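(* As $\delta\searrow0$, the functionals $F_\delta:L^2(\Omega)\to\mathbb{R}\cup\{+\infty\}$, $F_\delta(u)=\mathbb{I}_{B_{L^{\infty,2}(\Omega_\delta\times\Omega_\delta)}}(\mathcal{G}_\delta u)-\ell(u)$, $\Gamma$-converge (with respect to convergence in $L^2(\Omega)$) to $F_0:L^2(\Omega)\to\mathbb{R}\cup\{+\infty\}$ defined by $F_0(u)=-\ell(u)$ if $u\in W^{1,\infty}_0(\Omega)$ and $\|\nabla u\|_{L^\infty(\Omega)}\le1$, and $F_0(u)=+\infty$ otherwise.
   Context: $n\ge2$, $\Omega\subset\mathbb{R}^n$ is a bounded connected open set with Lipschitz boundary, $f\in L^2(\Omega)$, $\ell(u)=\int_\Omega fu\,dx$. For $\delta>0$ (small), $\Omega_\delta=\bigcup_{x\in\Omega}B(x,\delta)$ and $\omega_\delta:\mathbb{R}^n\to[0,\infty)$ is radial, measurable, supported in $B(0,\delta)$, with $\int|z|^2\omega_\delta^2(z)dz=K_{2,n}^{-1}$, $K_{2,n}=|\mathbb{S}^{n-1}|^{-1}\int_{\mathbb{S}^{n-1}}|s\cdot e|^2ds$. Functions on $\Omega$ are extended by zero; $\mathcal{G}_\delta u(x,x')=[u(x)-u(x')]\omega_\delta(x-x')$ on $\Omega_\delta\times\Omega_\delta$. $B_{L^{\infty,2}}$ is the closed unit ball of the mixed-norm space $L^{\infty,2}(\Omega_\delta\times\Omega_\delta)$ with norm $\operatorname{ess\,sup}_x(\int_{\Omega_\delta}|\ddot p(x,x')|^2dx')^{1/2}$; $\mathbb{I}_S$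 is the indicator function ($0$ on $S$, $+\infty$ off $S$, in particular $+\infty$ if $\mathcal{G}_\delta u\notin L^{\infty,2}$). $W^{1,\infty}_0(\Omega)$: functions in $W^{1,\infty}(\Omega)$ whose zero extension is in $W^{1,\infty}(\mathbb{R}^n)$. *)

theory Defs
  imports "HOL-Analysis.Analysis"
begin

definition zext :: "'a set \<Rightarrow> ('a \<Rightarrow> real) \<Rightarrow> 'a \<Rightarrow> real" where
  "zext \<Omega> u = (\<lambda>x. if x \<in> \<Omega> then u x else 0)"

definition L2 :: "'a::euclidean_space set \<Rightarrow> ('a \<Rightarrow> real) \<Rightarrow> bool" where
  "L2 \<Omega> u \<longleftrightarrow> u \<in> borel_measurable (lebesgue_on \<Omega>) \<and>
                 integrable (lebesgue_on \<Omega>) (\<lambda>x. (u x)\<^sup>2)"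

definition L2_conv :: "'a::euclidean_space set \<Rightarrow> (nat \<Rightarrow> 'a \<Rightarrow> real) \<Rightarrow> ('a \<Rightarrow> real) \<Rightarrow> bool" where
  "L2_conv \<Omega> us u \<longleftrightarrow>
     ((\<lambda>k. \<integral>\<^sup>+ x. ennreal ((us k x - u x)\<^sup>2) \<partial>(lebesgue_on \<Omega>)) \<longlonglongrightarrow> 0)"

definition lipschitz_boundary :: "'a::euclidean_space set \<Rightarrow> bool" where
  "lipschitz_boundary \<Omega> \<longleftrightarrow>
     (\<forall>p\<in>frontier \<Omega>. \<exists>e U g L. norm e = 1 \<and> open U \<and> p \<in> U \<and>
        L-lipschitz_on UNIV g \<and> (\<forall>y. g y = g (y - (y \<bullet> e) *\<^sub>R e)) \<and>
        \<Omega> \<inter> U = {y\<in>U. y \<bullet> e < g y})"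

definition nbhd :: "'a::metric_space set \<Rightarrow> real \<Rightarrow> 'a set" where
  "nbhd \<Omega> \<delta> = (\<Union>x\<in>\<Omega>. ball x \<delta>)"

text \<open>K_{2,n} = |S^{n-1}|^{-1} \<integral>_{S^{n-1}} |s.e|^2 ds, whose value is 1/n.\<close>
definition K2 :: "nat \<Rightarrow> real" where
  "K2 n = 1 / real n"

definition admissible_kernel :: "real \<Rightarrow> ('a::euclidean_space \<Rightarrow> real) \<Rightarrow> bool" where
  "admissible_kernel \<delta> w \<longleftrightarrow>
     w \<in> borel_measurable lebesgue \<and>
     (\<forall>z. w z \<ge> 0) \<and>
     (\<forall>z w'. norm z = norm w' \<longrightarrow> w z = w w') \<and>
     (\<forall>z. w z \<noteq> 0 \<longrightarrow> z \<in> ball 0 \<delta>) \<and>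
     (\<integral>\<^sup>+ z. ennreal ((norm z)\<^sup>2 * (w z)\<^sup>2) \<partial>lebesgue) = ennreal (1 / K2 DIM('a))"

definition Gdelta :: "'a::euclidean_space set \<Rightarrow> ('a \<Rightarrow> real) \<Rightarrow> ('a \<Rightarrow> real) \<Rightarrow> 'a \<Rightarrow> 'a \<Rightarrow> real" where
  "Gdelta \<Omega> w u x x' = (zext \<Omega> u x - zext \<Omega> u x') * w (x - x')"

definition in_unit_ball_Linf2 :: "'a::euclidean_space set \<Rightarrow> ('a \<Rightarrow> 'a \<Rightarrow> real) \<Rightarrow> bool" where
  "in_unit_ball_Linf2 A p \<longleftrightarrow>
     (AE x in lebesgue_on A. (\<integral>\<^sup>+ x'. ennreal ((p x x')\<^sup>2) \<partial>(lebesgue_on A)) \<le> 1)"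

definition Fdelta :: "'a::euclidean_space set \<Rightarrow> ('a \<Rightarrow> real) \<Rightarrow> real \<Rightarrow> ('a \<Rightarrow> real) \<Rightarrow> ('a \<Rightarrow> real) \<Rightarrow> ereal" where
  "Fdelta \<Omega> f \<delta> w u =
     (if in_unit_ball_Linf2 (nbhd \<Omega> \<delta>) (Gdelta \<Omega> w u)
      then ereal (- (\<integral>x. f x * u x \<partial>(lebesgue_on \<Omega>))) else \<infinity>)"

coinductive smooth :: "('a::euclidean_space \<Rightarrow> real) \<Rightarrow> bool" where
  "(\<forall>x. f differentiable (at x)) \<Longrightarrow>
   (\<forall>i\<in>Basis. smooth (\<lambda>x. frechet_derivative f (at x) i)) \<Longrightarrow> smooth f"

definition test_function :: "('a::euclidean_space \<Rightarrow> real) \<Rightarrow> bool" where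
  "test_function \<phi> \<longleftrightarrow> smooth \<phi> \<and> compact (closure {x. \<phi> x \<noteq> 0})"

definition ess_bounded :: "('a::euclidean_space \<Rightarrow> 'b::real_normed_vector) \<Rightarrow> bool" where
  "ess_bounded v \<longleftrightarrow> (\<exists>C. AE x in lebesgue. norm (v x) \<le> C)"

definition weak_gradient :: "('a::euclidean_space \<Rightarrow> real) \<Rightarrow> ('a \<Rightarrow> 'a) \<Rightarrow> bool" where
  "weak_gradient v g \<longleftrightarrow>
     v \<in> borel_measurable lebesgue \<and> g \<in> borel_measurable lebesgue \<and>
     (\<forall>\<phi>. test_function \<phi> \<longrightarrow> (\<forall>i\<in>Basis.
        integrable lebesgue (\<lambda>x. v x * frechet_derivative \<phi> (at x) i) \<and>
        integrable lebesgue (\<lambda>x. (g x \<bullet> i) * \<phi> x) \<and>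
        (\<integral>x. v x * frechet_derivative \<phi> (at x) i \<partial>lebesgue) =
          - (\<integral>x. (g x \<bullet> i) * \<phi> x \<partial>lebesgue)))"

text \<open>u \<in> W^{1,\<infinity>}_0(Omega) (zero extension in W^{1,\<infinity>}(R^n)) and
  ||\<nabla>u||_{L^\<infinity>(Omega)} \<le> 1 (Euclidean norm of the gradient).\<close>
definition W1inf0_unit :: "'a::euclidean_space set \<Rightarrow> ('a \<Rightarrow> real) \<Rightarrow> bool" where
  "W1inf0_unit \<Omega> u \<longleftrightarrow>
     (\<exists>g. weak_gradient (zext \<Omega> u) g \<and> ess_bounded (zext \<Omega> u) \<and> ess_bounded g \<and>
          (AE x in lebesgue_on \<Omega>. norm (g x) \<le> 1))"

definition F0 :: "'a::euclidean_space set \<Rightarrow> ('a \<Rightarrow> real) \<Rightarrow> ('a \<Rightarrow> real) \<Rightarrow> ereal" where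
  "F0 \<Omega> f u = (if W1inf0_unit \<Omega> u then ereal (- (\<integral>x. f x * u x \<partial>(lebesgue_on \<Omega>))) else \<infinity>)"

definition Gamma_conv_L2 :: "'a::euclidean_space set \<Rightarrow> (real \<Rightarrow> ('a \<Rightarrow> real) \<Rightarrow> ereal) \<Rightarrow> (('a \<Rightarrow> real) \<Rightarrow> ereal) \<Rightarrow> bool" where
  "Gamma_conv_L2 \<Omega> F G \<longleftrightarrow>
     (\<forall>\<delta>s :: nat \<Rightarrow> real. (\<forall>k. \<delta>s k > 0) \<longrightarrow> \<delta>s \<longlonglongrightarrow> 0 \<longrightarrow>
        (\<forall>u. L2 \<Omega> u \<longrightarrow>
           (\<forall>us. (\<forall>k. L2 \<Omega> (us k)) \<longrightarrow> L2_conv \<Omega> us u \<longrightarrow>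
                 G u \<le> liminf (\<lambda>k. F (\<delta>s k) (us k))) \<and>
           (\<exists>us. (\<forall>k. L2 \<Omega> (us k)) \<and> L2_conv \<Omega> us u \<and>
                 limsup (\<lambda>k. F (\<delta>s k) (us k)) \<le> G u)))"

end

theory Submission
  imports Defs
begin

text \<open>
  Lower bound. Radiality and the normalisation give \<open>\<integral> (a \<bullet> z)\<^sup>2 \<omega>\<^sup>2 = |a|\<^sup>2\<close>. Hence, for a unit
  vector \<open>e\<close>, \<open>2ab \<le> a\<^sup>2 + b\<^sup>2\<close> turns the quadratic constraint into the linear one
  \<open>\<integral> (u x - u (x - z)) (e \<bullet> z) \<omega>\<^sup>2 z dz \<le> 1\<close>, which survives mollification; a Taylor expansion then
  shows that mollifications of the limit have gradient at most one. Convex combinations of these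
  mollifications whose gradients converge almost everywhere provide the weak gradient.

  Recovery sequence. A function in the limit class has a Lipschitz representative \<open>V\<close>; the Lipschitz
  boundary makes it vanish off \<open>\<Omega>\<close>, and the gradient bound inside \<open>\<Omega>\<close> then makes it globally
  1-Lipschitz. The soft threshold of \<open>V\<close> has compact support in \<open>\<Omega>\<close>. Using \<open>V\<close> itself would
  cost a factor \<open>n\<close> in the constraint, but for a mollified function \<open>w\<close> with second-order remainder
  the nonlocal energy is at most \<open>1 + O(\<delta>)\<close>, and rescaling \<open>w\<close> makes it admissible.
\<close>

section \<open>Smooth functions and a smooth bump\<close>

text \<open>The term with \<open>f\<close> is continuous under L2 convergence, so everything is
  decided by the constraint sets: a limit of admissible functions, even along a subsequence, must
  lie in the limit class, and every member of that class must be a limit of admissible functions.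
  The factor n arises because a Lipschitz bound only gives (V x - V (x - z))^2 \<le> |z|^2, whose
  integral against the squared kernel is n, while a linear increment a . z costs |a|^2. Isotropy
  therefore pays only where increments are linear to first order, which is why smoothing is
  expressed throughout by a uniform quadratic Taylor remainder; multiplied by one further factor |z|
  < \<delta> it disappears in the limit. Two obstacles shape the set-up. Kernels and functions are
  only Lebesgue measurable and matter up to null sets, whereas Fubini and translations are used on
  \<open>lborel\<close>; hence the Borel representatives and the reformulation of the constraint on
  the whole space. And \<open>smooth\<close> is coinductive, so a bump function has to be found
  inside an explicit family closed under partial derivatives.\<close>

lemma smooth_differentiable: "smooth f \<Longrightarrow> f differentiable (at x)"
  by (auto elim: smooth.cases)

lemma smooth_partial: "smooth f \<Longrightarrow> i \<in> Basis \<Longrightarrow> smooth (\<lambda>x. frechet_derivative f (at x) i)"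
  by (auto elim: smooth.cases)

lemma smooth_continuous_on: "smooth f \<Longrightarrow> continuous_on A f"
  by (simp add: smooth_differentiable continuous_at_imp_continuous_on differentiable_imp_continuous_within)

text \<open>Coinduction with explicitly given derivatives: uniqueness of the derivative replaces
  \<open>frechet_derivative\<close> by any formula for it, so a family only has to be closed under
  the partial derivatives written down.\<close>

lemma smooth_coinduct_derivative:
  assumes "X f"
    and step: "\<And>f. X f \<Longrightarrow> \<exists>f'. (\<forall>x. (f has_derivative f' x) (at x)) \<and> (\<forall>i\<in>Basis. X (\<lambda>x. f' x i))"
  shows "smooth f"
  using \<open>X f\<close>
proof (coinduction arbitrary: f)
  case smooth
  then obtain f' where f': "\<And>x. (f has_derivative f' x) (at x)" and X: "\<forall>i\<in>Basis. X (\<lambda>x. f' x i)"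
    using step by blast
  have "frechet_derivative f (at x) = f' x" for x
    using frechet_derivative_at[OF f'] by simp
  then show ?case
    using f' X by (auto simp: differentiable_def)
qed

text \<open>The factor \<open>c\<close> belongs to the family because each chain rule contributes a
  factor \<open>t\<close>, which it absorbs.\<close>

lemma smooth_affine:
  fixes f :: "'a::euclidean_space \<Rightarrow> real"
  assumes "smooth f"
  shows "smooth (\<lambda>x. c * f (a + t *\<^sub>R x))"
proof (rule smooth_coinduct_derivative[where X = "\<lambda>g. \<exists>c f. smooth f \<and> g = (\<lambda>x. c * f (a + t *\<^sub>R x))"])
  show "\<exists>c' f'. smooth f' \<and> (\<lambda>x. c * f (a + t *\<^sub>R x)) = (\<lambda>x. c' * f' (a + t *\<^sub>R x))"
    using assms by blast
  fix g :: "'a \<Rightarrow> real" assume "\<exists>c f. smooth f \<and> g = (\<lambda>x. c * f (a + t *\<^sub>R x))"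
  then obtain c h where h: "smooth h" and g: "g = (\<lambda>x. c * h (a + t *\<^sub>R x))"
    by auto
  define h' where "h' x = frechet_derivative h (at x)" for x
  have h': "(h has_derivative h' x) (at x)" for x
    using smooth_differentiable[OF h] by (simp add: h'_def frechet_derivative_works)
  have "((\<lambda>x. h (a + t *\<^sub>R x)) has_derivative (\<lambda>v. h' (a + t *\<^sub>R x) (t *\<^sub>R v))) (at x)" for x
    by (rule has_derivative_compose[OF _ h', where f="\<lambda>x. a + t *\<^sub>R x", unfolded o_def]) (auto intro!: derivative_eq_intros)
  then have "(g has_derivative (\<lambda>v. c * h' (a + t *\<^sub>R x) (t *\<^sub>R v))) (at x)" for x
    unfolding g by (rule has_derivative_mult_right)
  moreover have "h' y (t *\<^sub>R v) = t * h' y v" for y v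
    using has_derivative_linear[OF h'] by (metis linear_scale real_scaleR_def)
  ultimately have g': "(g has_derivative (\<lambda>v. (c * t) * h' (a + t *\<^sub>R x) v)) (at x)" for x
    by (simp add: mult.assoc)
  show "\<exists>g'. (\<forall>x. (g has_derivative g' x) (at x)) \<and>
     (\<forall>i\<in>Basis. \<exists>c f. smooth f \<and> (\<lambda>x. g' x i) = (\<lambda>x. c * f (a + t *\<^sub>R x)))"
    using g' smooth_partial[OF h] unfolding h'_def[symmetric]
    by (intro exI[of _ "\<lambda>x v. (c * t) * h' (a + t *\<^sub>R x) v"]) blast
qed

text \<open>Serves at the two places where a derivative is known only through a remainder: the bump
  on and beyond the unit sphere, and functions with a \<open>c11\<close> bound.\<close>

lemma has_derivative_quadratic_bound:
  fixes f :: "'a::real_normed_vector \<Rightarrow> 'b::real_normed_vector"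
  assumes "bounded_linear f'" and bound: "\<And>y. norm (f y - f x - f' (y - x)) \<le> C * (norm (y - x))\<^sup>2"
  shows "(f has_derivative f') (at x)"
  unfolding has_derivative_at2
proof (intro conjI)
  have "((\<lambda>y. C * norm (y - x)) \<longlongrightarrow> C * norm (x - x)) (at x)"
    by (intro tendsto_intros)
  then have *: "((\<lambda>y. C * norm (y - x)) \<longlongrightarrow> 0) (at x)"
    by simp
  have le: "norm ((1 / norm (y - x)) *\<^sub>R (f y - (f x + f' (y - x)))) \<le> C * norm (y - x)" for y
  proof (cases "y = x")
    case False
    then have "norm (f y - (f x + f' (y - x))) / norm (y - x) \<le> C * norm (y - x)"
      using bound[of y] by (simp add: divide_le_eq power2_eq_square diff_diff_add)
    then show ?thesis
      by simp
  qed simp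
  show "((\<lambda>y. (1 / norm (y - x)) *\<^sub>R (f y - (f x + f' (y - x)))) \<longlongrightarrow> 0) (at x)"
    by (rule Lim_null_comparison[OF _ *]) (use le in auto)
qed fact

text \<open>Closure of polynomials under directional derivatives, needed so that the bump family
  below is closed under differentiation.\<close>

lemma real_polynomial_function_has_derivative:
  fixes p :: "'a::euclidean_space \<Rightarrow> real"
  assumes "real_polynomial_function p"
  shows "\<exists>p'. (\<forall>x. (p has_derivative p' x) (at x)) \<and> (\<forall>v. real_polynomial_function (\<lambda>x. p' x v))"
  using assms
proof induction
  case (linear f)
  then show ?case
    by (intro exI[of _ "\<lambda>_. f"]) (auto intro: bounded_linear_imp_has_derivative)
next
  case (const c)
  show ?case
    by (intro exI[of _ "\<lambda>_ _. 0"]) auto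
next
  case (add f g)
  then obtain f' g' where "\<forall>x. (f has_derivative f' x) (at x)" "\<forall>v. real_polynomial_function (\<lambda>x. f' x v)"
    "\<forall>x. (g has_derivative g' x) (at x)" "\<forall>v. real_polynomial_function (\<lambda>x. g' x v)"
    by blast
  then show ?case
    by (intro exI[of _ "\<lambda>x v. f' x v + g' x v"]) (auto intro: has_derivative_add)
next
  case (mult f g)
  then obtain f' g' where "\<forall>x. (f has_derivative f' x) (at x)" "\<forall>v. real_polynomial_function (\<lambda>x. f' x v)"
    "\<forall>x. (g has_derivative g' x) (at x)" "\<forall>v. real_polynomial_function (\<lambda>x. g' x v)"
    by blast
  with mult.hyps show ?case
    by (intro exI[of _ "\<lambda>x v. f x * g' x v + f' x v * g x"]) (auto intro!: has_derivative_mult real_polynomial_function.intros(3,4))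
qed

text \<open>Keep the single term of index \<open>k + 2\<close> in the exponential series. The
  surplus 2 turns, for s = 1/t, into a factor t^2, which is the quadratic decay that
  differentiability at the sphere asks for.\<close>

lemma power_mult_exp_minus_le:
  fixes s :: real
  assumes "s > 0"
  shows "s ^ k * exp (- s) \<le> fact (k + 2) * (1 / s)\<^sup>2"
proof -
  have "(\<lambda>n. s ^ n / fact n) sums exp s"
    using exp_converges[of s] by (simp add: divide_inverse mult.commute)
  then have "(\<Sum>n\<in>{k + 2}. s ^ n / fact n) \<le> exp s"
    using assms sum_le_suminf[of "\<lambda>n. s ^ n / fact n" "{k + 2}"] by (auto simp: sums_iff)
  then have "s ^ (k + 2) \<le> exp s * fact (k + 2)"
    by (simp add: divide_le_eq)
  then have "s ^ k * s\<^sup>2 * exp (- s) \<le> exp s * fact (k + 2) * exp (- s)"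
    unfolding power_add by (intro mult_right_mono) auto
  then have "s ^ k * s\<^sup>2 * exp (- s) \<le> fact (k + 2)"
    by (simp add: exp_minus field_simps)
  then show ?thesis
    using assms by (simp add: field_simps)
qed

text \<open>With t = 1 - |x|^2 these are the functions p t^(-k) exp (-1/t), extended by zero. The
  usual bump is p = 1, k = 0; polynomials and negative powers of t are what its derivatives
  generate.\<close>

definition bump_factor :: "('a::euclidean_space \<Rightarrow> real) \<Rightarrow> nat \<Rightarrow> 'a \<Rightarrow> real" where
  "bump_factor p k x = (if norm x < 1 then p x * (1 / (1 - x \<bullet> x)) ^ k * exp (- (1 / (1 - x \<bullet> x))) else 0)"

lemma norm_less_1_inner: "norm (x::'a::real_inner) < 1 \<Longrightarrow> 0 < 1 - x \<bullet> x"
  by (simp add: power2_norm_eq_inner[symmetric] abs_square_less_1)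

text \<open>If \<open>x\<close> is outside the open unit ball then 1 - |y|^2 = (1 - |y|)(1 + |y|) is
  at most twice |y - x|; the quadratic decay in this quantity becomes decay in the distance.\<close>

lemma bump_factor_bound:
  fixes p :: "'a::euclidean_space \<Rightarrow> real"
  assumes "real_polynomial_function p"
  shows "\<exists>C. \<forall>x y. norm x \<ge> 1 \<longrightarrow> \<bar>bump_factor p k y\<bar> \<le> C * (norm (y - x))\<^sup>2"
proof -
  have "compact (p ` cball 0 1)"
    using assms by (intro compact_continuous_image) (auto simp: real_polynomial_function_eq continuous_on_polymonial_function)
  then obtain B where B: "\<And>y. y \<in> cball 0 1 \<Longrightarrow> \<bar>p y\<bar> \<le> B"
    by (meson bounded_real compact_imp_bounded image_eqI)
  then have "B \<ge> 0"
    using order_trans[OF abs_ge_zero B[of 0]] by simp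
  have "\<bar>bump_factor p k y\<bar> \<le> (4 * B * fact (k + 2)) * (norm (y - x))\<^sup>2" if x: "norm x \<ge> 1" for x y :: 'a
  proof (cases "norm y < 1")
    case True
    define t where "t = 1 - y \<bullet> y"
    have t: "t > 0"
      using norm_less_1_inner[OF True] by (simp add: t_def)
    have "t = (1 - norm y) * (1 + norm y)"
      by (simp add: t_def power2_norm_eq_inner[symmetric] algebra_simps power2_eq_square)
    also have "\<dots> \<le> norm (y - x) * 2"
    proof (intro mult_mono)
      show "1 - norm y \<le> norm (y - x)"
        using x norm_triangle_ineq3[of y x] by linarith
    qed (use True in auto)
    finally have t2: "t\<^sup>2 \<le> (norm (y - x) * 2)\<^sup>2"
      using t by (intro power_mono) auto
    have "\<bar>bump_factor p k y\<bar> = \<bar>p y\<bar> * ((1 / t) ^ k * exp (- (1 / t)))"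
      using True t by (simp add: bump_factor_def t_def[symmetric] abs_mult)
    also have "\<dots> \<le> B * (fact (k + 2) * t\<^sup>2)"
      using B[of y] True power_mult_exp_minus_le[of "1 / t" k] t by (intro mult_mono[of "\<bar>p y\<bar>" B]) auto
    also have "\<dots> \<le> B * (fact (k + 2) * (norm (y - x) * 2)\<^sup>2)"
      using t2 \<open>B \<ge> 0\<close> by (intro mult_left_mono) auto
    finally show ?thesis
      by (simp only: power_mult_distrib mult_ac power2_eq_square[of 2])
  qed (use \<open>B \<ge> 0\<close> in \<open>simp add: bump_factor_def\<close>)
  then show ?thesis
    by blast
qed

text \<open>The three summands come from differentiating p, the power and the exponential, put over
  the common factor t^(-(k+2)). Off the open ball both sides vanish and the quadratic bound takes
  over.\<close>

lemma bump_factor_has_derivative: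
  fixes p :: "'a::euclidean_space \<Rightarrow> real"
  assumes p: "real_polynomial_function p" and p': "\<And>x. (p has_derivative p' x) (at x)"
  shows "(bump_factor p k has_derivative
     (\<lambda>v. bump_factor (\<lambda>x. p' x v * (1 - x \<bullet> x)\<^sup>2 + 2 * real k * (x \<bullet> v) * (1 - x \<bullet> x) * p x - 2 * (x \<bullet> v) * p x) (k + 2) x)) (at x)"
proof (cases "norm x < 1")
  case True
  define t where "t = 1 - x \<bullet> x"
  have t: "t > 0"
    using norm_less_1_inner[OF True] by (simp add: t_def)
  have "((\<lambda>x. p x * (1 / (1 - x \<bullet> x)) ^ k * exp (- (1 / (1 - x \<bullet> x)))) has_derivative
     (\<lambda>v. (p' x v * (1 - x \<bullet> x)\<^sup>2 + 2 * real k * (x \<bullet> v) * (1 - x \<bullet> x) * p x - 2 * (x \<bullet> v) * p x)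
        * (1 / (1 - x \<bullet> x)) ^ (k + 2) * exp (- (1 / (1 - x \<bullet> x))))) (at x)"
    using t unfolding t_def
    apply (auto intro!: derivative_eq_intros p' simp: t_def[symmetric])
    apply (rule ext)
    \<comment> \<open>The power rule leaves the exponent \<open>k - 1\<close>, which is truncated
      when \<open>k\<close> is 0.\<close>
    apply (cases k)
    apply (auto simp: field_simps inner_commute power2_eq_square)
    done
  then have "(bump_factor p k has_derivative
     (\<lambda>v. (p' x v * (1 - x \<bullet> x)\<^sup>2 + 2 * real k * (x \<bullet> v) * (1 - x \<bullet> x) * p x - 2 * (x \<bullet> v) * p x)
        * (1 / (1 - x \<bullet> x)) ^ (k + 2) * exp (- (1 / (1 - x \<bullet> x))))) (at x)"
    by (rule has_derivative_transform_within_open[where s="ball 0 1"]) (use True in \<open>auto simp: bump_factor_def\<close>)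
  then show ?thesis
    using True by (simp add: bump_factor_def)
next
  case False
  obtain C where C: "\<And>x y. norm x \<ge> 1 \<Longrightarrow> \<bar>bump_factor p k y\<bar> \<le> C * (norm (y - x))\<^sup>2"
    using bump_factor_bound[OF p] by blast
  have "(bump_factor p k has_derivative (\<lambda>v. 0)) (at x)"
    using C[of x] False by (intro has_derivative_quadratic_bound) (auto simp: bump_factor_def[of _ _ x])
  then show ?thesis
    using False by (simp add: bump_factor_def)
qed

lemma smooth_bump_factor:
  assumes "real_polynomial_function p"
  shows "smooth (bump_factor p k)"
proof (rule smooth_coinduct_derivative[where X = "\<lambda>f. \<exists>p k. real_polynomial_function p \<and> f = bump_factor p k"])
  show "\<exists>q l. real_polynomial_function q \<and> bump_factor p k = bump_factor q l"
    using assms by blast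
  fix f :: "'a \<Rightarrow> real" assume "\<exists>p k. real_polynomial_function p \<and> f = bump_factor p k"
  then obtain p k where p: "real_polynomial_function p" and f: "f = bump_factor p k"
    by blast
  obtain p' where p': "\<And>x. (p has_derivative p' x) (at x)" and poly: "\<And>v. real_polynomial_function (\<lambda>x. p' x v)"
    using real_polynomial_function_has_derivative[OF p] by blast
  have inner: "real_polynomial_function (\<lambda>x::'a. x \<bullet> v)" for v
    by (intro real_polynomial_function.intros(1) bounded_linear_inner_left)
  have "(\<lambda>x::'a. x \<bullet> x) = (\<lambda>x. \<Sum>i\<in>Basis. (x \<bullet> i) * (x \<bullet> i))"
    by (rule ext) (rule euclidean_inner)
  then have sq: "real_polynomial_function (\<lambda>x::'a. x \<bullet> x)"
    using inner by (auto intro!: real_polynomial_function_sum)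
  show "\<exists>f'. (\<forall>x. (f has_derivative f' x) (at x)) \<and>
     (\<forall>i\<in>Basis. \<exists>p k. real_polynomial_function p \<and> (\<lambda>x. f' x i) = bump_factor p k)"
    unfolding f
    apply (intro exI conjI allI ballI)
      apply (rule bump_factor_has_derivative[OF p p'])
     \<comment> \<open>The equation goes first: unification reads the polynomial and the exponent
       off it before the polynomial is checked.\<close>
     prefer 2
     apply (rule ext)
     apply (rule refl)
    by (intro real_polynomial_function_diff real_polynomial_function.intros(2-) real_polynomial_function_power poly p inner sq)
qed

section \<open>Test functions and quadratic remainders\<close>

definition grad :: "('a::euclidean_space \<Rightarrow> real) \<Rightarrow> 'a \<Rightarrow> 'a" where
  "grad f x = (\<Sum>i\<in>Basis. frechet_derivative f (at x) i *\<^sub>R i)"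

lemma grad_inner_Basis: "i \<in> Basis \<Longrightarrow> grad f x \<bullet> i = frechet_derivative f (at x) i"
  by (simp add: grad_def inner_sum_left_Basis)

lemma frechet_derivative_eq_grad:
  assumes "f differentiable (at x)"
  shows "frechet_derivative f (at x) h = grad f x \<bullet> h"
proof -
  have "linear (frechet_derivative f (at x))"
    using assms by (rule linear_frechet_derivative)
  then have "frechet_derivative f (at x) (\<Sum>i\<in>Basis. (h \<bullet> i) *\<^sub>R i) = grad f x \<bullet> h"
    unfolding euclidean_inner[of "grad f x" h] linear_sum[OF \<open>linear _\<close>]
    by (intro sum.cong) (simp_all add: linear_scale grad_inner_Basis)
  then show ?thesis
    by (simp add: euclidean_representation)
qed

lemma test_function_continuous_on: "test_function \<phi> \<Longrightarrow> continuous_on A \<phi>"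
  by (simp add: test_function_def smooth_continuous_on)

lemma test_function_support:
  assumes "test_function \<phi>"
  obtains R where "R > 0" "\<And>x. norm x \<ge> R \<Longrightarrow> \<phi> x = 0"
proof -
  have "bounded {x. \<phi> x \<noteq> 0}"
    using assms bounded_subset[OF compact_imp_bounded closure_subset] unfolding test_function_def by blast
  then obtain B where "B > 0" and B: "\<And>x. \<phi> x \<noteq> 0 \<Longrightarrow> norm x \<le> B"
    by (auto simp: bounded_pos)
  show thesis
  proof (rule that[of "B + 1"])
    show "\<phi> x = 0" if "norm x \<ge> B + 1" for x
      using B[of x] that by fastforce
  qed (use \<open>B > 0\<close> in simp)
qed

lemma test_function_bounded:
  assumes "test_function \<phi>"
  obtains B where "B > 0" "\<And>x. \<bar>\<phi> x\<bar> \<le> B"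
proof -
  have "compact (\<phi> ` closure {x. \<phi> x \<noteq> 0})"
    using assms by (intro compact_continuous_image test_function_continuous_on) (auto simp: test_function_def)
  then obtain B where B: "B > 0" "\<And>x. x \<in> closure {x. \<phi> x \<noteq> 0} \<Longrightarrow> \<bar>\<phi> x\<bar> \<le> B"
    using compact_imp_bounded[of "\<phi> ` closure {x. \<phi> x \<noteq> 0}"] by (auto simp: bounded_pos)
  show thesis
  proof (rule that[OF \<open>B > 0\<close>])
    show "\<bar>\<phi> x\<bar> \<le> B" for x
      using B closure_subset[of "{x. \<phi> x \<noteq> 0}"] by (cases "\<phi> x = 0") auto
  qed
qed

text \<open>Off the closure of its support a test function is zero on an open set, so its derivative
  vanishes there and the support does not grow.\<close>

lemma test_function_partial:
  assumes "test_function \<phi>" "i \<in> Basis"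
  shows "test_function (\<lambda>x. frechet_derivative \<phi> (at x) i)"
  unfolding test_function_def
proof (intro conjI)
  show "smooth (\<lambda>x. frechet_derivative \<phi> (at x) i)"
    using assms by (auto simp: test_function_def intro: smooth_partial)
  have "x \<in> closure {x. \<phi> x \<noteq> 0}" if "frechet_derivative \<phi> (at x) i \<noteq> 0" for x
  proof (rule ccontr)
    assume x: "x \<notin> closure {x. \<phi> x \<noteq> 0}"
    have "frechet_derivative \<phi> (at x) = frechet_derivative (\<lambda>x. 0) (at x)"
    proof (rule frechet_derivative_transform_within_open)
      show "open (- closure {x. \<phi> x \<noteq> 0})"
        by auto
      show "\<phi> y = 0" if "y \<in> - closure {x. \<phi> x \<noteq> 0}" for y
        using that closure_subset[of "{x. \<phi> x \<noteq> 0}"] by auto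
    qed (use x assms in \<open>auto simp: test_function_def smooth_differentiable\<close>)
    then show False
      using that by simp
  qed
  then have "closure {x. frechet_derivative \<phi> (at x) i \<noteq> 0} \<subseteq> closure {x. \<phi> x \<noteq> 0}"
    by (intro closure_minimal) auto
  then show "compact (closure {x. frechet_derivative \<phi> (at x) i \<noteq> 0})"
    using assms bounded_subset unfolding test_function_def compact_eq_bounded_closed by blast
qed

lemma norm_grad_le: "norm (grad f x) \<le> (\<Sum>i\<in>Basis. \<bar>frechet_derivative f (at x) i\<bar>)"
  unfolding grad_def by (rule order_trans[OF norm_sum]) simp

lemma test_function_has_derivative:
  assumes "test_function \<phi>"
  shows "(\<phi> has_derivative (\<lambda>h. grad \<phi> x \<bullet> h)) (at x)"
proof -
  have d: "\<phi> differentiable (at x)"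
    using assms by (simp add: test_function_def smooth_differentiable)
  then have "(\<phi> has_derivative frechet_derivative \<phi> (at x)) (at x)"
    by (simp only: frechet_derivative_works)
  then show ?thesis
    by (rule back_subst[of "\<lambda>f. (\<phi> has_derivative f) (at x)"]) (simp add: fun_eq_iff frechet_derivative_eq_grad[OF d])
qed

lemma onorm_inner_right_le:
  fixes a :: "'a::euclidean_space"
  assumes "norm a \<le> L"
  shows "onorm (\<lambda>h. a \<bullet> h) \<le> L"
proof (rule onorm_le)
  show "norm (a \<bullet> h) \<le> L * norm h" for h
    using order_trans[OF Cauchy_Schwarz_ineq2 mult_right_mono[OF assms norm_ge_zero]] by simp
qed

lemma test_function_grad_bounded:
  assumes "test_function \<phi>"
  obtains B where "B > 0" "\<And>x. norm (grad \<phi> x) \<le> B"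
proof -
  have "\<forall>i\<in>Basis. \<exists>B. \<forall>x. \<bar>frechet_derivative \<phi> (at x) i\<bar> \<le> B"
    using test_function_bounded[OF test_function_partial[OF assms]] by meson
  then obtain b where b: "\<And>i x. i \<in> Basis \<Longrightarrow> \<bar>frechet_derivative \<phi> (at x) i\<bar> \<le> b i"
    by metis
  show thesis
  proof (rule that[of "1 + \<bar>sum b Basis\<bar>"])
    show "norm (grad \<phi> x) \<le> 1 + \<bar>sum b Basis\<bar>" for x
      using norm_grad_le[of \<phi> x] sum_mono[of Basis "\<lambda>i. \<bar>frechet_derivative \<phi> (at x) i\<bar>" b] b by fastforce
  qed auto
qed

lemma test_function_lipschitz:
  assumes "test_function \<phi>"
  obtains B where "B > 0" "\<And>x y. \<bar>\<phi> x - \<phi> y\<bar> \<le> B * norm (x - y)"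
proof -
  obtain B where B: "B > 0" "\<And>x. norm (grad \<phi> x) \<le> B"
    using test_function_grad_bounded[OF assms] by blast
  have "norm (\<phi> x - \<phi> y) \<le> B * norm (x - y)" for x y
  proof (rule differentiable_bound[of UNIV])
    show "(\<phi> has_derivative (\<lambda>h. grad \<phi> x \<bullet> h)) (at x within UNIV)" for x
      using test_function_has_derivative[OF assms] by simp
    show "onorm ((\<bullet>) (grad \<phi> x)) \<le> B" for x
      using B by (intro onorm_inner_right_le)
  qed auto
  then show thesis
    using that[OF B(1)] by auto
qed

text \<open>On the whole space this amounts to a C^{1,1} condition. The Taylor form is chosen
  because it passes through integrals against a kernel and through averages, and because both energy
  estimates use exactly this remainder.\<close>

definition c11 :: "real \<Rightarrow> ('a::euclidean_space \<Rightarrow> real) \<Rightarrow> ('a \<Rightarrow> 'a) \<Rightarrow> bool" where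
  "c11 C w g \<longleftrightarrow> (\<forall>x h. \<bar>w (x + h) - w x - g x \<bullet> h\<bar> \<le> C * (norm h)\<^sup>2)"

lemma c11D: "c11 C w g \<Longrightarrow> \<bar>w (x + h) - w x - g x \<bullet> h\<bar> \<le> C * (norm h)\<^sup>2"
  by (simp add: c11_def)

lemma c11_has_derivative:
  assumes "c11 C w g"
  shows "(w has_derivative (\<lambda>h. g x \<bullet> h)) (at x)"
proof (intro has_derivative_quadratic_bound[where C=C] bounded_linear_inner_right)
  show "norm (w y - w x - g x \<bullet> (y - x)) \<le> C * (norm (y - x))\<^sup>2" for y
    using c11D[OF assms, of x "y - x"] by simp
qed

lemma c11_continuous: "c11 C w g \<Longrightarrow> continuous_on A w"
  by (meson c11_has_derivative continuous_at_imp_continuous_on has_derivative_continuous)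

lemma c11_nonneg:
  fixes g :: "'a::euclidean_space \<Rightarrow> 'a"
  assumes "c11 C w g"
  shows "C \<ge> 0"
proof -
  obtain b :: 'a where "b \<in> Basis"
    using nonempty_Basis by blast
  then show ?thesis
    using c11D[OF assms, of 0 b] by (simp add: order_trans[OF abs_ge_zero])
qed

text \<open>Compare the expansions at \<open>x\<close> and at \<open>y\<close> in the point
  \<open>y + h\<close>, with \<open>h\<close> parallel to \<open>g y - g x\<close> and as long as
  \<open>y - x\<close>. The three remainders contribute 4, 1 and 1 times C |y - x|^2, hence the
  6.\<close>

lemma c11_gradient_lipschitz:
  fixes g :: "'a::euclidean_space \<Rightarrow> 'a"
  assumes "c11 C w g"
  shows "norm (g y - g x) \<le> 6 * C * norm (y - x)"
proof (cases "g y = g x")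
  case False
  define d where "d = norm (y - x)"
  define h where "h = (d / norm (g y - g x)) *\<^sub>R (g y - g x)"
  have C: "C \<ge> 0"
    using c11_nonneg[OF assms] .
  have d: "d \<ge> 0" "y \<noteq> x"
    using False by (auto simp: d_def)
  then have "d > 0"
    by (simp add: d_def)
  have nh: "norm h = d"
    using d False by (simp add: h_def)
  have "norm (h + (y - x)) \<le> 2 * d"
    using norm_triangle_ineq[of h "y - x"] nh by (simp add: d_def)
  then have "C * (norm (h + (y - x)))\<^sup>2 \<le> C * (2 * d)\<^sup>2"
    using C by (intro mult_left_mono power_mono) auto
  then have "\<bar>w (y + h) - w x - g x \<bullet> (h + (y - x))\<bar> \<le> 4 * C * d\<^sup>2"
    using c11D[OF assms, of x "h + (y - x)"] by (simp add: power_mult_distrib add.commute)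
  moreover have "\<bar>w y - w x - g x \<bullet> (y - x)\<bar> \<le> C * d\<^sup>2"
    using c11D[OF assms, of x "y - x"] by (simp add: d_def)
  moreover have "\<bar>w (y + h) - w y - g y \<bullet> h\<bar> \<le> C * d\<^sup>2"
    using c11D[OF assms, of y h] by (simp add: nh)
  ultimately have "(g y - g x) \<bullet> h \<le> 6 * C * d\<^sup>2"
    by (simp add: inner_diff_left inner_add_right)
  moreover have "(g y - g x) \<bullet> h = d * norm (g y - g x)"
    using False by (simp add: h_def dot_square_norm power2_eq_square)
  ultimately have "d * norm (g y - g x) \<le> d * (6 * C * d)"
    by (simp add: power2_eq_square mult_ac)
  then show ?thesis
    using \<open>d > 0\<close> by (simp add: d_def)
qed (use c11_nonneg[OF assms] in simp)

lemma c11_gradient_continuous: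
  assumes "c11 C w g"
  shows "continuous_on A g"
proof (rule lipschitz_on_continuous_on)
  show "(6 * C)-lipschitz_on A g"
    using c11_gradient_lipschitz[OF assms] c11_nonneg[OF assms]
    by (intro lipschitz_onI) (auto simp: dist_norm)
qed

text \<open>The common limit argument: \<open>t\<close> will be a step length, a shift, the fraction
  of a segment left out, or a mollification width.\<close>

lemma affine_bound_at_0:
  fixes a b C :: real
  assumes "\<And>t. t > 0 \<Longrightarrow> a \<le> b + C * t"
  shows "a \<le> b"
proof (rule tendsto_lowerbound)
  have "((\<lambda>t. b + C * t) \<longlongrightarrow> b + C * 0) (at_right 0)"
    by (intro tendsto_intros)
  then show "((\<lambda>t. b + C * t) \<longlongrightarrow> b) (at_right 0)"
    by simp
  show "\<forall>\<^sub>F t in at_right 0. a \<le> b + C * t"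
    using assms by (auto simp: eventually_at_right_less eventually_at_filter)
qed auto

text \<open>Along the gradient direction the first-order expansion grows at rate
  \<open>norm (g x)\<close>, up to an error that is linear in the step after division.\<close>

lemma lipschitz_c11_gradient_le:
  assumes "c11 C w g" and lip: "\<And>x y. \<bar>w x - w y\<bar> \<le> L * norm (x - y)"
  shows "norm (g x) \<le> L"
proof (rule ccontr)
  assume "\<not> norm (g x) \<le> L"
  then have L: "L < norm (g x)" by simp
  \<comment> \<open>Normalising \<open>g x\<close> requires it to be nonzero; otherwise
    \<open>L\<close> would be negative, which contradicts \<open>lip\<close> at two distinct
    points.\<close>
  have "norm (g x) > 0"
  proof (rule ccontr)
    assume "\<not> norm (g x) > 0"
    then have "L < 0" using L by simp
    obtain b :: 'a where "b \<in> Basis"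
      using nonempty_Basis by blast
    then show False
      using lip[of b 0] \<open>L < 0\<close> by simp
  qed
  define e where "e = g x /\<^sub>R norm (g x)"
  have e: "norm e = 1" "g x \<bullet> e = norm (g x)"
    using \<open>norm (g x) > 0\<close> by (auto simp: e_def dot_square_norm power2_eq_square)
  have "norm (g x) \<le> L + C * t" if "t > 0" for t
  proof -
    have "\<bar>w (x + t *\<^sub>R e) - w x - t * norm (g x)\<bar> \<le> C * t\<^sup>2"
      using c11D[OF assms(1), of x "t *\<^sub>R e"] e that by simp
    moreover have "\<bar>w (x + t *\<^sub>R e) - w x\<bar> \<le> L * t"
      using lip[of "x + t *\<^sub>R e" x] e that by simp
    ultimately have "t * norm (g x) \<le> t * (L + C * t)"
      by (simp add: algebra_simps power2_eq_square)
    then show ?thesis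
      using that by simp
  qed
  then have "norm (g x) \<le> L"
    by (rule affine_bound_at_0)
  with L show False
    by simp
qed

text \<open>The gradient bound is asked for on the segment only, so that it can be used inside a
  domain that is not convex.\<close>

lemma c11_bounded_gradient_lipschitz:
  assumes "c11 C w g" and "\<And>z. z \<in> closed_segment x y \<Longrightarrow> norm (g z) \<le> L"
  shows "\<bar>w x - w y\<bar> \<le> L * norm (x - y)"
proof -
  have "norm (w x - w y) \<le> L * norm (x - y)"
  proof (rule differentiable_bound[of "closed_segment x y"])
    show "(w has_derivative (\<lambda>h. g z \<bullet> h)) (at z within closed_segment x y)" for z
      using c11_has_derivative[OF assms(1)] has_derivative_at_withinI by blast
    show "onorm ((\<bullet>) (g z)) \<le> L" if "z \<in> closed_segment x y" for z
      using assms(2)[OF that] by (intro onorm_inner_right_le)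
  qed auto
  then show ?thesis
    by simp
qed

text \<open>Apply the mean value inequality to \<open>\<phi>\<close> minus its linear part at
  \<open>x\<close>. The gradient of this difference is at most \<open>C * norm h\<close> on the
  segment, because every partial derivative is again a test function and hence Lipschitz.\<close>

lemma test_function_c11:
  assumes "test_function \<phi>"
  obtains C where "c11 C \<phi> (grad \<phi>)"
proof -
  have "\<forall>i\<in>Basis. \<exists>B. \<forall>x y. \<bar>frechet_derivative \<phi> (at x) i - frechet_derivative \<phi> (at y) i\<bar> \<le> B * norm (x - y)"
    using test_function_lipschitz[OF test_function_partial[OF assms]] by meson
  then obtain b where b: "\<And>i x y. i \<in> Basis \<Longrightarrow>
      \<bar>frechet_derivative \<phi> (at x) i - frechet_derivative \<phi> (at y) i\<bar> \<le> b i * norm (x - y)"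
    by metis
  define C where "C = sum b Basis"
  have C: "norm (grad \<phi> x - grad \<phi> y) \<le> C * norm (x - y)" for x y
  proof -
    have "norm (grad \<phi> x - grad \<phi> y) \<le> (\<Sum>i\<in>Basis. \<bar>frechet_derivative \<phi> (at x) i - frechet_derivative \<phi> (at y) i\<bar>)"
      unfolding grad_def sum_subtractf[symmetric] scaleR_diff_left[symmetric]
      by (rule order_trans[OF norm_sum]) simp
    also have "\<dots> \<le> (\<Sum>i\<in>Basis. b i * norm (x - y))"
      using b by (intro sum_mono)
    finally show ?thesis
      by (simp add: C_def sum_distrib_right)
  qed
  have "\<bar>\<phi> (x + h) - \<phi> x - grad \<phi> x \<bullet> h\<bar> \<le> C * (norm h)\<^sup>2" for x h
  proof -
    have "norm ((\<phi> (x + h) - grad \<phi> x \<bullet> (x + h)) - (\<phi> x - grad \<phi> x \<bullet> x)) \<le> (C * norm h) * norm ((x + h) - x)"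
    proof (rule differentiable_bound[where f="\<lambda>y. \<phi> y - grad \<phi> x \<bullet> y" and S="closed_segment x (x + h)"])
      fix y assume y: "y \<in> closed_segment x (x + h)"
      show "((\<lambda>y. \<phi> y - grad \<phi> x \<bullet> y) has_derivative (\<lambda>k. grad \<phi> y \<bullet> k - grad \<phi> x \<bullet> k)) (at y within closed_segment x (x + h))"
        using has_derivative_at_withinI[OF test_function_has_derivative[OF assms]]
        by (intro has_derivative_diff) (auto intro!: derivative_eq_intros)
      have "norm (y - x) \<le> norm h"
        using segment_bound(1)[OF y] by (simp add: norm_minus_commute)
      moreover have "C \<ge> 0"
        unfolding C_def
      proof (intro sum_nonneg)
        fix i :: 'a assume "i \<in> Basis"
        then show "b i \<ge> 0"
          using b[of i i 0] by (simp add: order_trans[OF abs_ge_zero])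
      qed
      ultimately have "norm (grad \<phi> y - grad \<phi> x) \<le> C * norm h"
        using C[of y x] by (meson mult_left_mono order_trans)
      then show "onorm (\<lambda>k. grad \<phi> y \<bullet> k - grad \<phi> x \<bullet> k) \<le> C * norm h"
        unfolding inner_diff_left[symmetric]
        by (intro onorm_inner_right_le)
    qed auto
    then show ?thesis
      by (simp add: inner_add_right power2_eq_square algebra_simps)
  qed
  then show thesis
    using that by (auto simp: c11_def)
qed

section \<open>Translations, reflections and mollification\<close>

lemma lborel_distr_minus:
  fixes x :: "'a::euclidean_space"
  shows "distr lborel borel (\<lambda>y. x - y) = lborel"
  by (subst (2) lborel_affine[of "- 1" x]) (auto simp: density_1)

lemma lborel_distr_translate:
  fixes x :: "'a::euclidean_space"
  shows "distr lborel borel (\<lambda>y. y - x) = lborel"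
  by (subst (2) lborel_distr_plus[of "- x", symmetric]) (rule distr_cong; simp)

lemma
  fixes f :: "'a::euclidean_space \<Rightarrow> 'b::{banach, second_countable_topology}"
  shows integrable_lborel_minus_iff: "f \<in> borel_measurable borel \<Longrightarrow> integrable lborel (\<lambda>y. f (x - y)) \<longleftrightarrow> integrable lborel f"
    and integral_lborel_minus: "f \<in> borel_measurable borel \<Longrightarrow> (LBINT y. f (x - y)) = (LBINT y. f y)"
    and integrable_lborel_translate_iff: "f \<in> borel_measurable borel \<Longrightarrow> integrable lborel (\<lambda>y. f (y - x)) \<longleftrightarrow> integrable lborel f"
    and integral_lborel_translate: "f \<in> borel_measurable borel \<Longrightarrow> (LBINT y. f (y - x)) = (LBINT y. f y)"
proof -
  assume [measurable]: "f \<in> borel_measurable borel"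
  show "integrable lborel (\<lambda>y. f (x - y)) \<longleftrightarrow> integrable lborel f"
    using integrable_distr_eq[of "\<lambda>y. x - y" lborel borel f] by (simp add: lborel_distr_minus)
  show "(LBINT y. f (x - y)) = (LBINT y. f y)"
    using integral_distr[of "\<lambda>y. x - y" lborel borel f] by (simp add: lborel_distr_minus)
  show "integrable lborel (\<lambda>y. f (y - x)) \<longleftrightarrow> integrable lborel f"
    using integrable_distr_eq[of "\<lambda>y. y - x" lborel borel f] by (simp add: lborel_distr_translate)
  show "(LBINT y. f (y - x)) = (LBINT y. f y)"
    using integral_distr[of "\<lambda>y. y - x" lborel borel f] by (simp add: lborel_distr_translate)
qed

lemma nn_integral_lborel_minus:
  fixes f :: "'a::euclidean_space \<Rightarrow> ennreal"
  assumes [measurable]: "f \<in> borel_measurable borel"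
  shows "(\<integral>\<^sup>+ y. f (x - y) \<partial>lborel) = (\<integral>\<^sup>+ y. f y \<partial>lborel)"
  using nn_integral_distr[of "\<lambda>y. x - y" lborel borel f] by (simp add: lborel_distr_minus)

lemma AE_lborel_minus:
  fixes x :: "'a::euclidean_space"
  assumes "AE y in lborel. P y"
  shows "AE y in lborel. P (x - y)"
proof -
  obtain N where N: "N \<in> null_sets lborel" "{y. \<not> P y} \<subseteq> N"
    using assms by (auto simp: eventually_ae_filter)
  then have "AE y in distr lborel borel (\<lambda>y. x - y). y \<notin> N"
    unfolding lborel_distr_minus by (intro AE_not_in)
  then have "AE y in lborel. x - y \<notin> N"
    using N by (subst (asm) AE_distr_iff) auto
  then show ?thesis
    by eventually_elim (use N in auto)
qed

lemma integrable_lborel_compact_support: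
  fixes f :: "'a::euclidean_space \<Rightarrow> 'b::{banach, second_countable_topology}"
  assumes "continuous_on UNIV f" "\<And>x. norm x > R \<Longrightarrow> f x = 0"
  shows "integrable lborel f"
proof -
  have "integrable lborel (\<lambda>x. indicator (cball 0 R) x *\<^sub>R f x)"
    using assms(1) by (intro borel_integrable_compact) (auto intro: continuous_on_subset)
  moreover have "(\<lambda>x. indicator (cball 0 R) x *\<^sub>R f x) = f"
    using assms(2) by (auto simp: fun_eq_iff indicator_def not_le)
  ultimately show ?thesis
    by simp
qed

lemma test_function_integrable: "test_function \<phi> \<Longrightarrow> integrable lborel \<phi>"
  using test_function_support[of \<phi>] integrable_lborel_compact_support[OF test_function_continuous_on, of \<phi>]
  by (meson less_imp_le)

lemma test_function_measurable [measurable_dest]: "test_function \<phi> \<Longrightarrow> \<phi> \<in> borel_measurable borel"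
  by (simp add: test_function_continuous_on borel_measurable_continuous_onI)

lemma test_function_grad_measurable [measurable_dest]: "test_function \<phi> \<Longrightarrow> grad \<phi> \<in> borel_measurable borel"
  using test_function_c11[of \<phi>] borel_measurable_continuous_onI[OF c11_gradient_continuous, of _ \<phi>] by blast

lemma test_function_affine:
  assumes "test_function \<phi>" "t \<noteq> 0"
  shows "test_function (\<lambda>x. c * \<phi> (a + t *\<^sub>R x))"
  unfolding test_function_def
proof
  show "smooth (\<lambda>x. c * \<phi> (a + t *\<^sub>R x))"
    using assms by (intro smooth_affine) (simp add: test_function_def)
  obtain R where R: "R > 0" "\<And>x. norm x \<ge> R \<Longrightarrow> \<phi> x = 0"
    using test_function_support[OF assms(1)] by blast
  have "norm x \<le> (R + norm a) / \<bar>t\<bar>" if "c * \<phi> (a + t *\<^sub>R x) \<noteq> 0" for x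
  proof -
    have "norm (a + t *\<^sub>R x) < R"
      using that R(2)[of "a + t *\<^sub>R x"] by (cases "norm (a + t *\<^sub>R x) < R") auto
    then have "\<bar>t\<bar> * norm x \<le> R + norm a"
      using norm_triangle_ineq2[of "t *\<^sub>R x" "- a"] by (simp add: add.commute)
    then show ?thesis
      using assms(2) by (simp add: field_simps)
  qed
  then have "bounded {x. c * \<phi> (a + t *\<^sub>R x) \<noteq> 0}"
    by (auto simp: bounded_iff)
  then show "compact (closure {x. c * \<phi> (a + t *\<^sub>R x) \<noteq> 0})"
    by simp
qed

text \<open>A predicate and not a rescaled family: only sign, mass and support are ever used, and a
  kernel of smaller width still counts as one of width \<open>\<epsilon>\<close>.\<close>

definition mollifier :: "real \<Rightarrow> ('a::euclidean_space \<Rightarrow> real) \<Rightarrow> bool" where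
  "mollifier \<epsilon> \<phi> \<longleftrightarrow> test_function \<phi> \<and> (\<forall>x. \<phi> x \<ge> 0) \<and> (\<forall>x. norm x \<ge> \<epsilon> \<longrightarrow> \<phi> x = 0) \<and> (LBINT x. \<phi> x) = 1"

lemma mollifierD:
  assumes "mollifier \<epsilon> \<phi>"
  shows "test_function \<phi>" "\<phi> x \<ge> 0" "norm x \<ge> \<epsilon> \<Longrightarrow> \<phi> x = 0" "(LBINT x. \<phi> x) = 1"
  using assms by (auto simp: mollifier_def)

lemma ex_mollifier:
  assumes "\<epsilon> > 0"
  shows "\<exists>\<phi> :: 'a::euclidean_space \<Rightarrow> real. mollifier \<epsilon> \<phi>"
proof -
  define b :: "'a \<Rightarrow> real" where "b = bump_factor (\<lambda>_. 1) 0"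
  have b: "b x \<ge> 0" "norm x \<ge> 1 \<Longrightarrow> b x = 0" "norm x < 1 \<Longrightarrow> b x > 0" for x
    by (auto simp: b_def bump_factor_def)
  have "bounded {x. b x \<noteq> 0}"
    using b(2) by (intro boundedI[where B=1]) (metis linear mem_Collect_eq)
  then have "test_function b"
    by (auto simp: test_function_def b_def intro!: smooth_bump_factor)
  define p where "p x = 1 * b (0 + (1 / \<epsilon>) *\<^sub>R x)" for x
  have p: "test_function p"
    unfolding p_def using assms \<open>test_function b\<close> by (intro test_function_affine) auto
  have p': "p x \<ge> 0" "norm x \<ge> \<epsilon> \<Longrightarrow> p x = 0" "p 0 > 0" for x
    using b assms by (auto simp: p_def field_simps)
  define I where "I = (LBINT x. p x)"
  \<comment> \<open>With zero mass the closed zero set would have full measure, hence be the whole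
    space, against \<open>p 0 > 0\<close>.\<close>
  have "I \<noteq> 0"
  proof
    assume "I = 0"
    then have "AE x in lborel. p x = 0"
      using integral_nonneg_eq_0_iff_AE[OF test_function_integrable[OF p]] p' by (simp add: I_def)
    then have "AE x in lebesgue. x \<in> {x. p x = 0}"
      by (simp add: AE_completion)
    moreover have "closed {x. p x = 0}"
      using test_function_continuous_on[OF p, of UNIV] by (intro closed_Collect_eq) auto
    ultimately have "0 \<in> {x. p x = 0}"
      by (rule mem_closed_if_AE_lebesgue[rotated])
    then show False
      using p' by simp
  qed
  moreover have "I \<ge> 0"
    unfolding I_def using p' by (intro integral_nonneg_AE) auto
  ultimately have I: "I > 0" by simp
  have "test_function (\<lambda>x. (1 / I) * p (0 + 1 *\<^sub>R x))"
    by (intro test_function_affine p) auto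
  then have "mollifier \<epsilon> (\<lambda>x. (1 / I) * p x)"
    using I p' integral_mult_right_zero[of lborel "1 / I" p] by (simp add: mollifier_def I_def[symmetric])
  then show ?thesis by blast
qed

text \<open>The kernel may be vector valued, so that the same notion covers
  \<open>moll \<phi> v\<close> and its gradient \<open>moll (grad \<phi>) v\<close>.\<close>

definition moll :: "('a::euclidean_space \<Rightarrow> 'b::euclidean_space) \<Rightarrow> ('a \<Rightarrow> real) \<Rightarrow> 'a \<Rightarrow> 'b" where
  "moll \<phi> v x = (LBINT y. v y *\<^sub>R \<phi> (x - y))"

lemma integrable_moll:
  fixes \<phi> :: "'a::euclidean_space \<Rightarrow> 'b::euclidean_space"
  assumes v: "integrable lborel v" and [measurable]: "\<phi> \<in> borel_measurable borel"
    and bound: "\<And>x. norm (\<phi> x) \<le> B"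
  shows "integrable lborel (\<lambda>y. v y *\<^sub>R \<phi> (x - y))"
proof (rule Bochner_Integration.integrable_bound)
  show "integrable lborel (\<lambda>y. B * norm (v y))"
    using v by auto
  have [measurable]: "v \<in> borel_measurable borel"
    using borel_measurable_integrable[OF v] by simp
  show "(\<lambda>y. v y *\<^sub>R \<phi> (x - y)) \<in> borel_measurable lborel"
    by measurable
  have "norm (v y *\<^sub>R \<phi> (x - y)) \<le> norm (B * norm (v y))" for y
    using mult_left_mono[OF order_trans[OF bound[of "x - y"] abs_ge_self], of "\<bar>v y\<bar>"] by (simp add: abs_mult mult.commute)
  then show "AE y in lborel. norm (v y *\<^sub>R \<phi> (x - y)) \<le> norm (B * norm (v y))"
    by simp
qed

lemma moll_norm_le:
  fixes \<phi> :: "'a::euclidean_space \<Rightarrow> 'b::euclidean_space"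
  assumes v: "integrable lborel v" and "\<phi> \<in> borel_measurable borel" and bound: "\<And>x. norm (\<phi> x) \<le> B"
  shows "norm (moll \<phi> v x) \<le> B * (LBINT y. norm (v y))"
proof -
  have "norm (moll \<phi> v x) \<le> (LBINT y. norm (v y *\<^sub>R \<phi> (x - y)))"
    unfolding moll_def by (rule integral_norm_bound)
  also have "\<dots> \<le> (LBINT y. B * norm (v y))"
    using v integrable_moll[OF assms] mult_left_mono[OF bound abs_ge_zero]
    by (intro integral_mono integrable_norm) (auto simp: mult.commute)
  finally show ?thesis
    by simp
qed

text \<open>Integrate the Taylor remainder of the kernel against \<open>v\<close>. All regularity
  comes from \<open>\<phi>\<close>; the function \<open>v\<close> contributes nothing but its L1
  norm to the constant.\<close>

lemma moll_c11:
  assumes v: "integrable lborel v" and \<phi>: "test_function \<phi>" and C: "c11 C \<phi> (grad \<phi>)"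
  shows "c11 (C * (LBINT y. norm (v y))) (moll \<phi> v) (moll (grad \<phi>) v)"
  unfolding c11_def
proof (intro allI)
  fix x h
  obtain B where "B > 0" and B: "\<And>x. norm (\<phi> x) \<le> B"
    using test_function_bounded[OF \<phi>, folded real_norm_def] by blast
  obtain B' where "B' > 0" and B': "\<And>x. norm (grad \<phi> x) \<le> B'"
    using test_function_grad_bounded[OF \<phi>] by blast
  note int = integrable_moll[OF v test_function_measurable[OF \<phi>] B] integrable_moll[OF v test_function_grad_measurable[OF \<phi>] B']
  have i3: "integrable lborel (\<lambda>y. (v y *\<^sub>R grad \<phi> (x - y)) \<bullet> h)"
    using int(2) by (rule integrable_inner_left)
  have rem: "moll \<phi> v (x + h) - moll \<phi> v x - moll (grad \<phi>) v x \<bullet> h =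
      (LBINT y. v y *\<^sub>R \<phi> (x + h - y) - v y *\<^sub>R \<phi> (x - y) - (v y *\<^sub>R grad \<phi> (x - y)) \<bullet> h)"
    unfolding moll_def Bochner_Integration.integral_diff[OF Bochner_Integration.integrable_diff[OF int(1) int(1)] i3]
      Bochner_Integration.integral_diff[OF int(1) int(1)] integral_inner_left[OF int(2)] ..
  have "\<bar>moll \<phi> v (x + h) - moll \<phi> v x - moll (grad \<phi>) v x \<bullet> h\<bar> \<le> (LBINT y. norm (v y *\<^sub>R \<phi> (x + h - y) - v y *\<^sub>R \<phi> (x - y) - (v y *\<^sub>R grad \<phi> (x - y)) \<bullet> h))"
    unfolding rem real_norm_def[symmetric] by (rule integral_norm_bound)
  also have "\<dots> \<le> (LBINT y. (C * (norm h)\<^sup>2) * norm (v y))"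
  proof (rule integral_mono)
    fix y
    have eq: "v y *\<^sub>R \<phi> (x + h - y) - v y *\<^sub>R \<phi> (x - y) - (v y *\<^sub>R grad \<phi> (x - y)) \<bullet> h
        = v y * (\<phi> ((x - y) + h) - \<phi> (x - y) - grad \<phi> (x - y) \<bullet> h)"
      by (simp add: right_diff_distrib diff_add_eq)
    show "norm (v y *\<^sub>R \<phi> (x + h - y) - v y *\<^sub>R \<phi> (x - y) - (v y *\<^sub>R grad \<phi> (x - y)) \<bullet> h) \<le> C * (norm h)\<^sup>2 * norm (v y)"
      unfolding eq using mult_left_mono[OF c11D[OF C, of "x - y" h], of "\<bar>v y\<bar>"] by (simp add: abs_mult mult_ac)
    show "integrable lborel (\<lambda>y. norm (v y *\<^sub>R \<phi> (x + h - y) - v y *\<^sub>R \<phi> (x - y) - (v y *\<^sub>R grad \<phi> (x - y)) \<bullet> h))"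
      by (rule integrable_norm[OF Bochner_Integration.integrable_diff[OF Bochner_Integration.integrable_diff[OF int(1) int(1)] i3]])
    show "integrable lborel (\<lambda>y. C * (norm h)\<^sup>2 * norm (v y))"
      by (rule integrable_mult_right[OF integrable_norm[OF v]])
  qed
  finally show "\<bar>moll \<phi> v (x + h) - moll \<phi> v x - moll (grad \<phi>) v x \<bullet> h\<bar> \<le> C * (LBINT y. norm (v y)) * (norm h)\<^sup>2"
    by (simp add: mult_ac)
qed

lemma moll_swap:
  fixes \<phi> :: "'a::euclidean_space \<Rightarrow> real"
  assumes [measurable]: "v \<in> borel_measurable borel" "\<phi> \<in> borel_measurable borel"
  shows "moll \<phi> v x = (LBINT z. \<phi> z * v (x - z))"
  using integral_lborel_minus[of "\<lambda>z. \<phi> z * v (x - z)" x] by (simp add: moll_def mult.commute)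

lemma moll_support:
  assumes "mollifier \<epsilon> \<phi>" and v: "\<And>y. norm (y - x) < \<epsilon> \<Longrightarrow> v y = 0"
  shows "moll \<phi> v x = 0"
proof -
  have "v y * \<phi> (x - y) = 0" for y
    using v[of y] mollifierD(3)[OF assms(1), of "x - y"] by (cases "norm (y - x) < \<epsilon>") (auto simp: norm_minus_commute)
  then have "(\<lambda>y. v y *\<^sub>R \<phi> (x - y)) = (\<lambda>y. 0)"
    by (simp add: fun_eq_iff del: mult_eq_0_iff)
  then show ?thesis
    by (simp only: moll_def) simp
qed

text \<open>An average with total mass one. \<open>M\<close> may be any bound on the oscillation
  around this point, which covers uniformly continuous functions as well as Lipschitz ones.\<close>

lemma moll_lipschitz_close:
  assumes \<phi>: "mollifier \<epsilon> \<phi>" and v: "integrable lborel v"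
    and lip: "\<And>y. norm (y - x) < \<epsilon> \<Longrightarrow> \<bar>v y - v x\<bar> \<le> M"
  shows "\<bar>moll \<phi> v x - v x\<bar> \<le> M"
proof -
  note t = mollifierD(1)[OF \<phi>]
  note [measurable] = test_function_measurable[OF t]
  obtain B where "B > 0" and B: "\<And>x. norm (\<phi> x) \<le> B"
    using test_function_bounded[OF t, folded real_norm_def] by blast
  note int = integrable_moll[OF v test_function_measurable[OF t] B]
  have int': "integrable lborel (\<lambda>y. \<phi> (x - y))"
    using test_function_integrable[OF t] by (subst integrable_lborel_minus_iff) auto
  have one: "(LBINT y. \<phi> (x - y)) = 1"
    using integral_lborel_minus[of \<phi> x] mollifierD(4)[OF \<phi>] by simp
  have rem: "moll \<phi> v x - v x = (LBINT y. v y *\<^sub>R \<phi> (x - y) - v x * \<phi> (x - y))"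
    unfolding moll_def using int int' one by (simp del: real_scaleR_def)
  have "\<bar>moll \<phi> v x - v x\<bar> \<le> (LBINT y. norm (v y *\<^sub>R \<phi> (x - y) - v x * \<phi> (x - y)))"
    unfolding rem real_norm_def[symmetric] by (rule integral_norm_bound)
  also have "\<dots> \<le> (LBINT y. M * \<phi> (x - y))"
  proof (rule integral_mono)
    fix y
    have "norm (v y *\<^sub>R \<phi> (x - y) - v x * \<phi> (x - y)) = \<bar>v y - v x\<bar> * \<phi> (x - y)"
      using mollifierD(2)[OF \<phi>, of "x - y"] by (simp add: left_diff_distrib[symmetric] abs_mult)
    also have "\<dots> \<le> M * \<phi> (x - y)"
      using lip[of y] mollifierD(2,3)[OF \<phi>, of "x - y"]
      by (cases "norm (y - x) < \<epsilon>") (auto intro: mult_right_mono simp: norm_minus_commute)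
    finally show "norm (v y *\<^sub>R \<phi> (x - y) - v x * \<phi> (x - y)) \<le> M * \<phi> (x - y)" .
  qed (use int int' in \<open>auto simp del: real_scaleR_def\<close>)
  finally show ?thesis
    using one by simp
qed

section \<open>Convergence of mollifications in the mean\<close>

text \<open>A bounded truncation of \<open>v\<close> is an almost everywhere limit of continuous
  functions, which is what \<open>measurable_on\<close> provides; clipping these to the same bound
  and cutting them off supplies the dominating function.\<close>

lemma continuous_dense_L1:
  fixes v :: "'a::euclidean_space \<Rightarrow> real"
  assumes v: "integrable lborel v" and supp: "\<And>x. norm x > R \<Longrightarrow> v x = 0" and "e > 0"
  obtains c where "continuous_on UNIV c" "\<And>x. norm x > R + 1 \<Longrightarrow> c x = 0" "(LBINT x. \<bar>v x - c x\<bar>) < e"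
proof -
  note [measurable] = borel_measurable_integrable[OF v]
  define clip where "clip N t = max (- N) (min N t)" for N t :: real
  have clip: "\<bar>clip N t\<bar> \<le> N" if "N \<ge> 0" for N t
    using that by (auto simp: clip_def)
  have [measurable]: "clip N \<in> borel_measurable borel" for N
    unfolding clip_def by measurable
  have "(\<lambda>N. \<integral>x. \<bar>v x - clip (real N) (v x)\<bar> \<partial>lborel) \<longlonglongrightarrow> integral\<^sup>L lborel (\<lambda>x::'a. 0)"
  proof (rule integral_dominated_convergence[where w="\<lambda>x. \<bar>v x\<bar>"])
    have "(\<lambda>N. \<bar>v x - clip (real N) (v x)\<bar>) \<longlonglongrightarrow> 0" for x
    proof (rule tendsto_eventually)
      show "\<forall>\<^sub>F N in sequentially. \<bar>v x - clip (real N) (v x)\<bar> = 0"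
        using eventually_ge_at_top[of "nat \<lceil>\<bar>v x\<bar>\<rceil>"]
        by eventually_elim (auto simp: clip_def nat_le_iff ceiling_le_iff)
    qed
    then show "AE x in lborel. (\<lambda>N. \<bar>v x - clip (real N) (v x)\<bar>) \<longlonglongrightarrow> 0"
      by simp
    show "AE x in lborel. norm \<bar>v x - clip (real N) (v x)\<bar> \<le> \<bar>v x\<bar>" for N
      by (auto simp: clip_def)
  qed (use v in auto)
  then have "\<forall>\<^sub>F N in sequentially. (LBINT x. \<bar>v x - clip (real N) (v x)\<bar>) < e / 2"
    using \<open>e > 0\<close> by (intro order_tendstoD) auto
  then obtain N :: nat where N: "(LBINT x. \<bar>v x - clip (real N) (v x)\<bar>) < e / 2"
    by (auto simp: eventually_sequentially)
  define vN where "vN x = clip (real N) (v x)" for x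
  have vN_0: "vN x = 0" if "norm x > R" for x
    using supp[OF that] by (simp add: vN_def clip_def)
  have vN_int: "integrable lborel vN"
    unfolding vN_def by (rule Bochner_Integration.integrable_bound[OF v]) (auto simp: clip_def)
  have "vN \<in> borel_measurable lebesgue"
    unfolding vN_def by (intro measurable_completion) auto
  then have "vN measurable_on UNIV"
    using measurable_on_iff_borel_measurable[of UNIV vN] by (simp add: lebesgue_on_UNIV_eq)
  then obtain Z g where Z: "negligible Z" and g: "\<And>n. continuous_on UNIV (g n)"
    and lim: "\<And>x. x \<notin> Z \<Longrightarrow> (\<lambda>n. g n x) \<longlonglongrightarrow> vN x"
    by (auto simp: measurable_on_def)
  \<comment> \<open>Equal to one where \<open>vN\<close> may be nonzero, so the pointwise limit is
    unchanged, and zero beyond \<open>R + 1\<close>, so the approximants have compact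
    support.\<close>
  define cut where "cut x = max 0 (min 1 (R + 1 - norm x))" for x :: 'a
  define c where "c n x = cut x * clip (real N) (g n x)" for n x
  have cut: "cut x = 1" if "norm x \<le> R" for x
    using that by (simp add: cut_def)
  have cut': "cut x = 0" if "norm x > R + 1" for x
    using that by (simp add: cut_def)
  have cont: "continuous_on UNIV (c n)" for n
    unfolding c_def cut_def clip_def by (intro continuous_intros g)
  have c0: "c n x = 0" if "norm x > R + 1" for n x
    using cut'[OF that] by (simp add: c_def)
  have c_int: "integrable lborel (c n)" for n
    using cont c0 by (rule integrable_lborel_compact_support)
  have c_bound: "\<bar>c n x\<bar> \<le> real N * indicator (cball 0 (R + 1)) x" for n x
  proof (cases "norm x > R + 1")
    case False
    have "\<bar>c n x\<bar> = \<bar>cut x\<bar> * \<bar>clip (real N) (g n x)\<bar>"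
      by (simp add: c_def abs_mult)
    also have "\<dots> \<le> 1 * real N"
      by (intro mult_mono clip) (auto simp: cut_def)
    finally show ?thesis
      using False by (simp add: indicator_def)
  qed (simp add: c0)
  have c_lim: "(\<lambda>n. c n x) \<longlonglongrightarrow> vN x" if "x \<notin> Z" for x
  proof -
    have "(\<lambda>n. c n x) \<longlonglongrightarrow> cut x * clip (real N) (vN x)"
      unfolding c_def clip_def by (intro tendsto_intros lim that)
    moreover have "clip (real N) (vN x) = vN x"
      by (auto simp: clip_def vN_def)
    ultimately show ?thesis
      using cut[of x] vN_0[of x] by (cases "norm x \<le> R") auto
  qed
  have "AE x in lebesgue. x \<notin> Z"
    using Z by (auto simp: negligible_iff_null_sets intro: AE_not_in)
  then have AEZ: "AE x in lborel. x \<notin> Z"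
    by (simp add: AE_completion_iff)
  have "(\<lambda>n. \<integral>x. \<bar>vN x - c n x\<bar> \<partial>lborel) \<longlonglongrightarrow> integral\<^sup>L lborel (\<lambda>x::'a. 0)"
  proof (rule integral_dominated_convergence[where w="\<lambda>x. \<bar>vN x\<bar> + real N * indicator (cball 0 (R + 1)) x"])
    show "AE x in lborel. (\<lambda>n. \<bar>vN x - c n x\<bar>) \<longlonglongrightarrow> 0"
      using AEZ
    proof eventually_elim
      case (elim x)
      have "(\<lambda>n. \<bar>vN x - c n x\<bar>) \<longlonglongrightarrow> \<bar>vN x - vN x\<bar>"
        by (intro tendsto_intros c_lim elim)
      then show ?case by simp
    qed
    have "integrable lborel (indicator (cball 0 (R + 1)) :: 'a \<Rightarrow> real)"
      using emeasure_bounded_finite[OF bounded_cball] by (simp add: integrable_indicator_iff)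
    then show "integrable lborel (\<lambda>x. \<bar>vN x\<bar> + real N * indicator (cball 0 (R + 1)) x)"
      using vN_int by auto
    show "AE x in lborel. norm \<bar>vN x - c n x\<bar> \<le> \<bar>vN x\<bar> + real N * indicator (cball 0 (R + 1)) x" for n
    proof (rule AE_I2)
      show "norm \<bar>vN x - c n x\<bar> \<le> \<bar>vN x\<bar> + real N * indicator (cball 0 (R + 1)) x" for x
        using c_bound[of n x] abs_triangle_ineq4[of "vN x" "c n x"] by simp
    qed
  qed (use vN_int c_int in \<open>auto intro!: borel_measurable_abs borel_measurable_diff dest: borel_measurable_integrable\<close>)
  then have "\<forall>\<^sub>F n in sequentially. (LBINT x. \<bar>vN x - c n x\<bar>) < e / 2"
    using \<open>e > 0\<close> by (intro order_tendstoD) auto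
  then obtain n where n: "(LBINT x. \<bar>vN x - c n x\<bar>) < e / 2"
    by (auto simp: eventually_sequentially)
  have "(LBINT x. \<bar>v x - c n x\<bar>) \<le> (LBINT x. \<bar>v x - vN x\<bar> + \<bar>vN x - c n x\<bar>)"
    using v vN_int c_int by (intro integral_mono) auto
  also have "\<dots> = (LBINT x. \<bar>v x - vN x\<bar>) + (LBINT x. \<bar>vN x - c n x\<bar>)"
    using v vN_int c_int by (intro Bochner_Integration.integral_add) auto
  also have "\<dots> < e"
    using N n by (simp add: vN_def)
  finally show thesis
    using that[of "c n"] cont c0 by blast
qed

lemma moll_diff:
  fixes \<phi> :: "'a::euclidean_space \<Rightarrow> 'b::euclidean_space"
  assumes "integrable lborel u" "integrable lborel v" "\<phi> \<in> borel_measurable borel" "\<And>x. norm (\<phi> x) \<le> B"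
  shows "moll \<phi> (\<lambda>y. u y - v y) x = moll \<phi> u x - moll \<phi> v x"
proof -
  have "moll \<phi> (\<lambda>y. u y - v y) x = (LBINT y. u y *\<^sub>R \<phi> (x - y) - v y *\<^sub>R \<phi> (x - y))"
    unfolding moll_def by (intro Bochner_Integration.integral_cong) (auto simp: scaleR_diff_left)
  then show ?thesis
    unfolding moll_def using integrable_moll[OF assms(1,3,4)] integrable_moll[OF assms(2,3,4)]
    by (simp only: Bochner_Integration.integral_diff)
qed

lemma moll_continuous:
  assumes v: "integrable lborel v" and \<phi>: "test_function \<phi>"
  shows "continuous_on A (moll \<phi> v)"
  using test_function_c11[OF \<phi>] c11_continuous[OF moll_c11[OF v \<phi>]] by metis

text \<open>Young's inequality for a kernel of mass one: by Tonelli the kernel is integrated out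
  before \<open>v\<close>.\<close>

lemma
  assumes v: "integrable lborel v" and \<phi>: "mollifier \<epsilon> \<phi>"
  shows moll_integrable: "integrable lborel (moll \<phi> v)"
    and moll_L1_le: "(LBINT x. \<bar>moll \<phi> v x\<bar>) \<le> (LBINT x. \<bar>v x\<bar>)"
proof -
  note [measurable] = borel_measurable_integrable[OF v]
  note t = mollifierD(1)[OF \<phi>]
  note [measurable] = test_function_measurable[OF t]
  have [measurable]: "moll \<phi> v \<in> borel_measurable borel"
    using moll_continuous[OF v t] by (rule borel_measurable_continuous_onI)
  obtain B where "B > 0" and B: "\<And>x. norm (\<phi> x) \<le> B"
    using test_function_bounded[OF t, folded real_norm_def] by blast
  note int = integrable_moll[OF v test_function_measurable[OF t] B]
  have one: "(\<integral>\<^sup>+ x. ennreal (\<phi> (x - y)) \<partial>lborel) = 1" for y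
  proof -
    have "integrable lborel (\<lambda>x. \<phi> (x - y))"
      using test_function_integrable[OF t] by (subst integrable_lborel_translate_iff) auto
    then have "(\<integral>\<^sup>+ x. ennreal (\<phi> (x - y)) \<partial>lborel) = ennreal (LBINT x. \<phi> (x - y))"
      using mollifierD(2)[OF \<phi>] by (intro nn_integral_eq_integral) auto
    also have "\<dots> = 1"
      using integral_lborel_translate[of \<phi> y] mollifierD(4)[OF \<phi>] by simp
    finally show ?thesis .
  qed
  have "(\<integral>\<^sup>+ x. ennreal \<bar>moll \<phi> v x\<bar> \<partial>lborel) \<le> (\<integral>\<^sup>+ x. \<integral>\<^sup>+ y. ennreal (\<bar>v y\<bar> * \<phi> (x - y)) \<partial>lborel \<partial>lborel)"
  proof (rule nn_integral_mono)
    fix x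
    have "\<bar>moll \<phi> v x\<bar> \<le> (LBINT y. norm (v y *\<^sub>R \<phi> (x - y)))"
      unfolding moll_def real_norm_def[symmetric] by (rule integral_norm_bound)
    then have "ennreal \<bar>moll \<phi> v x\<bar> \<le> ennreal (LBINT y. norm (v y *\<^sub>R \<phi> (x - y)))"
      by (rule ennreal_leI)
    also have "\<dots> = (\<integral>\<^sup>+ y. ennreal (norm (v y *\<^sub>R \<phi> (x - y))) \<partial>lborel)"
      using int by (intro nn_integral_eq_integral[symmetric] integrable_norm) auto
    also have "\<dots> = (\<integral>\<^sup>+ y. ennreal (\<bar>v y\<bar> * \<phi> (x - y)) \<partial>lborel)"
      using mollifierD(2)[OF \<phi>] by (intro nn_integral_cong) (simp add: abs_mult)
    finally show "ennreal \<bar>moll \<phi> v x\<bar> \<le> (\<integral>\<^sup>+ y. ennreal (\<bar>v y\<bar> * \<phi> (x - y)) \<partial>lborel)" .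
  qed
  also have "\<dots> = (\<integral>\<^sup>+ y. \<integral>\<^sup>+ x. ennreal (\<bar>v y\<bar> * \<phi> (x - y)) \<partial>lborel \<partial>lborel)"
    by (rule lborel_pair.Fubini') measurable
  also have "\<dots> = (\<integral>\<^sup>+ y. ennreal \<bar>v y\<bar> * (\<integral>\<^sup>+ x. ennreal (\<phi> (x - y)) \<partial>lborel) \<partial>lborel)"
    by (intro nn_integral_cong) (simp add: ennreal_mult' nn_integral_cmult)
  also have "\<dots> = (\<integral>\<^sup>+ y. ennreal \<bar>v y\<bar> \<partial>lborel)"
    by (simp add: one)
  also have "\<dots> = ennreal (LBINT y. \<bar>v y\<bar>)"
    using v by (intro nn_integral_eq_integral) auto
  finally have le: "(\<integral>\<^sup>+ x. ennreal \<bar>moll \<phi> v x\<bar> \<partial>lborel) \<le> ennreal (LBINT y. \<bar>v y\<bar>)" .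
  show int': "integrable lborel (moll \<phi> v)"
  proof (rule integrableI_bounded)
    show "(\<integral>\<^sup>+ x. ennreal (norm (moll \<phi> v x)) \<partial>lborel) < \<infinity>"
      using le by (simp add: order_le_less_trans[OF le])
  qed measurable
  have "ennreal (LBINT x. \<bar>moll \<phi> v x\<bar>) \<le> ennreal (LBINT y. \<bar>v y\<bar>)"
    using le int' by (subst nn_integral_eq_integral[symmetric]) auto
  then show "(LBINT x. \<bar>moll \<phi> v x\<bar>) \<le> (LBINT x. \<bar>v x\<bar>)"
    by (subst (asm) ennreal_le_iff) auto
qed

text \<open>Mollification contracts L1, so it suffices to treat a continuous approximant
  \<open>c\<close>, for which uniform continuity on a ball gives uniform closeness.\<close>

lemma moll_L1_conv:
  fixes v :: "'a::euclidean_space \<Rightarrow> real"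
  assumes v: "integrable lborel v" and supp: "\<And>x. norm x > R \<Longrightarrow> v x = 0" and "e > 0"
  obtains \<epsilon>0 where "\<epsilon>0 > 0" "\<And>\<epsilon> \<phi>. \<epsilon> \<le> \<epsilon>0 \<Longrightarrow> mollifier \<epsilon> \<phi> \<Longrightarrow> (LBINT x. \<bar>moll \<phi> v x - v x\<bar>) < e"
proof -
  have e3: "e / 3 > 0"
    using \<open>e > 0\<close> by simp
  obtain c where c: "continuous_on UNIV c" and c0: "\<And>x. norm x > R + 1 \<Longrightarrow> c x = 0"
    and vc: "(LBINT x. \<bar>v x - c x\<bar>) < e / 3"
    using continuous_dense_L1[OF v supp e3] by blast
  have c_int: "integrable lborel c"
    using c c0 by (rule integrable_lborel_compact_support)
  define vol where "vol = measure lborel (cball (0::'a) (R + 2))"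
  \<comment> \<open>A uniform error \<open>\<eta>\<close> on the ball of volume \<open>vol\<close>
    costs at most e/3; adding 1 covers an empty ball.\<close>
  define \<eta> where "\<eta> = e / (3 * (vol + 1))"
  have vol: "vol \<ge> 0"
    by (simp add: vol_def)
  then have \<eta>: "\<eta> > 0"
    using \<open>e > 0\<close> by (simp add: \<eta>_def)
  \<comment> \<open>The support of \<open>c\<close> lies in radius \<open>R + 1\<close>, its
    mollification in \<open>R + 2\<close>, and the points averaged over in
    \<open>R + 3\<close>.\<close>
  have "uniformly_continuous_on (cball 0 (R + 3)) c"
    using c by (intro compact_uniformly_continuous) (auto intro: continuous_on_subset)
  then obtain d where d: "d > 0" "\<And>x y. x \<in> cball 0 (R + 3) \<Longrightarrow> y \<in> cball 0 (R + 3) \<Longrightarrow> dist y x < d \<Longrightarrow> dist (c y) (c x) < \<eta>"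
    using \<eta> unfolding uniformly_continuous_on_def by metis
  show thesis
  proof (rule that[of "min d 1"])
    show "min d 1 > 0"
      using d by simp
    fix \<epsilon> and \<phi> :: "'a \<Rightarrow> real" assume \<epsilon>: "\<epsilon> \<le> min d 1" and \<phi>: "mollifier \<epsilon> \<phi>"
    note t = mollifierD(1)[OF \<phi>]
    obtain B where "B > 0" and B: "\<And>x. norm (\<phi> x) \<le> B"
      using test_function_bounded[OF t, folded real_norm_def] by blast
    have c_close: "\<bar>moll \<phi> c x - c x\<bar> \<le> \<eta> * indicator (cball 0 (R + 2)) x" for x
    proof (cases "norm x > R + 2")
      case True
      have "c y = 0" if "norm (y - x) < \<epsilon>" for y
      proof (rule c0)
        show "norm y > R + 1"
          using True that \<epsilon> norm_triangle_ineq2[of x y] by (simp add: norm_minus_commute)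
      qed
      then have "moll \<phi> c x = 0"
        by (rule moll_support[OF \<phi>])
      then show ?thesis
        using True c0[of x] by simp
    next
      case False
      have "\<bar>moll \<phi> c x - c x\<bar> \<le> \<eta>"
      proof (rule moll_lipschitz_close[OF \<phi> c_int])
        fix y assume y: "norm (y - x) < \<epsilon>"
        have "norm y \<le> R + 3"
          using False y \<epsilon> norm_triangle_ineq2[of y x] by simp
        then have "dist (c y) (c x) < \<eta>"
          using False y \<epsilon> by (intro d) (auto simp: dist_norm)
        then show "\<bar>c y - c x\<bar> \<le> \<eta>"
          by (simp add: dist_real_def)
      qed
      then show ?thesis
        using False by simp
    qed
    have vc_int: "integrable lborel (\<lambda>x. v x - c x)"
      using v c_int by auto
    note ints = moll_integrable[OF v \<phi>] moll_integrable[OF c_int \<phi>] moll_integrable[OF vc_int \<phi>]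
    have ind: "integrable lborel (indicator (cball 0 (R + 2)) :: 'a \<Rightarrow> real)"
      using emeasure_bounded_finite[OF bounded_cball] by (simp add: integrable_indicator_iff)
    have "(LBINT x. \<bar>moll \<phi> v x - v x\<bar>) \<le>
       (LBINT x. \<bar>moll \<phi> (\<lambda>y. v y - c y) x\<bar> + \<eta> * indicator (cball 0 (R + 2)) x + \<bar>v x - c x\<bar>)"
    proof (rule integral_mono)
      fix x
      show "\<bar>moll \<phi> v x - v x\<bar> \<le> \<bar>moll \<phi> (\<lambda>y. v y - c y) x\<bar> + \<eta> * indicator (cball 0 (R + 2)) x + \<bar>v x - c x\<bar>"
        unfolding moll_diff[OF v c_int test_function_measurable[OF t] B]
        using c_close[of x] by linarith
    qed (use ints v c_int ind in auto)
    also have "\<dots> = (LBINT x. \<bar>moll \<phi> (\<lambda>y. v y - c y) x\<bar>) + \<eta> * vol + (LBINT x. \<bar>v x - c x\<bar>)"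
      using ints v c_int ind by (simp add: vol_def)
    also have "\<dots> < e / 3 + e / 3 + e / 3"
    proof -
      have "(LBINT x. \<bar>moll \<phi> (\<lambda>y. v y - c y) x\<bar>) < e / 3"
        using moll_L1_le[OF vc_int \<phi>] vc by simp
      moreover have "\<eta> * vol \<le> e / 3"
        using vol \<open>e > 0\<close> by (simp add: \<eta>_def field_simps)
      ultimately show ?thesis
        using vc by simp
    qed
    finally show "(LBINT x. \<bar>moll \<phi> v x - v x\<bar>) < e"
      by simp
  qed
qed

section \<open>Radial kernels\<close>

text \<open>\<open>q\<close> stands for the squared kernel. Radiality is remembered only as the
  statement that the matrix of second moments is the identity. The support condition is almost
  everywhere because \<open>q\<close> is a Borel representative.\<close>

definition normalized_kernel :: "real \<Rightarrow> ('a::euclidean_space \<Rightarrow> real) \<Rightarrow> bool" where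
  "normalized_kernel \<delta> q \<longleftrightarrow> q \<in> borel_measurable borel \<and> (\<forall>z. q z \<ge> 0) \<and>
     (AE z in lborel. norm z \<ge> \<delta> \<longrightarrow> q z = 0) \<and>
     (\<forall>a. has_bochner_integral lborel (\<lambda>z. (a \<bullet> z)\<^sup>2 * q z) ((norm a)\<^sup>2))"

text \<open>For distinct basis vectors this is the reflection across the hyperplane orthogonal to
  \<open>b - c\<close>, that is, the exchange of two coordinates.\<close>

definition coord_swap :: "'a \<Rightarrow> 'a \<Rightarrow> 'a::euclidean_space \<Rightarrow> 'a" where
  "coord_swap b c x = x + (x \<bullet> c - x \<bullet> b) *\<^sub>R (b - c)"

definition coord_flip :: "'a \<Rightarrow> 'a::euclidean_space \<Rightarrow> 'a" where
  "coord_flip b x = x - (2 * (x \<bullet> b)) *\<^sub>R b"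

lemma coord_swap_inner:
  assumes "b \<in> Basis" "c \<in> Basis" "i \<in> Basis"
  shows "coord_swap b c x \<bullet> i = x \<bullet> Transposition.transpose b c i"
  using assms by (auto simp: coord_swap_def inner_simps inner_Basis Transposition.transpose_def)

lemma coord_flip_inner:
  assumes "b \<in> Basis" "i \<in> Basis"
  shows "coord_flip b x \<bullet> i = (if i = b then - (x \<bullet> i) else x \<bullet> i)"
  using assms by (auto simp: coord_flip_def inner_simps inner_Basis)

lemma coord_swap_norm: "b \<in> Basis \<Longrightarrow> c \<in> Basis \<Longrightarrow> norm (coord_swap b c x) = norm x"
  by (simp add: norm_eq coord_swap_def inner_simps inner_Basis inner_commute) (auto simp: algebra_simps)

lemma coord_flip_norm: "b \<in> Basis \<Longrightarrow> norm (coord_flip b x) = norm x"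
  by (simp add: norm_eq coord_flip_def inner_simps inner_commute)

lemma coord_swap_measurable [measurable]: "coord_swap b c \<in> borel \<rightarrow>\<^sub>M borel"
  unfolding coord_swap_def by measurable

lemma coord_flip_measurable [measurable]: "coord_flip b \<in> borel \<rightarrow>\<^sub>M borel"
  unfolding coord_flip_def by measurable

text \<open>The preimage of a box is the box with permuted corners, and reindexing the product of
  side lengths leaves its volume unchanged.\<close>

lemma lborel_distr_coord_swap:
  assumes b: "b \<in> Basis" and c: "c \<in> Basis"
  shows "distr lborel borel (coord_swap b c) = lborel"
proof (rule lborel_eqI[symmetric])
  fix l u :: 'a assume le: "\<And>i. i \<in> Basis \<Longrightarrow> l \<bullet> i \<le> u \<bullet> i"
  let ?T = "Transposition.transpose b c"
  have T: "?T i \<in> Basis \<longleftrightarrow> i \<in> Basis" for i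
    using b c by (auto simp: Transposition.transpose_def)
  have bij: "bij_betw ?T Basis Basis"
    using b c by (intro permutes_imp_bij permutes_swap_id)
  have "coord_swap b c x \<in> box l u \<longleftrightarrow> x \<in> box (coord_swap b c l) (coord_swap b c u)" for x
  proof -
    have "coord_swap b c x \<in> box l u \<longleftrightarrow> (\<forall>i\<in>Basis. l \<bullet> i < x \<bullet> ?T i \<and> x \<bullet> ?T i < u \<bullet> i)"
      using b c by (simp add: mem_box coord_swap_inner)
    also have "\<dots> \<longleftrightarrow> (\<forall>i\<in>Basis. l \<bullet> ?T i < x \<bullet> i \<and> x \<bullet> i < u \<bullet> ?T i)"
      using T by (metis Transposition.transpose_involutory)
    finally show ?thesis
      using b c by (simp add: mem_box coord_swap_inner)
  qed
  then have "coord_swap b c -` box l u = box (coord_swap b c l) (coord_swap b c u)"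
    by auto
  moreover have "(\<Prod>i\<in>Basis. (coord_swap b c u - coord_swap b c l) \<bullet> i) = (\<Prod>i\<in>Basis. (u - l) \<bullet> ?T i)"
    using b c by (intro prod.cong) (auto simp: inner_diff_left coord_swap_inner)
  moreover have "\<dots> = (\<Prod>i\<in>Basis. (u - l) \<bullet> i)"
    by (rule prod.reindex_bij_betw[OF bij])
  ultimately show "emeasure (distr lborel borel (coord_swap b c)) (box l u) = (\<Prod>i\<in>Basis. (u - l) \<bullet> i)"
    using le b c T by (subst emeasure_distr) (auto simp: emeasure_lborel_box coord_swap_inner)
qed simp

lemma lborel_distr_coord_flip:
  assumes b: "b \<in> Basis"
  shows "distr lborel borel (coord_flip b) = lborel"
proof -
  define s :: "'a \<Rightarrow> real" where "s j = (if j = b then - 1 else 1)" for j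
  have "coord_flip b = (\<lambda>x. 0 + (\<Sum>j\<in>Basis. (s j * (x \<bullet> j)) *\<^sub>R j))"
    by (rule ext, rule euclidean_eqI) (use b in \<open>simp add: coord_flip_inner s_def\<close>)
  moreover have "lborel = density (distr lborel borel (\<lambda>x. 0 + (\<Sum>j\<in>Basis. (s j * (x \<bullet> j)) *\<^sub>R j))) (\<lambda>_. (\<Prod>j\<in>Basis. \<bar>s j\<bar>))"
    by (rule lborel_affine_euclidean) (auto simp: s_def)
  moreover have "(\<Prod>j\<in>Basis. \<bar>s j\<bar>) = 1"
    by (intro prod.neutral) (auto simp: s_def)
  ultimately show ?thesis
    by (simp add: density_1)
qed

text \<open>Sign changes of a coordinate annihilate the mixed second moments, exchanges of
  coordinates make the diagonal ones equal, and their sum is n by the normalisation. These two kinds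
  of isometry suffice, so no polar coordinates or general rotations occur.\<close>

lemma admissible_kernel_normalized:
  fixes w :: "'a::euclidean_space \<Rightarrow> real"
  assumes w: "admissible_kernel \<delta> w"
  obtains q where "normalized_kernel \<delta> q" "AE z in lborel. (w z)\<^sup>2 = q z"
proof -
  have w_supp: "norm z < \<delta>" if "w z \<noteq> 0" for z
    using w that unfolding admissible_kernel_def by (metis mem_ball_0)
  have w_radial: "w y = w z" if "norm y = norm z" for y z
    using w that unfolding admissible_kernel_def by blast
  obtain w' where [measurable]: "w' \<in> borel_measurable lborel" and w': "AE z in lborel. w z = w' z"
    using w completion_ex_borel_measurable_real[of w lborel] unfolding admissible_kernel_def by blast
  define q where "q z = (w' z)\<^sup>2" for z
  have [measurable]: "q \<in> borel_measurable borel"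
    unfolding q_def by measurable
  have q0: "q z \<ge> 0" for z
    by (simp add: q_def)
  have wq: "AE z in lborel. (w z)\<^sup>2 = q z"
    using w' by eventually_elim (simp add: q_def)
  have supp: "AE z in lborel. norm z \<ge> \<delta> \<longrightarrow> q z = 0"
    using wq
  proof eventually_elim
    case (elim z)
    have "w z = 0" if "norm z \<ge> \<delta>"
      using w_supp[of z] that by (cases "w z = 0") auto
    then show ?case
      using elim by auto
  qed
  \<comment> \<open>\<open>w\<close> is radial everywhere, its Borel representative only almost
    everywhere; the exceptional null set is pulled back along the measure-preserving
    \<open>T\<close>.\<close>
  have inv: "AE z in lborel. q (T z) = q z"
    if [measurable]: "T \<in> borel \<rightarrow>\<^sub>M borel" and T: "distr lborel borel T = lborel" and norm: "\<And>z. norm (T z) = norm z" for T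
  proof -
    obtain N where N: "N \<in> null_sets lborel" "{z. (w z)\<^sup>2 \<noteq> q z} \<subseteq> N"
      using wq by (auto simp: eventually_ae_filter)
    then have "AE z in distr lborel borel T. z \<notin> N"
      unfolding T by (intro AE_not_in)
    then have "AE z in lborel. T z \<notin> N"
      using N by (subst (asm) AE_distr_iff) auto
    then show ?thesis
      using wq
    proof eventually_elim
      case (elim z)
      moreover have "w (T z) = w z"
        using w_radial norm by blast
      ultimately show ?case
        using N by (metis (mono_tags, lifting) mem_Collect_eq subsetD)
    qed
  qed
  have n2: "(\<integral>\<^sup>+ z. ennreal ((norm z)\<^sup>2 * q z) \<partial>lborel) = ennreal (real DIM('a))"
  proof -
    have "(\<integral>\<^sup>+ z. ennreal ((norm z)\<^sup>2 * q z) \<partial>lborel) = (\<integral>\<^sup>+ z. ennreal ((norm z)\<^sup>2 * (w z)\<^sup>2) \<partial>lborel)"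
      by (rule nn_integral_cong_AE) (use wq in \<open>eventually_elim; simp\<close>)
    also have "\<dots> = ennreal (1 / K2 DIM('a))"
      using w unfolding admissible_kernel_def nn_integral_completion by blast
    finally show ?thesis
      by (simp add: K2_def)
  qed
  have int2: "integrable lborel (\<lambda>z. (norm z)\<^sup>2 * q z)"
    using q0 n2 by (intro integrableI_nonneg) auto
  have val2: "(LBINT z. (norm z)\<^sup>2 * q z) = DIM('a)"
    using n2 q0 by (subst integral_eq_nn_integral) auto
  have int: "integrable lborel (\<lambda>z. (z \<bullet> b) * (z \<bullet> c) * q z)" if "b \<in> Basis" "c \<in> Basis" for b c
  proof (rule Bochner_Integration.integrable_bound[OF int2])
    have "norm ((z \<bullet> b) * (z \<bullet> c) * q z) \<le> norm ((norm z)\<^sup>2 * q z)" for z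
      using q0[of z] that mult_mono[OF Basis_le_norm[of b z] Basis_le_norm[of c z]]
      by (auto simp: abs_mult power2_eq_square intro!: mult_right_mono)
    then show "AE z in lborel. norm ((z \<bullet> b) * (z \<bullet> c) * q z) \<le> norm ((norm z)\<^sup>2 * q z)"
      by simp
  qed measurable
  define I where "I b c = (LBINT z. (z \<bullet> b) * (z \<bullet> c) * q z)" for b c
  have change: "I b c = (LBINT z. (T z \<bullet> b) * (T z \<bullet> c) * q z)"
    if [measurable]: "T \<in> borel \<rightarrow>\<^sub>M borel" and T: "distr lborel borel T = lborel" and norm: "\<And>z. norm (T z) = norm z" for T b c
  proof -
    have "I b c = (\<integral>z. (z \<bullet> b) * (z \<bullet> c) * q z \<partial>distr lborel borel T)"
      by (simp add: I_def T)
    also have "\<dots> = (LBINT z. (T z \<bullet> b) * (T z \<bullet> c) * q (T z))"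
      by (rule integral_distr) measurable
    also have "\<dots> = (LBINT z. (T z \<bullet> b) * (T z \<bullet> c) * q z)"
    proof (rule integral_cong_AE)
      show "AE z in lborel. (T z \<bullet> b) * (T z \<bullet> c) * q (T z) = (T z \<bullet> b) * (T z \<bullet> c) * q z"
        using inv[OF that] by eventually_elim simp
    qed measurable
    finally show ?thesis .
  qed
  have swap: "I b b = I c c" if b: "b \<in> Basis" and c: "c \<in> Basis" for b c
    using change[OF coord_swap_measurable lborel_distr_coord_swap[OF b c] coord_swap_norm[OF b c], of b b] b c
    by (simp add: I_def coord_swap_inner)
  have flip: "I b c = 0" if b: "b \<in> Basis" and c: "c \<in> Basis" and "b \<noteq> c" for b c
    using change[OF coord_flip_measurable lborel_distr_coord_flip[OF b] coord_flip_norm[OF b], of b c] b c \<open>b \<noteq> c\<close>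
    by (simp add: I_def coord_flip_inner)
  \<comment> \<open>The trace of the moment matrix is n and its n diagonal entries coincide.\<close>
  have diag: "I b b = 1" if b: "b \<in> Basis" for b
  proof -
    have "real DIM('a) = (LBINT z. (\<Sum>c\<in>Basis. (z \<bullet> c) * (z \<bullet> c) * q z))"
      using val2 by (simp only: sum_distrib_right[symmetric] euclidean_inner[symmetric] power2_norm_eq_inner)
    also have "\<dots> = (\<Sum>c\<in>Basis. I c c)"
      unfolding I_def using int by (intro Bochner_Integration.integral_sum) auto
    also have "\<dots> = (\<Sum>c\<in>(Basis::'a set). I b b)"
      using swap[OF b] by (intro sum.cong) auto
    finally show ?thesis
      by simp
  qed
  have "has_bochner_integral lborel (\<lambda>z. (a \<bullet> z)\<^sup>2 * q z) ((norm a)\<^sup>2)" for a :: 'a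
  proof -
    have eq: "(a \<bullet> z)\<^sup>2 * q z = (\<Sum>b\<in>Basis. \<Sum>c\<in>Basis. ((a \<bullet> b) * (a \<bullet> c)) * ((z \<bullet> b) * (z \<bullet> c) * q z))" for z
      unfolding power2_eq_square euclidean_inner[of a z] sum_product sum_distrib_right
      by (intro sum.cong) (auto simp: sum_distrib_left mult_ac)
    have "has_bochner_integral lborel (\<lambda>z. (a \<bullet> z)\<^sup>2 * q z) (\<Sum>b\<in>Basis. \<Sum>c\<in>Basis. ((a \<bullet> b) * (a \<bullet> c)) * I b c)"
      unfolding eq I_def using int
      by (intro has_bochner_integral_sum has_bochner_integral_mult_right has_bochner_integral_integrable) auto
    moreover have "(\<Sum>b\<in>Basis. \<Sum>c\<in>Basis. ((a \<bullet> b) * (a \<bullet> c)) * I b c) = (\<Sum>b\<in>Basis. (a \<bullet> b) * (a \<bullet> b))"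
    proof (rule sum.cong)
      fix b :: 'a assume b: "b \<in> Basis"
      have "(\<Sum>c\<in>Basis. ((a \<bullet> b) * (a \<bullet> c)) * I b c) = (\<Sum>c\<in>Basis. if c = b then (a \<bullet> b) * (a \<bullet> b) else 0)"
        using b diag flip[OF b] by (intro sum.cong) auto
      then show "(\<Sum>c\<in>Basis. ((a \<bullet> b) * (a \<bullet> c)) * I b c) = (a \<bullet> b) * (a \<bullet> b)"
        using b by simp
    qed simp
    ultimately show ?thesis
      by (simp add: euclidean_inner[symmetric] power2_norm_eq_inner)
  qed
  then have "normalized_kernel \<delta> q"
    using q0 supp by (simp add: normalized_kernel_def)
  then show thesis
    using wq that by blast
qed

section \<open>Moments of a normalised kernel\<close>

lemma normalized_kernelD:
  assumes "normalized_kernel \<delta> q"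
  shows "q \<in> borel_measurable borel" "q z \<ge> 0" "AE z in lborel. norm z \<ge> \<delta> \<longrightarrow> q z = 0"
    "integrable lborel (\<lambda>z. (a \<bullet> z)\<^sup>2 * q z)" "(LBINT z. (a \<bullet> z)\<^sup>2 * q z) = (norm a)\<^sup>2"
    "(\<integral>\<^sup>+ z. ennreal ((a \<bullet> z)\<^sup>2 * q z) \<partial>lborel) = ennreal ((norm a)\<^sup>2)"
proof -
  show "q \<in> borel_measurable borel" "q z \<ge> 0" "AE z in lborel. norm z \<ge> \<delta> \<longrightarrow> q z = 0"
    "integrable lborel (\<lambda>z. (a \<bullet> z)\<^sup>2 * q z)" "(LBINT z. (a \<bullet> z)\<^sup>2 * q z) = (norm a)\<^sup>2"
    using assms by (auto simp: normalized_kernel_def has_bochner_integral_iff)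
  then show "(\<integral>\<^sup>+ z. ennreal ((a \<bullet> z)\<^sup>2 * q z) \<partial>lborel) = ennreal ((norm a)\<^sup>2)"
    using assms by (subst nn_integral_eq_integral) (auto simp: normalized_kernel_def has_bochner_integral_iff)
qed

lemma normalized_kernel_second_moment:
  fixes q :: "'a::euclidean_space \<Rightarrow> real"
  assumes "normalized_kernel \<delta> q"
  shows "integrable lborel (\<lambda>z. (norm z)\<^sup>2 * q z)" "(LBINT z. (norm z)\<^sup>2 * q z) = DIM('a)"
    "(\<integral>\<^sup>+ z. ennreal ((norm z)\<^sup>2 * q z) \<partial>lborel) = ennreal (real DIM('a))"
proof -
  have "(\<lambda>z::'a. (norm z)\<^sup>2 * q z) = (\<lambda>z. \<Sum>b\<in>Basis. (b \<bullet> z)\<^sup>2 * q z)"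
  proof
    fix z :: 'a
    have "(norm z)\<^sup>2 = (\<Sum>b\<in>Basis. (b \<bullet> z)\<^sup>2)"
      unfolding power2_norm_eq_inner by (subst euclidean_inner) (simp add: power2_eq_square inner_commute)
    then show "(norm z)\<^sup>2 * q z = (\<Sum>b\<in>Basis. (b \<bullet> z)\<^sup>2 * q z)"
      by (simp add: sum_distrib_right)
  qed
  moreover have "has_bochner_integral lborel (\<lambda>z. \<Sum>b\<in>Basis. (b \<bullet> z)\<^sup>2 * q z) (\<Sum>b\<in>(Basis::'a set). (norm b)\<^sup>2)"
    using assms by (intro has_bochner_integral_sum) (simp add: normalized_kernel_def del: norm_Basis)
  ultimately have "has_bochner_integral lborel (\<lambda>z. (norm z)\<^sup>2 * q z) (real DIM('a))"
    by simp
  then show *: "integrable lborel (\<lambda>z. (norm z)\<^sup>2 * q z)" "(LBINT z. (norm z)\<^sup>2 * q z) = DIM('a)"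
    by (auto simp: has_bochner_integral_iff)
  then show "(\<integral>\<^sup>+ z. ennreal ((norm z)\<^sup>2 * q z) \<partial>lborel) = ennreal (real DIM('a))"
    using normalized_kernelD(2)[OF assms] by (subst nn_integral_eq_integral) auto
qed

section \<open>The nonlocal constraint\<close>

text \<open>A nonzero integrand needs one of the two points in \<open>\<Omega>\<close> and the other
  closer than \<open>\<delta>\<close>, so both lie in the neighbourhood and the restriction of the
  integral is harmless. In the integration variable agreement almost everywhere is enough; at the
  fixed point \<open>x\<close> it has to be assumed.\<close>

lemma
  fixes \<Omega> :: "'a::euclidean_space set" and w u v :: "'a \<Rightarrow> real"
  assumes supp: "\<And>z. w z \<noteq> 0 \<Longrightarrow> norm z < \<delta>" and "\<delta> > 0"
    and q [measurable]: "q \<in> borel_measurable borel" and wq: "AE z in lborel. (w z)\<^sup>2 = q z"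
    and v [measurable]: "v \<in> borel_measurable borel" and vu: "AE y in lborel. v y = zext \<Omega> u y"
    and x: "v x = zext \<Omega> u x"
  shows Gdelta_energy_eq: "x \<in> nbhd \<Omega> \<delta> \<Longrightarrow>
      (\<integral>\<^sup>+ x'. ennreal ((Gdelta \<Omega> w u x x')\<^sup>2) \<partial>lebesgue_on (nbhd \<Omega> \<delta>)) =
      (\<integral>\<^sup>+ z. ennreal ((v x - v (x - z))\<^sup>2 * q z) \<partial>lborel)"
    and Gdelta_energy_outside: "x \<notin> nbhd \<Omega> \<delta> \<Longrightarrow>
      (\<integral>\<^sup>+ z. ennreal ((v x - v (x - z))\<^sup>2 * q z) \<partial>lborel) = 0"
proof -
  have "open (nbhd \<Omega> \<delta>)"
    by (auto simp: nbhd_def)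
  then have meas: "nbhd \<Omega> \<delta> \<in> sets lebesgue"
    by auto
  have eq: "(\<integral>\<^sup>+ z. ennreal ((v x - v (x - z))\<^sup>2 * q z) \<partial>lborel) = (\<integral>\<^sup>+ x'. ennreal ((Gdelta \<Omega> w u x x')\<^sup>2) \<partial>lborel)"
  proof -
    have "(\<integral>\<^sup>+ z. ennreal ((v x - v (x - z))\<^sup>2 * q z) \<partial>lborel) = (\<integral>\<^sup>+ y. ennreal ((v x - v y)\<^sup>2 * q (x - y)) \<partial>lborel)"
      using nn_integral_lborel_minus[of "\<lambda>z. ennreal ((v x - v (x - z))\<^sup>2 * q z)" x] by simp
    also have "\<dots> = (\<integral>\<^sup>+ x'. ennreal ((Gdelta \<Omega> w u x x')\<^sup>2) \<partial>lborel)"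
    proof (rule nn_integral_cong_AE)
      show "AE y in lborel. ennreal ((v x - v y)\<^sup>2 * q (x - y)) = ennreal ((Gdelta \<Omega> w u x y)\<^sup>2)"
        using vu AE_lborel_minus[OF wq, of x]
        by eventually_elim (simp add: Gdelta_def x power_mult_distrib)
    qed
    finally show ?thesis .
  qed
  have in_nbhd: "x \<in> nbhd \<Omega> \<delta> \<and> x' \<in> nbhd \<Omega> \<delta>" if "Gdelta \<Omega> w u x x' \<noteq> 0" for x'
  proof -
    have "norm (x - x') < \<delta>" and "x \<in> \<Omega> \<or> x' \<in> \<Omega>"
      using that supp by (auto simp: Gdelta_def zext_def split: if_splits)
    then show ?thesis
      using \<open>\<delta> > 0\<close> by (auto simp: nbhd_def dist_norm norm_minus_commute intro: bexI[of _ x] bexI[of _ x'])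
  qed
  show "(\<integral>\<^sup>+ x'. ennreal ((Gdelta \<Omega> w u x x')\<^sup>2) \<partial>lebesgue_on (nbhd \<Omega> \<delta>)) =
      (\<integral>\<^sup>+ z. ennreal ((v x - v (x - z))\<^sup>2 * q z) \<partial>lborel)" if "x \<in> nbhd \<Omega> \<delta>"
  proof -
    have "(\<integral>\<^sup>+ x'. ennreal ((Gdelta \<Omega> w u x x')\<^sup>2) \<partial>lebesgue_on (nbhd \<Omega> \<delta>)) =
      (\<integral>\<^sup>+ x'. ennreal ((Gdelta \<Omega> w u x x')\<^sup>2) * indicator (nbhd \<Omega> \<delta>) x' \<partial>lebesgue)"
      using meas by (intro nn_integral_restrict_space) auto
    also have "\<dots> = (\<integral>\<^sup>+ x'. ennreal ((Gdelta \<Omega> w u x x')\<^sup>2) \<partial>lborel)"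
      unfolding nn_integral_completion
    proof (rule nn_integral_cong)
      show "ennreal ((Gdelta \<Omega> w u x x')\<^sup>2) * indicator (nbhd \<Omega> \<delta>) x' = ennreal ((Gdelta \<Omega> w u x x')\<^sup>2)" for x'
        using in_nbhd[of x'] by (cases "Gdelta \<Omega> w u x x' = 0") (auto simp: indicator_def)
    qed
    finally show ?thesis
      using eq by simp
  qed
  show "(\<integral>\<^sup>+ z. ennreal ((v x - v (x - z))\<^sup>2 * q z) \<partial>lborel) = 0" if "x \<notin> nbhd \<Omega> \<delta>"
  proof -
    have "Gdelta \<Omega> w u x x' = 0" for x'
      using in_nbhd[of x'] that by auto
    then show ?thesis
      using eq by simp
  qed
qed

definition nonlocal_unit :: "('a::euclidean_space \<Rightarrow> real) \<Rightarrow> ('a \<Rightarrow> real) \<Rightarrow> bool" where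
  "nonlocal_unit q v \<longleftrightarrow> (AE x in lborel. (\<integral>\<^sup>+ z. ennreal ((v x - v (x - z))\<^sup>2 * q z) \<partial>lborel) \<le> 1)"

text \<open>Off the neighbourhood the energy is zero, so quantifying over the whole space adds no
  condition. The constraint becomes translation invariant and can be averaged against a
  mollifier.\<close>

lemma in_unit_ball_iff_nonlocal_unit:
  fixes \<Omega> :: "'a::euclidean_space set" and w u v :: "'a \<Rightarrow> real"
  assumes supp: "\<And>z. w z \<noteq> 0 \<Longrightarrow> norm z < \<delta>" and "\<delta> > 0"
    and q: "q \<in> borel_measurable borel" and wq: "AE z in lborel. (w z)\<^sup>2 = q z"
    and v: "v \<in> borel_measurable borel" and vu: "AE y in lborel. v y = zext \<Omega> u y"
  shows "in_unit_ball_Linf2 (nbhd \<Omega> \<delta>) (Gdelta \<Omega> w u) \<longleftrightarrow> nonlocal_unit q v"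
proof -
  have "open (nbhd \<Omega> \<delta>)"
    by (auto simp: nbhd_def)
  then have "nbhd \<Omega> \<delta> \<inter> space lebesgue \<in> sets lebesgue"
    by auto
  then have "in_unit_ball_Linf2 (nbhd \<Omega> \<delta>) (Gdelta \<Omega> w u) \<longleftrightarrow>
      (AE x in lborel. x \<in> nbhd \<Omega> \<delta> \<longrightarrow> (\<integral>\<^sup>+ x'. ennreal ((Gdelta \<Omega> w u x x')\<^sup>2) \<partial>lebesgue_on (nbhd \<Omega> \<delta>)) \<le> 1)"
    unfolding in_unit_ball_Linf2_def by (simp add: AE_restrict_space_iff AE_completion_iff)
  also have "\<dots> \<longleftrightarrow> nonlocal_unit q v"
    unfolding nonlocal_unit_def
  proof (rule eventually_subst)
    show "AE x in lborel. (x \<in> nbhd \<Omega> \<delta> \<longrightarrow> (\<integral>\<^sup>+ x'. ennreal ((Gdelta \<Omega> w u x x')\<^sup>2) \<partial>lebesgue_on (nbhd \<Omega> \<delta>)) \<le> 1)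
        = ((\<integral>\<^sup>+ z. ennreal ((v x - v (x - z))\<^sup>2 * q z) \<partial>lborel) \<le> 1)"
      using vu
    proof eventually_elim
      case (elim x)
      show ?case
        using Gdelta_energy_eq[OF supp \<open>\<delta> > 0\<close> q wq v vu elim] Gdelta_energy_outside[OF supp \<open>\<delta> > 0\<close> q wq v vu elim]
        by (cases "x \<in> nbhd \<Omega> \<delta>") simp_all
    qed
  qed
  finally show ?thesis .
qed

text \<open>Take \<open>e\<close> in the direction of the mollified gradient and average the
  linearised constraint with weight \<open>\<phi> (x0 - x)\<close>. The average is the same
  expression for \<open>moll \<phi> v\<close>, whose first-order part integrates to the norm of the
  gradient. The remainder C' |z|^2 meets a factor |e . z| \<le> \<delta> and the second moment
  n.\<close>

lemma norm_grad_moll_le: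
  fixes v :: "'a::euclidean_space \<Rightarrow> real"
  assumes q: "normalized_kernel \<delta> q" and v: "integrable lborel v" and unit: "nonlocal_unit q v"
    and \<phi>: "mollifier \<epsilon> \<phi>" and C: "c11 C \<phi> (grad \<phi>)" and "\<delta> > 0"
  shows "norm (moll (grad \<phi>) v x0) \<le> 1 + C * (LBINT y. norm (v y)) * \<delta> * DIM('a)"
proof (cases "moll (grad \<phi>) v x0 = 0")
  case True
  then show ?thesis
    using c11_nonneg[OF C] \<open>\<delta> > 0\<close> by simp
next
  case False
  define C' where "C' = C * (LBINT y. norm (v y))"
  define a where "a = moll (grad \<phi>) v x0"
  define e where "e = a /\<^sub>R norm a"
  have C': "C' \<ge> 0"
    using c11_nonneg[OF C] by (simp add: C'_def)
  have e: "norm e = 1" and az: "a \<bullet> z = norm a * (e \<bullet> z)" for z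
    using False by (auto simp: e_def a_def)
  note t = mollifierD(1)[OF \<phi>]
  note [measurable] = borel_measurable_integrable[OF v] test_function_measurable[OF t] normalized_kernelD(1)[OF q]
  note q0 = normalized_kernelD(2)[OF q]
  \<comment> \<open>Integrating over \<open>z\<close> inside uses the constraint at
    \<open>x\<close>; integrating over \<open>x\<close> inside turns \<open>v\<close> into its
    mollification. The proof consists in exchanging the two.\<close>
  define H where "H x z = \<phi> (x0 - x) * (v x - v (x - z)) * ((e \<bullet> z) * q z)" for x z
  have [measurable]: "case_prod H \<in> borel_measurable (lborel \<Otimes>\<^sub>M lborel)"
    unfolding H_def by measurable
  have phi_int: "integrable lborel (\<lambda>x. \<phi> (x0 - x))"
    using test_function_integrable[OF t] by (subst integrable_lborel_minus_iff) auto
  have "(\<integral>\<^sup>+ x. \<integral>\<^sup>+ z. ennreal \<bar>H x z\<bar> \<partial>lborel \<partial>lborel) \<le> (\<integral>\<^sup>+ x. ennreal (\<phi> (x0 - x)) \<partial>lborel)"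
  proof (rule nn_integral_mono_AE)
    show "AE x in lborel. (\<integral>\<^sup>+ z. ennreal \<bar>H x z\<bar> \<partial>lborel) \<le> ennreal (\<phi> (x0 - x))"
      using unit unfolding nonlocal_unit_def
    proof eventually_elim
      case (elim x)
      have phi0: "\<phi> (x0 - x) \<ge> 0"
        using mollifierD(2)[OF \<phi>] .
      have "(\<integral>\<^sup>+ z. ennreal \<bar>H x z\<bar> \<partial>lborel) \<le>
        (\<integral>\<^sup>+ z. ennreal (\<phi> (x0 - x) / 2) * (ennreal ((v x - v (x - z))\<^sup>2 * q z) + ennreal ((e \<bullet> z)\<^sup>2 * q z)) \<partial>lborel)"
      proof (rule nn_integral_mono)
        fix z
        \<comment> \<open>Equal weights lose nothing: the resulting energies, that of
          \<open>v\<close> and that of the linear function, are both at most one.\<close>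
        have "2 * \<bar>(v x - v (x - z)) * (e \<bullet> z)\<bar> \<le> (v x - v (x - z))\<^sup>2 + (e \<bullet> z)\<^sup>2"
          using sum_squares_bound[of "\<bar>v x - v (x - z)\<bar>" "\<bar>e \<bullet> z\<bar>"] by (simp add: abs_mult)
        then have "2 * \<bar>(v x - v (x - z)) * (e \<bullet> z)\<bar> * (q z * (\<phi> (x0 - x) / 2)) \<le>
            ((v x - v (x - z))\<^sup>2 + (e \<bullet> z)\<^sup>2) * (q z * (\<phi> (x0 - x) / 2))"
          using q0[of z] phi0 by (intro mult_right_mono) auto
        moreover have "\<bar>H x z\<bar> = 2 * \<bar>(v x - v (x - z)) * (e \<bullet> z)\<bar> * (q z * (\<phi> (x0 - x) / 2))"
          using q0[of z] phi0 by (simp add: H_def abs_mult)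
        ultimately have "\<bar>H x z\<bar> \<le> (\<phi> (x0 - x) / 2) * ((v x - v (x - z))\<^sup>2 * q z + (e \<bullet> z)\<^sup>2 * q z)"
          by (simp add: algebra_simps)
        then have "ennreal \<bar>H x z\<bar> \<le> ennreal ((\<phi> (x0 - x) / 2) * ((v x - v (x - z))\<^sup>2 * q z + (e \<bullet> z)\<^sup>2 * q z))"
          by (rule ennreal_leI)
        also have "\<dots> = ennreal (\<phi> (x0 - x) / 2) * (ennreal ((v x - v (x - z))\<^sup>2 * q z) + ennreal ((e \<bullet> z)\<^sup>2 * q z))"
          using q0[of z] phi0 by (subst ennreal_mult) (auto simp: ennreal_plus)
        finally show "ennreal \<bar>H x z\<bar> \<le> \<dots>" .
      qed
      also have "\<dots> = ennreal (\<phi> (x0 - x) / 2) * ((\<integral>\<^sup>+ z. ennreal ((v x - v (x - z))\<^sup>2 * q z) \<partial>lborel) + 1)"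
        using normalized_kernelD(6)[OF q, of e] e by (simp add: nn_integral_cmult nn_integral_add)
      also have "\<dots> \<le> ennreal (\<phi> (x0 - x) / 2) * (1 + 1)"
        using elim by (intro mult_left_mono add_mono) auto
      also have "\<dots> = ennreal (\<phi> (x0 - x) / 2) * ennreal 2"
        by simp
      also have "\<dots> = ennreal (\<phi> (x0 - x))"
        using phi0 by (subst ennreal_mult[symmetric]) auto
      finally show ?case .
    qed
  qed
  also have "\<dots> = ennreal (LBINT x. \<phi> (x0 - x))"
    using phi_int mollifierD(2)[OF \<phi>] by (intro nn_integral_eq_integral) auto
  also have "\<dots> = 1"
    using integral_lborel_minus[of \<phi> x0] mollifierD(4)[OF \<phi>] by simp
  finally have H1: "(\<integral>\<^sup>+ p. ennreal (norm (case_prod H p)) \<partial>(lborel \<Otimes>\<^sub>M lborel)) \<le> 1"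
    by (subst lborel.nn_integral_fst[symmetric]) auto
  have H_int: "integrable (lborel \<Otimes>\<^sub>M lborel) (case_prod H)"
    using order_le_less_trans[OF H1] by (intro integrableI_bounded) auto
  have "(\<integral>p. case_prod H p \<partial>(lborel \<Otimes>\<^sub>M lborel)) \<le> (\<integral>p. norm (case_prod H p) \<partial>(lborel \<Otimes>\<^sub>M lborel))"
    using H_int by (intro integral_mono integrable_norm) auto
  also have "\<dots> \<le> 1"
  proof -
    have "ennreal (\<integral>p. norm (case_prod H p) \<partial>(lborel \<Otimes>\<^sub>M lborel)) \<le> ennreal 1"
      using H1 H_int by (subst nn_integral_eq_integral[symmetric]) auto
    then show ?thesis
      by (subst (asm) ennreal_le_iff) auto
  qed
  finally have "(LBINT z. (LBINT x. H x z)) \<le> 1"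
    by (subst lborel_pair.integral_snd[OF H_int]) simp
  \<comment> \<open>Translating the integration variable moves the shift by \<open>z\<close> from
    \<open>v\<close> to the point at which the mollification is evaluated.\<close>
  moreover have Hz: "(LBINT x. H x z) = (moll \<phi> v x0 - moll \<phi> v (x0 - z)) * ((e \<bullet> z) * q z)" for z
  proof -
    obtain B where "B > 0" and B: "\<And>x. norm (\<phi> x) \<le> B"
      using test_function_bounded[OF t, folded real_norm_def] by blast
    note int = integrable_moll[OF v test_function_measurable[OF t] B]
    have int2: "integrable lborel (\<lambda>x. v (x - z) *\<^sub>R \<phi> (x0 - z - (x - z)))"
      using int[of "x0 - z"] by (subst integrable_lborel_translate_iff) auto
    have eq2: "(LBINT x. v (x - z) *\<^sub>R \<phi> (x0 - z - (x - z))) = moll \<phi> v (x0 - z)"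
      unfolding moll_def by (subst integral_lborel_translate[of "\<lambda>x. v x *\<^sub>R \<phi> (x0 - z - x)" z]) auto
    have "(LBINT x. H x z) = (LBINT x. (v x *\<^sub>R \<phi> (x0 - x) - v (x - z) *\<^sub>R \<phi> (x0 - z - (x - z))) * ((e \<bullet> z) * q z))"
      by (intro Bochner_Integration.integral_cong) (auto simp: H_def algebra_simps)
    also have "\<dots> = ((LBINT x. v x *\<^sub>R \<phi> (x0 - x)) - moll \<phi> v (x0 - z)) * ((e \<bullet> z) * q z)"
      by (simp only: integral_mult_left_zero Bochner_Integration.integral_diff[OF int int2] eq2)
    finally show ?thesis
      by (simp add: moll_def)
  qed
  moreover have "norm a - C' * \<delta> * DIM('a) \<le> (LBINT z. (moll \<phi> v x0 - moll \<phi> v (x0 - z)) * ((e \<bullet> z) * q z))"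
  proof -
    have "norm a - C' * \<delta> * DIM('a) = (LBINT z. norm a * ((e \<bullet> z)\<^sup>2 * q z) - (C' * \<delta>) * ((norm z)\<^sup>2 * q z))"
      using normalized_kernelD(4,5)[OF q, of e] normalized_kernel_second_moment[OF q] e
      by (subst Bochner_Integration.integral_diff) auto
    also have "\<dots> \<le> (LBINT z. (moll \<phi> v x0 - moll \<phi> v (x0 - z)) * ((e \<bullet> z) * q z))"
    proof (rule integral_mono_AE)
      show "integrable lborel (\<lambda>z. norm a * ((e \<bullet> z)\<^sup>2 * q z) - (C' * \<delta>) * ((norm z)\<^sup>2 * q z))"
        using normalized_kernelD(4)[OF q, of e] normalized_kernel_second_moment[OF q] by auto
      show "integrable lborel (\<lambda>z. (moll \<phi> v x0 - moll \<phi> v (x0 - z)) * ((e \<bullet> z) * q z))"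
        using lborel_pair.integrable_snd[OF H_int] by (simp add: Hz)
      show "AE z in lborel. norm a * ((e \<bullet> z)\<^sup>2 * q z) - (C' * \<delta>) * ((norm z)\<^sup>2 * q z)
          \<le> (moll \<phi> v x0 - moll \<phi> v (x0 - z)) * ((e \<bullet> z) * q z)"
        using normalized_kernelD(3)[OF q]
      proof eventually_elim
        case (elim z)
        show ?case
        proof (cases "norm z \<ge> \<delta>")
          case False
          define r where "r = moll \<phi> v x0 - moll \<phi> v (x0 - z) - norm a * (e \<bullet> z)"
          have "\<bar>r\<bar> \<le> C' * (norm z)\<^sup>2"
            using c11D[OF moll_c11[OF v t C], of x0 "- z"] az[of z]
            by (simp add: r_def C'_def a_def[symmetric] abs_minus_commute algebra_simps)
          moreover have "\<bar>e \<bullet> z\<bar> \<le> \<delta>"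
            using Cauchy_Schwarz_ineq2[of e z] e False by simp
          ultimately have "\<bar>r\<bar> * \<bar>e \<bullet> z\<bar> \<le> (C' * (norm z)\<^sup>2) * \<delta>"
            using C' by (intro mult_mono) auto
          then have "- (C' * \<delta> * (norm z)\<^sup>2) \<le> r * (e \<bullet> z)"
            by (simp add: abs_mult[symmetric] mult_ac)
          then have "- (C' * \<delta> * (norm z)\<^sup>2) * q z \<le> r * (e \<bullet> z) * q z"
            using q0 by (rule mult_right_mono)
          then show ?thesis
            by (simp add: r_def algebra_simps power2_eq_square)
        qed (use elim in simp)
      qed
    qed
    finally show ?thesis .
  qed
  ultimately show ?thesis
    by (simp add: a_def C'_def)
qed

section \<open>Weak gradients by energy minimisation\<close>

lemma integrable_mult_test_function:
  assumes v: "integrable lborel v" and \<phi>: "test_function \<phi>"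
  shows "integrable lborel (\<lambda>x. v x * \<phi> x)"
proof -
  obtain B where "B > 0" and B: "\<And>x. \<bar>\<phi> x\<bar> \<le> B"
    using test_function_bounded[OF \<phi>] by blast
  note [measurable] = borel_measurable_integrable[OF v] test_function_measurable[OF \<phi>]
  show ?thesis
  proof (rule Bochner_Integration.integrable_bound)
    show "integrable lborel (\<lambda>x. B * v x)"
      using v by simp
    have "norm (v x * \<phi> x) \<le> norm (B * v x)" for x
      using mult_right_mono[OF B[of x], of "\<bar>v x\<bar>"] \<open>B > 0\<close> by (simp add: abs_mult mult.commute)
    then show "AE x in lborel. norm (v x * \<phi> x) \<le> norm (B * v x)"
      by simp
  qed measurable
qed

lemma integrable_bounded_mult_test_function:
  fixes g :: "'a::euclidean_space \<Rightarrow> real"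
  assumes [measurable]: "g \<in> borel_measurable borel" and B: "\<And>x. \<bar>g x\<bar> \<le> B" and \<phi>: "test_function \<phi>"
  shows "integrable lborel (\<lambda>x. g x * \<phi> x)"
proof (rule Bochner_Integration.integrable_bound)
  note [measurable] = test_function_measurable[OF \<phi>]
  show "integrable lborel (\<lambda>x. B * \<phi> x)"
    using test_function_integrable[OF \<phi>] by simp
  have "norm (g x * \<phi> x) \<le> norm (B * \<phi> x)" for x
    using mult_right_mono[OF order_trans[OF B[of x] abs_ge_self], of "\<bar>\<phi> x\<bar>"] by (simp add: abs_mult)
  then show "AE x in lborel. norm (g x * \<phi> x) \<le> norm (B * \<phi> x)"
    by simp
  show "(\<lambda>x. g x * \<phi> x) \<in> borel_measurable lborel"
    by measurable
qed

lemma abs_le_mult_all_imp_0: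
  fixes a C :: real
  assumes "\<And>t. t > 0 \<Longrightarrow> \<bar>a\<bar> \<le> C * t"
  shows "a = 0"
  using affine_bound_at_0[of "\<bar>a\<bar>" 0 C] assms by simp

text \<open>Integration by parts for difference quotients is just a translation of the integral; the
  Taylor remainders on both sides control the passage to derivatives.\<close>

lemma c11_integration_by_parts:
  fixes w :: "'a::euclidean_space \<Rightarrow> real"
  assumes w: "c11 C w g" and supp: "\<And>x. norm x > R \<Longrightarrow> w x = 0" and \<phi>: "test_function \<phi>" and i: "norm i = 1"
  shows "(LBINT x. w x * (grad \<phi> x \<bullet> i)) = - (LBINT x. (g x \<bullet> i) * \<phi> x)"
proof -
  obtain C' where C': "c11 C' \<phi> (grad \<phi>)"
    using test_function_c11[OF \<phi>] by blast
  obtain R' where R': "\<And>x. norm x \<ge> R' \<Longrightarrow> \<phi> x = 0"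
    using test_function_support[OF \<phi>] by blast
  have cw: "continuous_on UNIV w" and cg: "continuous_on UNIV g" and c\<phi>: "continuous_on UNIV \<phi>"
    and c\<phi>': "continuous_on UNIV (grad \<phi>)"
    using c11_continuous[OF w] c11_gradient_continuous[OF w] test_function_continuous_on[OF \<phi>] c11_gradient_continuous[OF C']
    by auto
  have w_int: "integrable lborel w"
    using cw supp by (rule integrable_lborel_compact_support)
  note [measurable] = borel_measurable_continuous_onI[OF cw] borel_measurable_continuous_onI[OF c\<phi>]
  define X Y where "X = (LBINT x. w x * (grad \<phi> x \<bullet> i))" and "Y = (LBINT x. (g x \<bullet> i) * \<phi> x)"
  have X_int: "integrable lborel (\<lambda>x. w x * (grad \<phi> x \<bullet> i))"
    by (rule integrable_lborel_compact_support[where R=R]) (use supp in \<open>auto intro!: continuous_intros cw c\<phi>'\<close>)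
  have Y_int: "integrable lborel (\<lambda>x. (g x \<bullet> i) * \<phi> x)"
    by (rule integrable_lborel_compact_support[where R=R']) (use R' in \<open>auto intro!: continuous_intros cg c\<phi>\<close>)
  have "\<bar>X + Y\<bar> \<le> (C' * (LBINT x. \<bar>w x\<bar>) + C * (LBINT x. \<bar>\<phi> x\<bar>)) * h" if "h > 0" for h
  proof -
    define k where "k = h *\<^sub>R i"
    have nk: "norm k = h"
      using i that by (simp add: k_def)
    have cw': "continuous_on UNIV (\<lambda>x. w (x + - k))"
      by (intro continuous_on_compose2[OF cw] continuous_intros) auto
    have c\<phi>k: "continuous_on UNIV (\<lambda>x. \<phi> (x + k))"
      by (intro continuous_on_compose2[OF c\<phi>] continuous_intros) auto
    have int1: "integrable lborel (\<lambda>x. w x * \<phi> (x + k))"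
      by (rule integrable_lborel_compact_support[where R=R]) (use supp in \<open>auto intro!: continuous_intros cw c\<phi>k\<close>)
    have int2: "integrable lborel (\<lambda>x. w x * \<phi> x)"
      by (rule integrable_lborel_compact_support[where R=R]) (use supp in \<open>auto intro!: continuous_intros cw c\<phi>\<close>)
    have int3: "integrable lborel (\<lambda>x. w (x + - k) * \<phi> x)"
      by (rule integrable_lborel_compact_support[where R=R']) (use R' in \<open>auto intro!: continuous_on_mult cw'[simplified] c\<phi>\<close>)
    have shift: "(LBINT x. w x * \<phi> (x + k)) = (LBINT x. w (x + - k) * \<phi> x)"
      using integral_lborel_translate[of "\<lambda>x. w x * \<phi> (x + k)" k] by simp
    \<comment> \<open>\<open>A\<close> is \<open>h * X\<close> when \<open>\<phi>\<close> is
      expanded, and \<open>- h * Y\<close> when the shift is moved to \<open>w\<close> and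
      \<open>w\<close> is expanded, each up to order h^2.\<close>
    define A where "A = (LBINT x. w x * \<phi> (x + k)) - (LBINT x. w x * \<phi> x)"
    have "\<bar>A - h * X\<bar> \<le> (C' * h\<^sup>2) * (LBINT x. \<bar>w x\<bar>)"
    proof -
      have "A - h * X = (LBINT x. w x * \<phi> (x + k) - w x * \<phi> x - h * (w x * (grad \<phi> x \<bullet> i)))"
        unfolding A_def X_def using int1 int2 X_int by simp
      also have "\<dots> = (LBINT x. w x * (\<phi> (x + k) - \<phi> x - grad \<phi> x \<bullet> k))"
        by (intro Bochner_Integration.integral_cong) (auto simp: k_def algebra_simps)
      finally have eq: "A - h * X = (LBINT x. w x * (\<phi> (x + k) - \<phi> x - grad \<phi> x \<bullet> k))" .
      have "norm (A - h * X) \<le> (LBINT x. (C' * h\<^sup>2) * \<bar>w x\<bar>)"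
      proof (subst eq, rule Bochner_Integration.integral_norm_bound_integral)
        show "integrable lborel (\<lambda>x. w x * (\<phi> (x + k) - \<phi> x - grad \<phi> x \<bullet> k))"
          by (rule integrable_lborel_compact_support[where R=R]) (use supp in \<open>auto intro!: continuous_intros cw c\<phi> c\<phi>' c\<phi>k\<close>)
        show "norm (w x * (\<phi> (x + k) - \<phi> x - grad \<phi> x \<bullet> k)) \<le> (C' * h\<^sup>2) * \<bar>w x\<bar>" for x
          using mult_left_mono[OF c11D[OF C', of x k] abs_ge_zero[of "w x"]] by (simp add: abs_mult nk mult.commute)
      qed (use w_int in auto)
      then show ?thesis
        by simp
    qed
    moreover have "\<bar>A + h * Y\<bar> \<le> (C * h\<^sup>2) * (LBINT x. \<bar>\<phi> x\<bar>)"
    proof -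
      have "A + h * Y = (LBINT x. w (x + - k) * \<phi> x - w x * \<phi> x + h * ((g x \<bullet> i) * \<phi> x))"
        unfolding A_def Y_def shift using int3 int2 Y_int by simp
      also have "\<dots> = (LBINT x. \<phi> x * (w (x + - k) - w x - g x \<bullet> (- k)))"
        by (intro Bochner_Integration.integral_cong) (auto simp: k_def algebra_simps)
      finally have eq: "A + h * Y = (LBINT x. \<phi> x * (w (x + - k) - w x - g x \<bullet> (- k)))" .
      have "norm (A + h * Y) \<le> (LBINT x. (C * h\<^sup>2) * \<bar>\<phi> x\<bar>)"
      proof (subst eq, rule Bochner_Integration.integral_norm_bound_integral)
        show "integrable lborel (\<lambda>x. \<phi> x * (w (x + - k) - w x - g x \<bullet> (- k)))"
          by (rule integrable_lborel_compact_support[where R=R'])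
            (use R' in \<open>auto intro!: continuous_on_mult continuous_on_diff continuous_on_add continuous_on_inner continuous_on_const cw cw'[simplified] c\<phi> cg\<close>)
        show "norm (\<phi> x * (w (x + - k) - w x - g x \<bullet> (- k))) \<le> (C * h\<^sup>2) * \<bar>\<phi> x\<bar>" for x
          using mult_left_mono[OF c11D[OF w, of x "- k"] abs_ge_zero[of "\<phi> x"]] by (simp add: abs_mult nk mult.commute)
      qed (use test_function_integrable[OF \<phi>] in auto)
      then show ?thesis
        by simp
    qed
    ultimately have "\<bar>h * X + h * Y\<bar> \<le> (C' * h\<^sup>2) * (LBINT x. \<bar>w x\<bar>) + (C * h\<^sup>2) * (LBINT x. \<bar>\<phi> x\<bar>)"
      by linarith
    moreover have "\<bar>h * X + h * Y\<bar> = h * \<bar>X + Y\<bar>"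
      using that by (simp add: abs_mult flip: distrib_left)
    ultimately have "h * \<bar>X + Y\<bar> \<le> h * ((C' * (LBINT x. \<bar>w x\<bar>) + C * (LBINT x. \<bar>\<phi> x\<bar>)) * h)"
      by (simp add: algebra_simps power2_eq_square)
    then show ?thesis
      using that by simp
  qed
  then have "X + Y = 0"
    by (rule abs_le_mult_all_imp_0)
  then show ?thesis
    by (simp add: X_def Y_def)
qed

lemma c11_gradient_support:
  assumes w: "c11 C w g" and supp: "\<And>x. norm x > R \<Longrightarrow> w x = 0" and x: "norm x > R"
  shows "g x = 0"
proof -
  have "open {x::'a. R < norm x}"
    by (intro open_Collect_less continuous_intros)
  then have "((\<lambda>x. 0) has_derivative (\<lambda>h. g x \<bullet> h)) (at x)"
    by (rule has_derivative_transform_within_open[OF c11_has_derivative[OF w]]) (use x supp in auto)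
  then have "(\<lambda>h. g x \<bullet> h) = (\<lambda>h. 0)"
    by (rule has_derivative_unique) simp
  then show ?thesis
    by (metis inner_eq_zero_iff)
qed

section \<open>Pointwise limits from summable increments\<close>

lemma convergent_if_summable_increments:
  fixes f :: "nat \<Rightarrow> 'a::banach"
  assumes "summable (\<lambda>j. norm (f (Suc j) - f j))"
  shows "convergent f"
proof -
  have "summable (\<lambda>j. f (Suc j) - f j)"
    using assms by (rule summable_norm_cancel)
  then have "(\<lambda>n. \<Sum>j<n. f (Suc j) - f j) \<longlonglongrightarrow> (\<Sum>j. f (Suc j) - f j)"
    by (rule summable_LIMSEQ)
  then have "(\<lambda>n. (f n - f 0) + f 0) \<longlonglongrightarrow> (\<Sum>j. f (Suc j) - f j) + f 0"
    unfolding sum_lessThan_telescope by (intro tendsto_intros)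
  then show ?thesis
    by (auto intro: convergentI)
qed

text \<open>The sum of the increments has finite integral, hence is finite almost
  everywhere.\<close>

lemma AE_convergent_if_summable_L1:
  fixes f :: "nat \<Rightarrow> 'a \<Rightarrow> 'b::{banach, second_countable_topology}"
  assumes int: "\<And>j. integrable M (f j)"
    and le: "\<And>j. (\<integral>x. norm (f (Suc j) x - f j x) \<partial>M) \<le> c j" and c: "summable c"
  shows "AE x in M. convergent (\<lambda>j. f j x)"
proof -
  note [measurable] = borel_measurable_integrable[OF int]
  have "(\<integral>\<^sup>+ x. (\<Sum>j. ennreal (norm (f (Suc j) x - f j x))) \<partial>M) = (\<Sum>j. \<integral>\<^sup>+ x. ennreal (norm (f (Suc j) x - f j x)) \<partial>M)"
    by (intro nn_integral_suminf) measurable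
  also have "\<dots> = (\<Sum>j. ennreal (\<integral>x. norm (f (Suc j) x - f j x) \<partial>M))"
    using int by (intro suminf_cong nn_integral_eq_integral integrable_norm Bochner_Integration.integrable_diff) auto
  also have "\<dots> \<le> (\<Sum>j. ennreal (c j))"
    by (intro suminf_le ennreal_leI le) auto
  also have "\<dots> < \<infinity>"
  proof -
    have "0 \<le> c j" for j
      by (rule order_trans[OF _ le[of j]]) (simp add: Bochner_Integration.integral_nonneg)
    then show ?thesis
      using c by (simp add: suminf_ennreal2)
  qed
  finally have "AE x in M. (\<Sum>j. ennreal (norm (f (Suc j) x - f j x))) \<noteq> \<infinity>"
    by (intro nn_integral_noteq_infinite) auto
  then show ?thesis
  proof eventually_elim
    case (elim x)
    then have "summable (\<lambda>j. norm (f (Suc j) x - f j x))"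
      by (intro summable_suminf_not_top) auto
    then show ?case
      by (rule convergent_if_summable_increments)
  qed
qed

text \<open>The constant \<open>C\<close> is left free, as it may blow up when \<open>\<tau>\<close>
  shrinks; the radius \<open>R\<close> is shared, which together with the unit gradient bound keeps
  all Dirichlet energies below the volume of one ball.\<close>

definition unit_c11_near :: "real \<Rightarrow> ('a::euclidean_space \<Rightarrow> real) \<Rightarrow> real \<Rightarrow> ('a \<Rightarrow> real) \<Rightarrow> ('a \<Rightarrow> 'a) \<Rightarrow> bool" where
  "unit_c11_near R v \<tau> w g \<longleftrightarrow> (\<exists>C. c11 C w g) \<and> (\<forall>x. norm (g x) \<le> 1) \<and> (\<forall>x. norm x > R \<longrightarrow> w x = 0) \<and>
     (LBINT x. \<bar>w x - v x\<bar>) \<le> \<tau>"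

lemma unit_c11_nearD:
  fixes w :: "'a::euclidean_space \<Rightarrow> real"
  assumes "unit_c11_near R v \<tau> w g"
  shows "\<exists>C. c11 C w g" "norm (g x) \<le> 1" "norm x > R \<Longrightarrow> w x = 0" "(LBINT x. \<bar>w x - v x\<bar>) \<le> \<tau>"
    "integrable lborel w" "continuous_on UNIV g" "norm x > R \<Longrightarrow> g x = 0"
    "integrable lborel (\<lambda>x. (norm (g x))\<^sup>2)" "integrable lborel g"
proof -
  show ex: "\<exists>C. c11 C w g" and "norm (g x) \<le> 1" and w0: "norm x > R \<Longrightarrow> w x = 0" and "(LBINT x. \<bar>w x - v x\<bar>) \<le> \<tau>" for x
    using assms by (auto simp: unit_c11_near_def)
  then obtain C where C: "c11 C w g"
    by blast
  show cont: "continuous_on UNIV g" and g0: "norm x > R \<Longrightarrow> g x = 0" for x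
    using c11_gradient_continuous[OF C] c11_gradient_support[OF C w0] by auto
  show "integrable lborel w"
    using c11_continuous[OF C] w0 by (rule integrable_lborel_compact_support)
  show "integrable lborel g"
    using cont g0 by (rule integrable_lborel_compact_support)
  show "integrable lborel (\<lambda>x. (norm (g x))\<^sup>2)"
    by (rule integrable_lborel_compact_support[where R=R]) (use g0 in \<open>auto intro!: continuous_intros cont\<close>)
qed

text \<open>Midpoints are all the convexity that the parallelogram law requires.\<close>

lemma unit_c11_near_midpoint:
  fixes w1 w2 :: "'a::euclidean_space \<Rightarrow> real"
  assumes v: "integrable lborel v" and 1: "unit_c11_near R v \<tau> w1 g1" and 2: "unit_c11_near R v \<tau> w2 g2"
  shows "unit_c11_near R v \<tau> (\<lambda>x. (w1 x + w2 x) / 2) (\<lambda>x. (g1 x + g2 x) /\<^sub>R 2)"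
  unfolding unit_c11_near_def
proof (intro conjI allI impI)
  obtain C1 C2 where C: "c11 C1 w1 g1" "c11 C2 w2 g2"
    using unit_c11_nearD(1)[OF 1] unit_c11_nearD(1)[OF 2] by blast
  have "\<bar>(w1 (x + h) + w2 (x + h)) / 2 - (w1 x + w2 x) / 2 - ((g1 x + g2 x) /\<^sub>R 2) \<bullet> h\<bar> \<le> (C1 + C2) / 2 * (norm h)\<^sup>2" for x h
  proof -
    have "(w1 (x + h) + w2 (x + h)) / 2 - (w1 x + w2 x) / 2 - ((g1 x + g2 x) /\<^sub>R 2) \<bullet> h =
       ((w1 (x + h) - w1 x - g1 x \<bullet> h) + (w2 (x + h) - w2 x - g2 x \<bullet> h)) / 2"
      by (simp add: inner_add_left field_simps)
    then show ?thesis
      using c11D[OF C(1), of x h] c11D[OF C(2), of x h] by (simp add: field_simps)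
  qed
  then show "\<exists>C. c11 C (\<lambda>x. (w1 x + w2 x) / 2) (\<lambda>x. (g1 x + g2 x) /\<^sub>R 2)"
    unfolding c11_def by blast
  show "norm ((g1 x + g2 x) /\<^sub>R 2) \<le> 1" for x
    using norm_triangle_ineq[of "g1 x" "g2 x"] unit_c11_nearD(2)[OF 1, of x] unit_c11_nearD(2)[OF 2, of x] by simp
  show "(w1 x + w2 x) / 2 = 0" if "R < norm x" for x
    using unit_c11_nearD(3)[OF 1 that] unit_c11_nearD(3)[OF 2 that] by simp
  have int: "integrable lborel (\<lambda>x. \<bar>w1 x - v x\<bar>)" "integrable lborel (\<lambda>x. \<bar>w2 x - v x\<bar>)"
    using unit_c11_nearD(5)[OF 1] unit_c11_nearD(5)[OF 2] v by auto
  have "(LBINT x. \<bar>(w1 x + w2 x) / 2 - v x\<bar>) \<le> (LBINT x. (\<bar>w1 x - v x\<bar> + \<bar>w2 x - v x\<bar>) / 2)"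
  proof (rule integral_mono)
    show "integrable lborel (\<lambda>x. \<bar>(w1 x + w2 x) / 2 - v x\<bar>)"
      using unit_c11_nearD(5)[OF 1] unit_c11_nearD(5)[OF 2] v by auto
    show "integrable lborel (\<lambda>x. (\<bar>w1 x - v x\<bar> + \<bar>w2 x - v x\<bar>) / 2)"
      using int by auto
    show "\<bar>(w1 x + w2 x) / 2 - v x\<bar> \<le> (\<bar>w1 x - v x\<bar> + \<bar>w2 x - v x\<bar>) / 2" for x
      by (simp add: field_simps)
  qed
  also have "\<dots> = ((LBINT x. \<bar>w1 x - v x\<bar>) + (LBINT x. \<bar>w2 x - v x\<bar>)) / 2"
    using int by simp
  also have "\<dots> \<le> \<tau>"
    using unit_c11_nearD(4)[OF 1] unit_c11_nearD(4)[OF 2] by simp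
  finally show "(LBINT x. \<bar>(w1 x + w2 x) / 2 - v x\<bar>) \<le> \<tau>" .
qed

lemma unit_c11_near_mono: "unit_c11_near R v \<tau> w g \<Longrightarrow> \<tau> \<le> \<tau>' \<Longrightarrow> unit_c11_near R v \<tau>' w g"
  by (auto simp: unit_c11_near_def)

text \<open>Almost-minimisers of the Dirichlet energy over the shrinking convex sets of unit-gradient
  functions near \<open>v\<close> are Cauchy by the parallelogram law: this is where the
  weak gradient of \<open>v\<close> comes from, without weak compactness or Rademacher's theorem.\<close>

lemma minimising_sequence:
  fixes v :: "'a::euclidean_space \<Rightarrow> real"
  assumes v: "integrable lborel v" and near: "\<And>\<tau>. \<tau> > 0 \<Longrightarrow> \<exists>w g. unit_c11_near R v \<tau> w g"
  obtains w g where "\<And>j::nat. unit_c11_near R v (1 / 2 ^ j) (w j) (g j)"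
    "\<And>j. (LBINT x. (norm (g (Suc j) x - g j x))\<^sup>2) \<le> 8 / 4 ^ j"
proof -
  define En where "En g = (LBINT x. (norm (g x))\<^sup>2)" for g :: "'a \<Rightarrow> 'a"
  define K where "K \<tau> = {En g |w g. unit_c11_near R v \<tau> w g}" for \<tau>
  define d where "d \<tau> = Inf (K \<tau>)" for \<tau>
  define vol where "vol = measure lborel (cball (0::'a) R)"
  have ind: "integrable lborel (indicator (cball 0 R) :: 'a \<Rightarrow> real)"
    using emeasure_bounded_finite[OF bounded_cball] by (simp add: integrable_indicator_iff)
  have En_le: "En g \<le> vol" if "unit_c11_near R v \<tau> w g" for \<tau> w g
  proof -
    have "En g \<le> (LBINT x. indicator (cball (0::'a) R) x)"
      unfolding En_def
    proof (rule integral_mono[of lborel _ "indicator (cball 0 R)"])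
      show "(norm (g x))\<^sup>2 \<le> indicator (cball 0 R) x" for x
        using unit_c11_nearD(2,7)[OF that, of x] by (auto simp: indicator_def abs_square_le_1 not_le)
    qed (use ind unit_c11_nearD(8)[OF that] in auto)
    then show ?thesis
      by (simp add: vol_def)
  qed
  have En_ge: "En g \<ge> 0" for g
    by (simp add: En_def Bochner_Integration.integral_nonneg)
  have bdd: "bdd_below (K \<tau>)" for \<tau>
    by (rule bdd_belowI[of _ 0]) (auto simp: K_def En_ge)
  have ne: "K \<tau> \<noteq> {}" if "\<tau> > 0" for \<tau>
    using near[OF that] by (auto simp: K_def)
  have d_le: "d \<tau> \<le> En g" if "unit_c11_near R v \<tau> w g" for \<tau> w g
    unfolding d_def using that by (intro cInf_lower bdd) (auto simp: K_def)
  have d_vol: "d \<tau> \<le> vol" if \<tau>: "\<tau> > 0" for \<tau>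
    using near[OF \<tau>] d_le En_le order_trans by blast
  have d_mono: "d \<tau>' \<le> d \<tau>" if "\<tau> > 0" "\<tau> \<le> \<tau>'" for \<tau> \<tau>'
    unfolding d_def using that ne by (intro cInf_superset_mono bdd) (auto simp: K_def intro: unit_c11_near_mono)
  \<comment> \<open>The infimal energy grows as \<open>\<tau>\<close> decreases, so this supremum is
    its limit; it is finite because all energies are bounded by \<open>vol\<close>.\<close>
  define D where "D = Sup (d ` {0<..})"
  have bddD: "bdd_above (d ` {0<..})"
    by (rule bdd_aboveI[of _ vol]) (use d_vol in auto)
  have d_D: "d \<tau> \<le> D" if "\<tau> > 0" for \<tau>
    unfolding D_def using that by (intro cSup_upper bddD) auto
  have "\<exists>\<tau>>0. D - 1 / 4 ^ j < d \<tau>" for j :: nat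
  proof -
    have "\<exists>y\<in>d ` {0<..}. D - 1 / 4 ^ j < y"
      using bddD by (subst less_cSup_iff[symmetric]) (auto simp: D_def[symmetric])
    then show ?thesis
      by auto
  qed
  then obtain \<tau> where \<tau>: "\<tau> j > 0" "D - 1 / 4 ^ j < d (\<tau> j)" for j
    by metis
  \<comment> \<open>The minimum over all earlier thresholds makes \<open>\<sigma>\<close>
    decreasing, so that the next function still competes at the current level; the cap
    \<open>1 / 2 ^ j\<close> forces convergence to \<open>v\<close> in L1.\<close>
  define \<sigma> where "\<sigma> j = min (1 / 2 ^ j) (Min (\<tau> ` {..j}))" for j
  have \<sigma>_pos: "\<sigma> j > 0" for j
    using \<tau> by (auto simp: \<sigma>_def)
  have \<sigma>_le: "\<sigma> j \<le> \<tau> j" "\<sigma> j \<le> 1 / 2 ^ j" for j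
    by (auto simp: \<sigma>_def intro: min.coboundedI2)
  have \<sigma>_dec: "\<sigma> (Suc j) \<le> \<sigma> j" for j
  proof -
    have "Min (\<tau> ` {..Suc j}) \<le> Min (\<tau> ` {..j})"
      by (intro Min_antimono image_mono) auto
    moreover have "1 / 2 ^ Suc j \<le> (1::real) / 2 ^ j"
      by (simp add: field_simps)
    ultimately show ?thesis
      unfolding \<sigma>_def by (intro min.mono)
  qed
  have d\<sigma>: "D - 1 / 4 ^ j < d (\<sigma> j)" for j
    using \<tau>(2)[of j] d_mono[OF \<sigma>_pos \<sigma>_le(1), of j] by simp
  have "\<exists>w g. unit_c11_near R v (\<sigma> j) w g \<and> En g < d (\<sigma> j) + 1 / 4 ^ j" for j
  proof -
    have "\<exists>y\<in>K (\<sigma> j). y < d (\<sigma> j) + 1 / 4 ^ j"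
      using ne[OF \<sigma>_pos] bdd by (subst cInf_less_iff[symmetric]) (auto simp: d_def)
    then show ?thesis
      by (auto simp: K_def)
  qed
  then obtain w g where wg: "unit_c11_near R v (\<sigma> j) (w j) (g j)" "En (g j) < d (\<sigma> j) + 1 / 4 ^ j" for j
    by metis
  show thesis
  proof (rule that)
    show "unit_c11_near R v (1 / 2 ^ j) (w j) (g j)" for j
      using wg(1) \<sigma>_le(2) by (rule unit_c11_near_mono)
    fix j
    let ?m = "\<lambda>x. (g j x + g (Suc j) x) /\<^sub>R 2"
    note near_Suc = unit_c11_near_mono[OF wg(1) \<sigma>_dec, of j]
    note mid = unit_c11_near_midpoint[OF v wg(1)[of j] near_Suc]
    \<comment> \<open>The midpoint competes at level \<open>j\<close>, so its energy exceeds D -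
      1/4^j. The errors add up to (2 + 1/2 + 4)/4^j, which stays below the 8/4^j claimed.\<close>
    have lin: "2 * a + 2 * b - 4 * m \<le> 2 * (D + p) + 2 * (D + r) - 4 * (D - p)"
      if "a < s + p" "b < t + r" "s \<le> D" "t \<le> D" "s \<le> m" "D - p < s" for a b m p r s t
      using that by (smt (verit))
    have "(norm (g (Suc j) x - g j x))\<^sup>2 = 2 * (norm (g j x))\<^sup>2 + 2 * (norm (g (Suc j) x))\<^sup>2 - 4 * (norm (?m x))\<^sup>2" for x
      unfolding power2_norm_eq_inner by (simp add: inner_simps inner_commute algebra_simps)
    then have "(LBINT x. (norm (g (Suc j) x - g j x))\<^sup>2) = 2 * En (g j) + 2 * En (g (Suc j)) - 4 * En ?m"
      unfolding En_def using unit_c11_nearD(8)[OF wg(1)] unit_c11_nearD(8)[OF mid] by simp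
    also have "\<dots> \<le> 2 * (D + 1 / 4 ^ j) + 2 * (D + 1 / 4 ^ Suc j) - 4 * (D - 1 / 4 ^ j)"
      using wg(2)[of j] wg(2)[of "Suc j"] d_D[OF \<sigma>_pos, of j] d_D[OF \<sigma>_pos, of "Suc j"] d_le[OF mid] d\<sigma>[of j]
      by (rule lin)
    also have "\<dots> \<le> 8 / 4 ^ j"
      by (simp add: field_simps)
    finally show "(LBINT x. (norm (g (Suc j) x - g j x))\<^sup>2) \<le> 8 / 4 ^ j" .
  qed
qed

definition lborel_weak_gradient :: "('a::euclidean_space \<Rightarrow> real) \<Rightarrow> ('a \<Rightarrow> 'a) \<Rightarrow> bool" where
  "lborel_weak_gradient v g \<longleftrightarrow> (\<forall>\<phi> i. test_function \<phi> \<longrightarrow> i \<in> Basis \<longrightarrow>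
     (LBINT x. v x * (grad \<phi> x \<bullet> i)) = - (LBINT x. (g x \<bullet> i) * \<phi> x))"

text \<open>On the common bounded support the L2 decay of the gradient increments gives summable L1
  increments, hence pointwise convergence; the bound by one then lets dominated convergence carry
  integration by parts to the limit.\<close>

lemma unit_c11_near_weak_gradient:
  fixes v :: "'a::euclidean_space \<Rightarrow> real"
  assumes v: "integrable lborel v" and near: "\<And>\<tau>. \<tau> > 0 \<Longrightarrow> \<exists>w g. unit_c11_near R v \<tau> w g"
  obtains g where "g \<in> borel_measurable borel" "\<And>x. norm (g x) \<le> 1" "lborel_weak_gradient v g"
proof -
  obtain w g where near_j: "\<And>j::nat. unit_c11_near R v (1 / 2 ^ j) (w j) (g j)"
    and L2: "\<And>j. (LBINT x. (norm (g (Suc j) x - g j x))\<^sup>2) \<le> 8 / 4 ^ j"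
    using minimising_sequence[OF v near] by blast
  note D = unit_c11_nearD[OF near_j]
  have [measurable]: "g j \<in> borel_measurable borel" for j
    using D(6) by (rule borel_measurable_continuous_onI)
  define vol where "vol = measure lborel (cball (0::'a) R)"
  have ind: "integrable lborel (indicator (cball 0 R) :: 'a \<Rightarrow> real)"
    using emeasure_bounded_finite[OF bounded_cball] by (simp add: integrable_indicator_iff)
  have "AE x in lborel. convergent (\<lambda>j. g j x)"
  proof (rule AE_convergent_if_summable_L1[where c="\<lambda>j. (vol / 2 + 4) * (1 / 2) ^ j"])
    show "summable (\<lambda>j. (vol / 2 + 4) * (1 / 2) ^ j)"
      by (intro summable_mult summable_geometric) simp
    fix j
    have int2: "integrable lborel (\<lambda>x. (norm (g (Suc j) x - g j x))\<^sup>2)"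
      by (rule integrable_lborel_compact_support[where R=R]) (use D(7) in \<open>auto intro!: continuous_intros D(6)\<close>)
    \<comment> \<open>Young's inequality with weight 2^j makes the volume term and the squared
      increment, of order 4^(-j), both of order 2^(-j).\<close>
    have "(LBINT x. norm (g (Suc j) x - g j x)) \<le>
        (LBINT x. ((1 / 2) ^ j / 2) * indicator (cball 0 R) x + (2 ^ j / 2) * (norm (g (Suc j) x - g j x))\<^sup>2)"
    proof (rule integral_mono)
      show "integrable lborel (\<lambda>x. norm (g (Suc j) x - g j x))"
        using D(9) by (intro integrable_norm Bochner_Integration.integrable_diff)
      show "integrable lborel (\<lambda>x. ((1 / 2) ^ j / 2) * indicator (cball 0 R) x + (2 ^ j / 2) * (norm (g (Suc j) x - g j x))\<^sup>2)"
        using ind int2 by auto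
      fix x
      define r where "r = norm (g (Suc j) x - g j x)"
      show "norm (g (Suc j) x - g j x) \<le> ((1 / 2) ^ j / 2) * indicator (cball 0 R) x + (2 ^ j / 2) * (norm (g (Suc j) x - g j x))\<^sup>2"
      proof (cases "norm x > R")
        case False
        have "0 \<le> (1 - 2 ^ j * r)\<^sup>2 / 2 ^ j"
          by simp
        then have "2 * r \<le> 1 / 2 ^ j + 2 ^ j * r\<^sup>2"
          by (simp add: power2_eq_square field_simps)
        then show ?thesis
          using False by (simp add: r_def[symmetric] power_one_over)
      qed (simp add: D(7))
    qed
    also have "\<dots> = ((1 / 2) ^ j / 2) * vol + (2 ^ j / 2) * (LBINT x. (norm (g (Suc j) x - g j x))\<^sup>2)"
      using ind int2 by (simp add: vol_def)
    also have "\<dots> \<le> ((1 / 2) ^ j / 2) * vol + (2 ^ j / 2) * (8 / 4 ^ j)"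
      using L2[of j] by (intro add_left_mono mult_left_mono) auto
    also have "\<dots> = (vol / 2 + 4) * (1 / 2) ^ j"
    proof -
      have "(4::real) ^ j = 2 ^ j * 2 ^ j"
        by (simp flip: power_mult_distrib)
      then show ?thesis
        by (simp add: power_one_over field_simps)
    qed
    finally show "(LBINT x. norm (g (Suc j) x - g j x)) \<le> (vol / 2 + 4) * (1 / 2) ^ j" .
  qed (use D(9) in auto)
  then have AE_lim: "AE x in lborel. (\<lambda>j. g j x) \<longlonglongrightarrow> lim (\<lambda>j. g j x)"
    by eventually_elim (simp add: convergent_LIMSEQ_iff)
  \<comment> \<open>\<open>lim\<close> says nothing where the sequence diverges; the default 0
    there, whenever the value is too large, makes the unit bound hold everywhere.\<close>
  define G where "G x = (if norm (lim (\<lambda>j. g j x)) \<le> 1 then lim (\<lambda>j. g j x) else 0)" for x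
  have [measurable]: "(\<lambda>x. lim (\<lambda>j. g j x)) \<in> borel_measurable borel"
    by (intro borel_measurable_lim_metric) measurable
  have [measurable]: "G \<in> borel_measurable borel"
    unfolding G_def by measurable
  have G1: "norm (G x) \<le> 1" for x
    by (simp add: G_def)
  have AE_G: "AE x in lborel. (\<lambda>j. g j x) \<longlonglongrightarrow> G x"
    using AE_lim
  proof eventually_elim
    case (elim x)
    then have "norm (lim (\<lambda>j. g j x)) \<le> 1"
      using tendsto_norm[OF elim] by (rule_tac LIMSEQ_le_const2) (auto intro: D(2))
    then show ?case
      using elim by (simp add: G_def)
  qed
  have "(LBINT x. v x * (grad \<phi> x \<bullet> i)) = - (LBINT x. (G x \<bullet> i) * \<phi> x)"
    if \<phi>: "test_function \<phi>" and i: "i \<in> Basis" for \<phi> i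
  proof (rule LIMSEQ_unique)
    note [measurable] = test_function_measurable[OF \<phi>]
    have partial: "test_function (\<lambda>x. grad \<phi> x \<bullet> i)"
      using test_function_partial[OF \<phi> i] by (simp add: grad_inner_Basis[OF i])
    obtain B where "B > 0" and B: "\<And>x. \<bar>grad \<phi> x \<bullet> i\<bar> \<le> B"
      using test_function_bounded[OF partial] by blast
    show "(\<lambda>j. \<integral>x. w j x * (grad \<phi> x \<bullet> i) \<partial>lborel) \<longlonglongrightarrow> (LBINT x. v x * (grad \<phi> x \<bullet> i))"
    proof (rule LIM_zero_cancel, rule Lim_null_comparison)
      show "(\<lambda>j. B * (1 / 2) ^ j) \<longlonglongrightarrow> 0"
        by (intro tendsto_mult_right_zero LIMSEQ_power_zero) simp
      have "norm ((LBINT x. w j x * (grad \<phi> x \<bullet> i)) - (LBINT x. v x * (grad \<phi> x \<bullet> i))) \<le> B * (1 / 2) ^ j" for j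
      proof -
        have "(LBINT x. w j x * (grad \<phi> x \<bullet> i)) - (LBINT x. v x * (grad \<phi> x \<bullet> i)) =
          (LBINT x. (w j x - v x) * (grad \<phi> x \<bullet> i))"
          using integrable_mult_test_function[OF D(5) partial] integrable_mult_test_function[OF v partial]
          by (simp add: left_diff_distrib)
        moreover have "norm (LBINT x. (w j x - v x) * (grad \<phi> x \<bullet> i)) \<le> (LBINT x. B * \<bar>w j x - v x\<bar>)"
        proof (rule Bochner_Integration.integral_norm_bound_integral)
          show "integrable lborel (\<lambda>x. (w j x - v x) * (grad \<phi> x \<bullet> i))"
            using D(5) v by (intro integrable_mult_test_function partial Bochner_Integration.integrable_diff)
          show "norm ((w j x - v x) * (grad \<phi> x \<bullet> i)) \<le> B * \<bar>w j x - v x\<bar>" for x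
            using mult_left_mono[OF B[of x], of "\<bar>w j x - v x\<bar>"] by (simp add: abs_mult mult.commute)
        qed (use D(5) v in auto)
        moreover have "B * (LBINT x. \<bar>w j x - v x\<bar>) \<le> B * (1 / 2) ^ j"
          using D(4)[of j] \<open>B > 0\<close> by (intro mult_left_mono) (auto simp: power_one_over)
        ultimately show ?thesis
          by simp
      qed
      then show "\<forall>\<^sub>F j in sequentially. norm ((LBINT x. w j x * (grad \<phi> x \<bullet> i)) - (LBINT x. v x * (grad \<phi> x \<bullet> i))) \<le> B * (1 / 2) ^ j"
        by simp
    qed
    have ibp: "(LBINT x. w j x * (grad \<phi> x \<bullet> i)) = - (LBINT x. (g j x \<bullet> i) * \<phi> x)" for j
    proof -
      obtain C where "c11 C (w j) (g j)"
        using D(1) by blast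
      then show ?thesis
        using c11_integration_by_parts[OF _ D(3) \<phi>] i by simp
    qed
    have "(\<lambda>j. \<integral>x. (g j x \<bullet> i) * \<phi> x \<partial>lborel) \<longlonglongrightarrow> (LBINT x. (G x \<bullet> i) * \<phi> x)"
    proof (rule integral_dominated_convergence[where w="\<lambda>x. \<bar>\<phi> x\<bar>"])
      show "integrable lborel (\<lambda>x. \<bar>\<phi> x\<bar>)"
        using test_function_integrable[OF \<phi>] by simp
      show "AE x in lborel. (\<lambda>j. (g j x \<bullet> i) * \<phi> x) \<longlonglongrightarrow> (G x \<bullet> i) * \<phi> x"
        using AE_G by eventually_elim (intro tendsto_intros)
      have "norm ((g j x \<bullet> i) * \<phi> x) \<le> \<bar>\<phi> x\<bar>" for j x
        using mult_right_mono[OF order_trans[OF Basis_le_norm[OF i, of "g j x"] D(2)] abs_ge_zero[of "\<phi> x"]] by (simp add: abs_mult)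
      then show "AE x in lborel. norm ((g j x \<bullet> i) * \<phi> x) \<le> \<bar>\<phi> x\<bar>" for j
        by simp
    qed measurable
    then show "(\<lambda>j. \<integral>x. w j x * (grad \<phi> x \<bullet> i) \<partial>lborel) \<longlonglongrightarrow> - (LBINT x. (G x \<bullet> i) * \<phi> x)"
      unfolding ibp by (rule tendsto_minus)
  qed
  then show thesis
    using that[of G] G1 by (simp add: lborel_weak_gradient_def)
qed

section \<open>Limits of nonlocally constrained functions\<close>

text \<open>The mollifier stays fixed while \<open>k\<close> grows, so its remainder constant does
  not compete with \<open>\<delta> k\<close>; replacing \<open>vk k\<close> by \<open>v\<close>
  costs the sup norm of \<open>grad \<phi>\<close> times their L1 distance.\<close>

lemma norm_grad_moll_limit_le:
  fixes v :: "'a::euclidean_space \<Rightarrow> real"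
  assumes vk: "\<And>k::nat. integrable lborel (vk k)" and v: "integrable lborel v"
    and L1: "(\<lambda>k. \<integral>x. \<bar>vk k x - v x\<bar> \<partial>lborel) \<longlonglongrightarrow> 0"
    and \<delta>: "\<delta> \<longlonglongrightarrow> 0" "\<And>k. \<delta> k > 0"
    and q: "\<And>k. normalized_kernel (\<delta> k) (q k)" and unit: "\<And>k. nonlocal_unit (q k) (vk k)"
    and \<phi>: "mollifier \<epsilon> \<phi>"
  shows "norm (moll (grad \<phi>) v x) \<le> 1"
proof -
  note t = mollifierD(1)[OF \<phi>]
  obtain C where C: "c11 C \<phi> (grad \<phi>)"
    using test_function_c11[OF t] by blast
  obtain B where "B > 0" and B: "\<And>x. norm (grad \<phi> x) \<le> B"
    using test_function_grad_bounded[OF t] by blast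
  define e where "e k = (LBINT x. \<bar>vk k x - v x\<bar>)" for k
  have e0: "e \<longlonglongrightarrow> 0"
    using L1 by (simp only: e_def[abs_def])
  define N where "N = (LBINT x. \<bar>v x\<bar>)"
  have le: "norm (moll (grad \<phi>) v x) \<le> 1 + C * (N + e k) * \<delta> k * DIM('a) + B * e k" for k
  proof -
    have "moll (grad \<phi>) (\<lambda>y. vk k y - v y) x = moll (grad \<phi>) (vk k) x - moll (grad \<phi>) v x"
      by (rule moll_diff[OF vk v test_function_grad_measurable[OF t] B])
    moreover have "norm (moll (grad \<phi>) (\<lambda>y. vk k y - v y) x) \<le> B * e k"
      using moll_norm_le[OF Bochner_Integration.integrable_diff[OF vk v] test_function_grad_measurable[OF t] B, of k x]
      by (simp add: e_def)
    ultimately have 1: "norm (moll (grad \<phi>) v x) \<le> norm (moll (grad \<phi>) (vk k) x) + B * e k"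
      using norm_triangle_ineq2[of "moll (grad \<phi>) v x" "moll (grad \<phi>) (vk k) x"] by (simp add: norm_minus_commute)
    have "(LBINT x. \<bar>vk k x\<bar>) \<le> (LBINT x. \<bar>v x\<bar> + \<bar>vk k x - v x\<bar>)"
      using vk v by (intro integral_mono) auto
    also have "\<dots> = N + e k"
      using vk v by (simp add: N_def e_def)
    finally have "C * (LBINT x. norm (vk k x)) * \<delta> k * DIM('a) \<le> C * (N + e k) * \<delta> k * DIM('a)"
      using c11_nonneg[OF C] \<delta>(2)[of k] by (intro mult_right_mono mult_left_mono) auto
    then show ?thesis
      using norm_grad_moll_le[OF q[of k] vk[of k] unit[of k] \<phi> C \<delta>(2)[of k], of x] 1 by linarith
  qed
  have "(\<lambda>k. 1 + C * (N + e k) * \<delta> k * DIM('a) + B * e k) \<longlonglongrightarrow> 1 + C * (N + 0) * 0 * DIM('a) + B * 0"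
    by (intro tendsto_add tendsto_mult tendsto_const \<delta> e0)
  then have "(\<lambda>k. 1 + C * (N + e k) * \<delta> k * DIM('a) + B * e k) \<longlonglongrightarrow> 1"
    by simp
  then show ?thesis
    by (rule LIMSEQ_le_const) (intro exI allI impI le)
qed

text \<open>Kernels of width at most one enlarge the support by at most one, hence
  \<open>R + 1\<close>.\<close>

lemma unit_gradient_mollified:
  fixes v :: "'a::euclidean_space \<Rightarrow> real"
  assumes v: "integrable lborel v" and supp: "\<And>x. norm x > R \<Longrightarrow> v x = 0"
    and grad: "\<And>\<epsilon> \<phi> x. mollifier \<epsilon> \<phi> \<Longrightarrow> norm (moll (grad \<phi>) v x) \<le> 1" and "\<tau> > 0"
  shows "\<exists>w g. unit_c11_near (R + 1) v \<tau> w g"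
proof -
  obtain \<epsilon> where "\<epsilon> > 0" and \<epsilon>: "\<And>\<epsilon>' \<phi>. \<epsilon>' \<le> \<epsilon> \<Longrightarrow> mollifier \<epsilon>' \<phi> \<Longrightarrow> (LBINT x. \<bar>moll \<phi> v x - v x\<bar>) < \<tau>"
    using moll_L1_conv[OF v supp \<open>\<tau> > 0\<close>] by blast
  obtain \<phi> :: "'a \<Rightarrow> real" where \<phi>: "mollifier (min \<epsilon> 1) \<phi>"
    using ex_mollifier[of "min \<epsilon> 1"] \<open>\<epsilon> > 0\<close> by auto
  note t = mollifierD(1)[OF \<phi>]
  obtain C where C: "c11 C \<phi> (grad \<phi>)"
    using test_function_c11[OF t] by blast
  have "moll \<phi> v x = 0" if "norm x > R + 1" for x
  proof (rule moll_support[OF \<phi>])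
    show "v y = 0" if "norm (y - x) < min \<epsilon> 1" for y
      using that \<open>norm x > R + 1\<close> norm_triangle_ineq2[of x y] by (intro supp) (auto simp: norm_minus_commute)
  qed
  then have "unit_c11_near (R + 1) v \<tau> (moll \<phi> v) (moll (grad \<phi>) v)"
    unfolding unit_c11_near_def using moll_c11[OF v t C] grad[OF \<phi>] \<epsilon>[OF _ \<phi>] by (auto intro: less_imp_le)
  then show ?thesis
    by blast
qed

lemma dense_if_AE:
  fixes S :: "'a::euclidean_space set"
  assumes "AE x in lborel. x \<in> S"
  shows "closure S = UNIV"
proof -
  have "AE x in lebesgue. x \<in> closure S"
    unfolding AE_completion_iff using assms by eventually_elim (use closure_subset in auto)
  then show ?thesis
    using mem_closed_if_AE_lebesgue[OF closed_closure] by blast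
qed

text \<open>All mollifications share the constant \<open>M\<close>. An almost everywhere convergent
  subsequence hands it to \<open>v\<close> on a set of full measure, which is dense, and a Lipschitz
  function extends to the closure.\<close>

lemma lipschitz_representative:
  fixes v :: "'a::euclidean_space \<Rightarrow> real"
  assumes v: "integrable lborel v" and supp: "\<And>x. norm x > R \<Longrightarrow> v x = 0"
    and grad: "\<And>\<epsilon> \<phi> x. mollifier \<epsilon> \<phi> \<Longrightarrow> norm (moll (grad \<phi>) v x) \<le> M" and "M \<ge> 0"
  obtains V where "M-lipschitz_on UNIV V" "AE x in lborel. v x = V x"
proof -
  have "\<exists>\<phi> \<epsilon>. mollifier \<epsilon> \<phi> \<and> (LBINT x. \<bar>moll \<phi> v x - v x\<bar>) < 1 / real (Suc n)" for n
  proof -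
    have "1 / real (Suc n) > 0"
      by simp
    then obtain \<epsilon> where "\<epsilon> > 0" and \<epsilon>: "\<And>\<epsilon>' \<phi>. \<epsilon>' \<le> \<epsilon> \<Longrightarrow> mollifier \<epsilon>' \<phi> \<Longrightarrow> (LBINT x. \<bar>moll \<phi> v x - v x\<bar>) < 1 / real (Suc n)"
      using moll_L1_conv[OF v supp] by blast
    obtain \<phi> :: "'a \<Rightarrow> real" where "mollifier \<epsilon> \<phi>"
      using ex_mollifier[OF \<open>\<epsilon> > 0\<close>] by blast
    then show ?thesis
      using \<epsilon> by blast
  qed
  then obtain \<phi> \<epsilon> where \<phi>: "\<And>n. mollifier (\<epsilon> n) (\<phi> n)" and close: "\<And>n. (LBINT x. \<bar>moll (\<phi> n) v x - v x\<bar>) < 1 / real (Suc n)"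
    by metis
  have "\<exists>r::nat\<Rightarrow>nat. strict_mono r \<and> (AE x in lborel. (\<lambda>n. moll (\<phi> (r n)) v x - v x) \<longlonglongrightarrow> 0)"
  proof (rule tendsto_L1_AE_subseq)
    show "integrable lborel (\<lambda>x. moll (\<phi> n) v x - v x)" for n
      using moll_integrable[OF v \<phi>] v by (intro Bochner_Integration.integrable_diff)
    show "(\<lambda>n. \<integral>x. norm (moll (\<phi> n) v x - v x) \<partial>lborel) \<longlonglongrightarrow> 0"
    proof (rule Lim_null_comparison)
      show "\<forall>\<^sub>F n in sequentially. norm (LBINT x. norm (moll (\<phi> n) v x - v x)) \<le> 1 / real (Suc n)"
        using close by (simp add: less_imp_le)
      show "(\<lambda>n. 1 / real (Suc n)) \<longlonglongrightarrow> 0"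
        using LIMSEQ_inverse_real_of_nat by (simp add: inverse_eq_divide)
    qed
  qed
  then obtain r where r: "AE x in lborel. (\<lambda>n. moll (\<phi> (r n)) v x - v x) \<longlonglongrightarrow> 0"
    by blast
  define S where "S = {x. (\<lambda>n. moll (\<phi> (r n)) v x) \<longlonglongrightarrow> v x}"
  have AE_S: "AE x in lborel. x \<in> S"
    using r by eventually_elim (simp add: S_def LIM_zero_iff)
  have "M-lipschitz_on S v"
  proof (rule lipschitz_onI[OF _ \<open>M \<ge> 0\<close>])
    fix x y assume xy: "x \<in> S" "y \<in> S"
    have "\<bar>moll (\<phi> n) v x - moll (\<phi> n) v y\<bar> \<le> M * norm (x - y)" for n
    proof -
      note t = mollifierD(1)[OF \<phi>]
      obtain C where C: "c11 C (\<phi> n) (grad (\<phi> n))"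
        using test_function_c11[OF t] by blast
      show ?thesis
        by (rule c11_bounded_gradient_lipschitz[OF moll_c11[OF v t C] grad[OF \<phi>]])
    qed
    moreover have "(\<lambda>n. \<bar>moll (\<phi> (r n)) v x - moll (\<phi> (r n)) v y\<bar>) \<longlonglongrightarrow> \<bar>v x - v y\<bar>"
      using xy by (intro tendsto_intros) (auto simp: S_def)
    ultimately have "\<bar>v x - v y\<bar> \<le> M * norm (x - y)"
      by (intro LIMSEQ_le_const2) auto
    then show "dist (v x) (v y) \<le> M * dist x y"
      by (simp add: dist_norm)
  qed
  then obtain V where V: "M-lipschitz_on (closure S) V" "\<And>x. x \<in> S \<Longrightarrow> V x = v x"
    using lipschitz_extend_closure by blast
  show thesis
  proof (rule that)
    show "M-lipschitz_on UNIV V"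
      using V(1) by (simp add: dense_if_AE[OF AE_S])
    show "AE x in lborel. v x = V x"
      using AE_S by eventually_elim (simp add: V(2))
  qed
qed

section \<open>Square-integrable functions on the domain\<close>

text \<open>Young's inequality with a free weight \<open>t\<close>: a small \<open>t\<close> makes
  the part with \<open>f\<close> small for every \<open>k\<close>, and the other part vanishes in
  the limit with \<open>t\<close> fixed.\<close>

lemma L2_tendsto_product:
  fixes f :: "'b \<Rightarrow> real" and d :: "nat \<Rightarrow> 'b \<Rightarrow> real"
  assumes [measurable]: "f \<in> borel_measurable M" "\<And>k. d k \<in> borel_measurable M"
    and f: "integrable M (\<lambda>x. (f x)\<^sup>2)" and d: "\<And>k. integrable M (\<lambda>x. (d k x)\<^sup>2)"
    and lim: "(\<lambda>k. \<integral>x. (d k x)\<^sup>2 \<partial>M) \<longlonglongrightarrow> 0"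
  shows "integrable M (\<lambda>x. f x * d k x)" "(\<lambda>k. \<integral>x. \<bar>f x * d k x\<bar> \<partial>M) \<longlonglongrightarrow> 0"
proof -
  have le: "\<bar>f x * d k x\<bar> \<le> t * (f x)\<^sup>2 + (d k x)\<^sup>2 / t" if "t > 0" for x k t
  proof -
    have "0 \<le> (t * \<bar>f x\<bar> - \<bar>d k x\<bar>)\<^sup>2 / t"
      using that by simp
    also have "\<dots> = t * (f x)\<^sup>2 + (d k x)\<^sup>2 / t - 2 * \<bar>f x * d k x\<bar>"
      using that by (simp add: power2_diff power_mult_distrib field_simps abs_mult) (simp add: power2_eq_square)
    finally show ?thesis
      using abs_ge_zero[of "f x * d k x"] by linarith
  qed
  show int: "integrable M (\<lambda>x. f x * d k x)" for k
  proof (rule Bochner_Integration.integrable_bound)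
    show "integrable M (\<lambda>x. (f x)\<^sup>2 + (d k x)\<^sup>2)"
      using f d by auto
    show "AE x in M. norm (f x * d k x) \<le> norm ((f x)\<^sup>2 + (d k x)\<^sup>2)"
      using le[of 1] by simp
  qed measurable
  have nonneg: "(\<integral>x. \<bar>f x * d k x\<bar> \<partial>M) \<ge> 0" for k
    by (simp add: Bochner_Integration.integral_nonneg)
  show "(\<lambda>k. \<integral>x. \<bar>f x * d k x\<bar> \<partial>M) \<longlonglongrightarrow> 0"
  proof (rule LIMSEQ_I)
    fix r :: real assume "r > 0"
    define F where "F = (\<integral>x. (f x)\<^sup>2 \<partial>M)"
    have F: "F \<ge> 0"
      by (simp add: F_def Bochner_Integration.integral_nonneg)
    define t where "t = r / (2 * (F + 1))"
    have t: "t > 0"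
      using \<open>r > 0\<close> F by (simp add: t_def)
    have tF: "t * F < r / 2"
      using \<open>r > 0\<close> F by (simp add: t_def field_simps)
    have "\<forall>\<^sub>F k in sequentially. (\<integral>x. (d k x)\<^sup>2 \<partial>M) < t * (r / 2)"
      using lim t \<open>r > 0\<close> by (intro order_tendstoD(2)[OF lim]) simp
    then obtain K where K: "\<And>k. k \<ge> K \<Longrightarrow> (\<integral>x. (d k x)\<^sup>2 \<partial>M) < t * (r / 2)"
      by (auto simp: eventually_sequentially)
    have "norm ((\<integral>x. \<bar>f x * d k x\<bar> \<partial>M) - 0) < r" if "k \<ge> K" for k
    proof -
      have "(\<integral>x. \<bar>f x * d k x\<bar> \<partial>M) \<le> (\<integral>x. t * (f x)\<^sup>2 + (d k x)\<^sup>2 / t \<partial>M)"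
        using int[of k] f d le[OF t] by (intro integral_mono integrable_abs) auto
      also have "\<dots> = t * F + (\<integral>x. (d k x)\<^sup>2 \<partial>M) / t"
        using f d by (simp add: F_def)
      also have "(\<integral>x. (d k x)\<^sup>2 \<partial>M) / t < r / 2"
        using K[OF that] t by (simp add: field_simps)
      finally show ?thesis
        using tF nonneg[of k] by simp
    qed
    then show "\<exists>no. \<forall>n\<ge>no. norm ((\<integral>x. \<bar>f x * d n x\<bar> \<partial>M) - 0) < r"
      by blast
  qed
qed

section \<open>Continuity of the linear functional\<close>

lemma L2_diff:
  assumes "L2 \<Omega> u" "L2 \<Omega> v"
  shows "L2 \<Omega> (\<lambda>x. u x - v x)"
  unfolding L2_def
proof
  have [measurable]: "u \<in> borel_measurable (lebesgue_on \<Omega>)" "v \<in> borel_measurable (lebesgue_on \<Omega>)"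
    using assms by (auto simp: L2_def)
  show "(\<lambda>x. u x - v x) \<in> borel_measurable (lebesgue_on \<Omega>)"
    by measurable
  show "integrable (lebesgue_on \<Omega>) (\<lambda>x. (u x - v x)\<^sup>2)"
  proof (rule Bochner_Integration.integrable_bound)
    show "integrable (lebesgue_on \<Omega>) (\<lambda>x. 2 * (u x)\<^sup>2 + 2 * (v x)\<^sup>2)"
      using assms by (auto simp: L2_def)
    have "(u x - v x)\<^sup>2 \<le> 2 * (u x)\<^sup>2 + 2 * (v x)\<^sup>2" for x
      using zero_le_power2[of "u x + v x"] by (simp add: power2_diff power2_sum)
    then show "AE x in lebesgue_on \<Omega>. norm ((u x - v x)\<^sup>2) \<le> norm (2 * (u x)\<^sup>2 + 2 * (v x)\<^sup>2)"
      by (intro AE_I2) simp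
  qed measurable
qed

lemma L2_conv_integral:
  assumes us: "\<And>k. L2 \<Omega> (us k)" and u: "L2 \<Omega> u" and conv: "L2_conv \<Omega> us u"
  shows "(\<lambda>k. \<integral>x. (us k x - u x)\<^sup>2 \<partial>lebesgue_on \<Omega>) \<longlonglongrightarrow> 0"
proof (rule tendsto_ennrealD)
  have "(\<integral>\<^sup>+ x. ennreal ((us k x - u x)\<^sup>2) \<partial>lebesgue_on \<Omega>) = ennreal (\<integral>x. (us k x - u x)\<^sup>2 \<partial>lebesgue_on \<Omega>)" for k
    using L2_diff[OF us u] by (intro nn_integral_eq_integral) (auto simp: L2_def)
  then show "(\<lambda>k. ennreal (\<integral>x. (us k x - u x)\<^sup>2 \<partial>lebesgue_on \<Omega>)) \<longlonglongrightarrow> ennreal 0"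
    using conv by (simp add: L2_conv_def)
qed (auto simp: Bochner_Integration.integral_nonneg)

lemma L2_const:
  assumes "open \<Omega>" "bounded \<Omega>"
  shows "L2 \<Omega> (\<lambda>x. c)"
proof -
  interpret finite_measure "lebesgue_on \<Omega>"
    using assms by (intro finite_measure_lebesgue_on lmeasurable_open)
  show ?thesis
    by (simp add: L2_def)
qed

lemma L2_conv_functional:
  assumes us: "\<And>k. L2 \<Omega> (us k)" and u: "L2 \<Omega> u" and conv: "L2_conv \<Omega> us u" and f: "L2 \<Omega> f"
  shows "(\<lambda>k. \<integral>x. \<bar>f x * (us k x - u x)\<bar> \<partial>lebesgue_on \<Omega>) \<longlonglongrightarrow> 0"
  using f L2_diff[OF us u] L2_conv_integral[OF us u conv]
  by (intro L2_tendsto_product(2)) (auto simp: L2_def)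

lemma L2_mult_integrable:
  assumes "L2 \<Omega> f" "L2 \<Omega> u"
  shows "integrable (lebesgue_on \<Omega>) (\<lambda>x. f x * u x)"
proof (rule Bochner_Integration.integrable_bound)
  show "integrable (lebesgue_on \<Omega>) (\<lambda>x. (f x)\<^sup>2 + (u x)\<^sup>2)"
    using assms by (auto simp: L2_def)
  have "\<bar>f x * u x\<bar> \<le> (f x)\<^sup>2 + (u x)\<^sup>2" for x
    using sum_squares_bound[of "\<bar>f x\<bar>" "\<bar>u x\<bar>"] mult_nonneg_nonneg[OF abs_ge_zero[of "f x"] abs_ge_zero[of "u x"]]
    unfolding abs_mult power2_abs by linarith
  then show "AE x in lebesgue_on \<Omega>. norm (f x * u x) \<le> norm ((f x)\<^sup>2 + (u x)\<^sup>2)"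
    by simp
  show "(\<lambda>x. f x * u x) \<in> borel_measurable (lebesgue_on \<Omega>)"
    using assms by (auto simp: L2_def)
qed

lemma L2_conv_linear_functional:
  assumes us: "\<And>k. L2 \<Omega> (us k)" and u: "L2 \<Omega> u" and conv: "L2_conv \<Omega> us u" and f: "L2 \<Omega> f"
  shows "(\<lambda>k. \<integral>x. f x * us k x \<partial>lebesgue_on \<Omega>) \<longlonglongrightarrow> (\<integral>x. f x * u x \<partial>lebesgue_on \<Omega>)"
proof (rule LIM_zero_cancel, rule Lim_null_comparison[OF _ L2_conv_functional[OF us u conv f]])
  have "norm ((\<integral>x. f x * us k x \<partial>lebesgue_on \<Omega>) - (\<integral>x. f x * u x \<partial>lebesgue_on \<Omega>)) \<le>
      (\<integral>x. \<bar>f x * (us k x - u x)\<bar> \<partial>lebesgue_on \<Omega>)" for k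
  proof -
    have "(\<integral>x. f x * us k x \<partial>lebesgue_on \<Omega>) - (\<integral>x. f x * u x \<partial>lebesgue_on \<Omega>) = (\<integral>x. f x * (us k x - u x) \<partial>lebesgue_on \<Omega>)"
      using L2_mult_integrable[OF f us] L2_mult_integrable[OF f u] by (simp add: right_diff_distrib)
    then show ?thesis
      using integral_norm_bound[of "lebesgue_on \<Omega>" "\<lambda>x. f x * (us k x - u x)"] by simp
  qed
  then show "\<forall>\<^sub>F k in sequentially. norm ((\<integral>x. f x * us k x \<partial>lebesgue_on \<Omega>) - (\<integral>x. f x * u x \<partial>lebesgue_on \<Omega>)) \<le>
      (\<integral>x. \<bar>f x * (us k x - u x)\<bar> \<partial>lebesgue_on \<Omega>)"
    by simp
qed

lemma L2_integrable:
  assumes "open \<Omega>" "bounded \<Omega>" "L2 \<Omega> u"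
  shows "integrable (lebesgue_on \<Omega>) u"
  using L2_mult_integrable[OF L2_const[OF assms(1,2), of 1] assms(3)] by simp

section \<open>Borel representatives of zero extensions\<close>

lemma zext_eq_indicator: "zext \<Omega> u = (\<lambda>x. indicator \<Omega> x *\<^sub>R u x)"
  by (auto simp: zext_def fun_eq_iff)

lemma L2_borel_version:
  fixes u :: "'a::euclidean_space \<Rightarrow> real"
  assumes "open \<Omega>" "bounded \<Omega>" "\<Omega> \<subseteq> ball 0 R" "L2 \<Omega> u"
  obtains v where "integrable lborel v" "v \<in> borel_measurable borel" "AE x in lborel. v x = zext \<Omega> u x" "\<And>x. norm x > R \<Longrightarrow> v x = 0"
proof -
  have meas: "\<Omega> \<inter> space lebesgue \<in> sets lebesgue"
    using assms by auto
  have int: "integrable lebesgue (zext \<Omega> u)"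
    using L2_integrable[OF assms(1,2,4)] integrable_restrict_space[OF meas, of u] by (simp add: zext_eq_indicator)
  obtain v where [measurable]: "v \<in> borel_measurable lborel" and v: "AE x in lborel. zext \<Omega> u x = v x"
    using completion_ex_borel_measurable_real[OF borel_measurable_integrable[OF int]] by blast
  \<comment> \<open>A Borel representative might be nonzero on a null set far away; the cut-off
    makes it vanish at every point outside the ball.\<close>
  define v' where "v' x = indicator (cball 0 R) x * v x" for x
  have "v \<in> borel_measurable borel"
    by simp
  then have [measurable]: "v' \<in> borel_measurable borel"
    unfolding v'_def by (intro borel_measurable_times borel_measurable_indicator) auto
  have v': "AE x in lborel. v' x = zext \<Omega> u x"
    using v
  proof eventually_elim
    case (elim x)
    then show ?case
      using assms(3) by (cases "x \<in> \<Omega>") (auto simp: v'_def zext_def indicator_def dest: subsetD)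
  qed
  have "integrable lebesgue v'"
  proof (rule integrable_cong_AE_imp[OF int])
    show "v' \<in> borel_measurable lebesgue"
      by (rule measurable_completion) simp
    show "AE x in lebesgue. zext \<Omega> u x = v' x"
      unfolding AE_completion_iff using v' by eventually_elim simp
  qed
  then have "integrable lborel v'"
    by (simp add: integrable_completion)
  then show thesis
    using that[of v'] v' by (auto simp: v'_def)
qed

lemma integral_abs_diff_zext:
  fixes u1 u2 :: "'a::euclidean_space \<Rightarrow> real"
  assumes "open \<Omega>" and "u1 \<in> borel_measurable (lebesgue_on \<Omega>)" "u2 \<in> borel_measurable (lebesgue_on \<Omega>)"
    and [measurable]: "v1 \<in> borel_measurable borel" "v2 \<in> borel_measurable borel"
    and v: "AE x in lborel. v1 x = zext \<Omega> u1 x" "AE x in lborel. v2 x = zext \<Omega> u2 x"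
  shows "(LBINT x. \<bar>v1 x - v2 x\<bar>) = (\<integral>x. \<bar>u1 x - u2 x\<bar> \<partial>lebesgue_on \<Omega>)"
proof -
  have meas: "\<Omega> \<inter> space lebesgue \<in> sets lebesgue"
    using assms by auto
  have "(LBINT x. \<bar>v1 x - v2 x\<bar>) = (\<integral>x. \<bar>v1 x - v2 x\<bar> \<partial>lebesgue)"
    by (rule integral_completion[symmetric]) measurable
  also have "\<dots> = (\<integral>x. indicator \<Omega> x *\<^sub>R \<bar>u1 x - u2 x\<bar> \<partial>lebesgue)"
  proof (rule integral_cong_AE)
    show "(\<lambda>x. \<bar>v1 x - v2 x\<bar>) \<in> borel_measurable lebesgue"
      by (rule measurable_completion) measurable
    show "(\<lambda>x. indicator \<Omega> x *\<^sub>R \<bar>u1 x - u2 x\<bar>) \<in> borel_measurable lebesgue"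
      using assms(2,3) by (subst borel_measurable_restrict_space_iff[OF meas, symmetric]) auto
    show "AE x in lebesgue. \<bar>v1 x - v2 x\<bar> = indicator \<Omega> x *\<^sub>R \<bar>u1 x - u2 x\<bar>"
      unfolding AE_completion_iff using v by eventually_elim (auto simp: zext_def)
  qed
  also have "\<dots> = (\<integral>x. \<bar>u1 x - u2 x\<bar> \<partial>lebesgue_on \<Omega>)"
    by (rule integral_restrict_space[OF meas, symmetric])
  finally show ?thesis .
qed

text \<open>The definition speaks of the zero extension and the completed measure, the construction
  of a Borel representative and \<open>lborel\<close>; the integrals agree through almost everywhere
  equality.\<close>

lemma W1inf0_unit_if_lborel_weak_gradient:
  fixes u :: "'a::euclidean_space \<Rightarrow> real"
  assumes "open \<Omega>" and u: "u \<in> borel_measurable (lebesgue_on \<Omega>)"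
    and v: "integrable lborel v" and vu: "AE x in lborel. v x = zext \<Omega> u x"
    and g [measurable]: "g \<in> borel_measurable borel" and g1: "\<And>x. norm (g x) \<le> 1" and wg: "lborel_weak_gradient v g"
    and bound: "AE x in lborel. \<bar>v x\<bar> \<le> B"
  shows "W1inf0_unit \<Omega> u"
  unfolding W1inf0_unit_def
proof (intro exI conjI)
  have meas: "\<Omega> \<inter> space lebesgue \<in> sets lebesgue"
    using \<open>open \<Omega>\<close> by auto
  have [measurable]: "zext \<Omega> u \<in> borel_measurable lebesgue"
    using u by (simp add: zext_eq_indicator borel_measurable_restrict_space_iff[OF meas])
  have g': "g \<in> borel_measurable lebesgue"
    by (rule measurable_completion) simp
  show "weak_gradient (zext \<Omega> u) g"
    unfolding weak_gradient_def
  proof (intro conjI allI impI ballI)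
    fix \<phi> :: "'a \<Rightarrow> real" and i :: 'a assume \<phi>: "test_function \<phi>" and i: "i \<in> Basis"
    have partial: "test_function (\<lambda>x. grad \<phi> x \<bullet> i)"
      using test_function_partial[OF \<phi> i] by (simp add: grad_inner_Basis[OF i])
    have D: "frechet_derivative \<phi> (at x) i = grad \<phi> x \<bullet> i" for x
      by (simp add: grad_inner_Basis[OF i])
    note [measurable] = test_function_measurable[OF \<phi>] test_function_measurable[OF partial] borel_measurable_integrable[OF v]
    have m: "(\<lambda>x. grad \<phi> x \<bullet> i) \<in> borel_measurable lebesgue" "(\<lambda>x. v x * (grad \<phi> x \<bullet> i)) \<in> borel_measurable lebesgue"
      by (rule measurable_completion, measurable)+
    have ae: "AE x in lebesgue. v x * (grad \<phi> x \<bullet> i) = zext \<Omega> u x * (grad \<phi> x \<bullet> i)"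
      unfolding AE_completion_iff using vu by eventually_elim simp
    have int1: "integrable lborel (\<lambda>x. v x * (grad \<phi> x \<bullet> i))"
      by (rule integrable_mult_test_function[OF v partial])
    have int2: "integrable lborel (\<lambda>x. (g x \<bullet> i) * \<phi> x)"
    proof (rule integrable_bounded_mult_test_function[OF _ _ \<phi>])
      show "\<bar>g x \<bullet> i\<bar> \<le> 1" for x
        using order_trans[OF Basis_le_norm[OF i] g1] .
    qed measurable
    show "integrable lebesgue (\<lambda>x. zext \<Omega> u x * frechet_derivative \<phi> (at x) i)"
      unfolding D
    proof (rule integrable_cong_AE_imp[OF _ _ ae])
      show "integrable lebesgue (\<lambda>x. v x * (grad \<phi> x \<bullet> i))"
        using int1 by (subst integrable_completion) auto
    qed (use m in measurable)
    show "integrable lebesgue (\<lambda>x. (g x \<bullet> i) * \<phi> x)"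
      using int2 by (subst integrable_completion) auto
    have "(\<integral>x. zext \<Omega> u x * (grad \<phi> x \<bullet> i) \<partial>lebesgue) = (\<integral>x. v x * (grad \<phi> x \<bullet> i) \<partial>lebesgue)"
    proof (rule integral_cong_AE)
      show "AE x in lebesgue. zext \<Omega> u x * (grad \<phi> x \<bullet> i) = v x * (grad \<phi> x \<bullet> i)"
        using ae by eventually_elim (rule sym)
    qed (use m in measurable)
    also have "\<dots> = (LBINT x. v x * (grad \<phi> x \<bullet> i))"
      by (rule integral_completion) measurable
    also have "\<dots> = - (LBINT x. (g x \<bullet> i) * \<phi> x)"
      using wg \<phi> i by (simp add: lborel_weak_gradient_def)
    also have "\<dots> = - (\<integral>x. (g x \<bullet> i) * \<phi> x \<partial>lebesgue)"
      by (subst integral_completion) auto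
    finally show "(\<integral>x. zext \<Omega> u x * frechet_derivative \<phi> (at x) i \<partial>lebesgue) = - (\<integral>x. (g x \<bullet> i) * \<phi> x \<partial>lebesgue)"
      by (simp add: D)
  qed (use g' in auto)
  have "AE x in lborel. norm (zext \<Omega> u x) \<le> B"
    using bound vu by eventually_elim simp
  then show "ess_bounded (zext \<Omega> u)"
    by (auto simp: ess_bounded_def AE_completion_iff)
  show "ess_bounded g" "AE x in lebesgue_on \<Omega>. norm (g x) \<le> 1"
    using g1 by (auto simp: ess_bounded_def)
qed

text \<open>The unit bound on all mollified gradients is used twice: for the weak gradient, and for
  a Lipschitz representative from which essential boundedness follows.\<close>

lemma nonlocal_limit_W1inf0_unit:
  fixes \<Omega> :: "'a::euclidean_space set"
  assumes \<Omega>: "open \<Omega>" "bounded \<Omega>" and us: "\<And>k::nat. L2 \<Omega> (us k)" and u: "L2 \<Omega> u" and conv: "L2_conv \<Omega> us u"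
    and \<delta>: "\<And>k. \<delta> k > 0" "\<delta> \<longlonglongrightarrow> 0" and w: "\<And>k. admissible_kernel (\<delta> k) (w k)"
    and ball: "\<And>k. in_unit_ball_Linf2 (nbhd \<Omega> (\<delta> k)) (Gdelta \<Omega> (w k) (us k))"
  shows "W1inf0_unit \<Omega> u"
proof -
  obtain R where R: "R > 0" "\<Omega> \<subseteq> ball 0 R"
    using bounded_subset_ballD[OF \<Omega>(2)] by blast
  obtain v where v: "integrable lborel v" "v \<in> borel_measurable borel" "AE x in lborel. v x = zext \<Omega> u x" "\<And>x. norm x > R \<Longrightarrow> v x = 0"
    using L2_borel_version[OF \<Omega> R(2) u] by blast
  have "\<exists>v. integrable lborel v \<and> v \<in> borel_measurable borel \<and> (AE x in lborel. v x = zext \<Omega> (us k) x)" for k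
    using L2_borel_version[OF \<Omega> R(2) us] by blast
  then obtain vk where vk: "\<And>k. integrable lborel (vk k)" "\<And>k. vk k \<in> borel_measurable borel" "\<And>k. AE x in lborel. vk k x = zext \<Omega> (us k) x"
    by metis
  have "\<exists>q. normalized_kernel (\<delta> k) q \<and> (AE z in lborel. (w k z)\<^sup>2 = q z)" for k
    using admissible_kernel_normalized[OF w] by blast
  then obtain q where q: "\<And>k. normalized_kernel (\<delta> k) (q k)" "\<And>k. AE z in lborel. (w k z)\<^sup>2 = q k z"
    by metis
  have unit: "nonlocal_unit (q k) (vk k)" for k
  proof (subst in_unit_ball_iff_nonlocal_unit[symmetric])
    show "norm z < \<delta> k" if "w k z \<noteq> 0" for z
      using w[of k] that unfolding admissible_kernel_def by (metis mem_ball_0)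
  qed (use \<delta>(1) q(2) normalized_kernelD(1)[OF q(1)] vk ball in auto)
  have "(\<lambda>k. \<integral>x. \<bar>1 * (us k x - u x)\<bar> \<partial>lebesgue_on \<Omega>) \<longlonglongrightarrow> 0"
    by (rule L2_conv_functional[OF us u conv L2_const[OF \<Omega>]])
  moreover have "(LBINT x. \<bar>vk k x - v x\<bar>) = (\<integral>x. \<bar>us k x - u x\<bar> \<partial>lebesgue_on \<Omega>)" for k
    using us[of k] u by (intro integral_abs_diff_zext \<Omega> vk v) (auto simp: L2_def)
  ultimately have L1: "(\<lambda>k. \<integral>x. \<bar>vk k x - v x\<bar> \<partial>lborel) \<longlonglongrightarrow> 0"
    by simp
  have grad: "norm (moll (grad \<phi>) v x) \<le> 1" if "mollifier \<epsilon> \<phi>" for \<epsilon> \<phi> x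
    by (rule norm_grad_moll_limit_le[OF vk(1) v(1) L1 \<delta>(2,1) q(1) unit that])
  have near: "\<exists>w g. unit_c11_near (R + 1) v \<tau> w g" if "\<tau> > 0" for \<tau>
    by (rule unit_gradient_mollified[OF v(1)]) (use v(4) grad that in blast)+
  obtain g where "g \<in> borel_measurable borel" "\<And>x. norm (g x) \<le> 1" "lborel_weak_gradient v g"
    using unit_c11_near_weak_gradient[OF v(1) near] by blast
  moreover obtain V where V: "1-lipschitz_on UNIV V" "AE x in lborel. v x = V x"
  proof (rule lipschitz_representative[OF v(1)])
    show "v x = 0" if "norm x > R" for x
      using v(4) that .
    show "norm (moll (grad \<phi>) v x) \<le> 1" if "mollifier \<epsilon> \<phi>" for \<epsilon> \<phi> x
      using grad that .
  qed simp
  \<comment> \<open>Inside the ball the bound comes from comparing with the origin by the Lipschitz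
    constant one; outside, \<open>v\<close> is zero.\<close>
  have "AE x in lborel. \<bar>v x\<bar> \<le> \<bar>V 0\<bar> + R"
    using V(2)
  proof eventually_elim
    case (elim x)
    then show ?case
      using lipschitz_onD[OF V(1), of x 0] v(4)[of x] R(1) by (cases "norm x > R") (auto simp: dist_norm)
  qed
  ultimately show ?thesis
    using u by (intro W1inf0_unit_if_lborel_weak_gradient[OF \<Omega>(1) _ v(1,3)]) (auto simp: L2_def)
qed

section \<open>Lipschitz representatives and recovery sequences\<close>

text \<open>The support of the kernel confines the hypothesis to a ball around \<open>x\<close>, so
  that a gradient bound valid only inside \<open>\<Omega>\<close> can be exploited.\<close>

lemma integral_bounded_le_mollifier:
  fixes g :: "'a::euclidean_space \<Rightarrow> 'a"
  assumes \<phi>: "mollifier \<epsilon> \<phi>" and g: "g \<in> borel_measurable lebesgue"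
    and M: "AE y in lebesgue. norm (y - x) < \<epsilon> \<longrightarrow> norm (g y) \<le> M" and e: "norm e = 1"
    and int: "integrable lebesgue (\<lambda>y. (g y \<bullet> e) * \<phi> (x - y))"
  shows "(\<integral>y. (g y \<bullet> e) * \<phi> (x - y) \<partial>lebesgue) \<le> M"
proof -
  note t = mollifierD(1)[OF \<phi>]
  note [measurable] = test_function_measurable[OF t]
  have int': "integrable lborel (\<lambda>y. \<phi> (x - y))"
    using test_function_integrable[OF t] by (subst integrable_lborel_minus_iff) auto
  have one: "(\<integral>y. \<phi> (x - y) \<partial>lebesgue) = 1"
    using integral_lborel_minus[of \<phi> x] mollifierD(4)[OF \<phi>] by (simp add: integral_completion)
  have "(\<integral>y. (g y \<bullet> e) * \<phi> (x - y) \<partial>lebesgue) \<le> (\<integral>y. M * \<phi> (x - y) \<partial>lebesgue)"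
  proof (rule integral_mono_AE[OF int])
    show "integrable lebesgue (\<lambda>y. M * \<phi> (x - y))"
      using int' by (intro integrable_mult_right) (simp add: integrable_completion)
    show "AE y in lebesgue. (g y \<bullet> e) * \<phi> (x - y) \<le> M * \<phi> (x - y)"
      using M
    proof eventually_elim
      case (elim y)
      show ?case
      proof (cases "norm (y - x) < \<epsilon>")
        case True
        have "g y \<bullet> e \<le> M"
          using True elim norm_cauchy_schwarz[of "g y" e] e by simp
        then show ?thesis
          using mollifierD(2)[OF \<phi>] by (rule mult_right_mono)
      next
        case False
        then show ?thesis
          using mollifierD(3)[OF \<phi>, of "x - y"] by (simp add: norm_minus_commute)
      qed
    qed
  qed
  then show ?thesis
    by (simp add: one)
qed

text \<open>The gradient of a mollification is the mollified weak gradient, tested against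
  \<open>y \<mapsto> \<phi> (x - y)\<close>.\<close>

lemma norm_moll_grad_le_weak_gradient:
  fixes v :: "'a::euclidean_space \<Rightarrow> real"
  assumes \<phi>: "mollifier \<epsilon> \<phi>" and v: "integrable lborel v" and V: "AE x in lborel. v x = V x"
    and wg: "weak_gradient V g" and M: "AE y in lebesgue. norm (y - x) < \<epsilon> \<longrightarrow> norm (g y) \<le> M" and "M \<ge> 0"
  shows "norm (moll (grad \<phi>) v x) \<le> M"
proof (cases "moll (grad \<phi>) v x = 0")
  case False
  note t = mollifierD(1)[OF \<phi>]
  \<comment> \<open>Written as an affine substitution to inherit the test function property. The
    sign from differentiating \<open>x - y\<close> cancels the one in the definition of the weak
    gradient.\<close>
  define \<psi> where "\<psi> y = 1 * \<phi> (x + (- 1) *\<^sub>R y)" for y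
  have \<psi>: "test_function \<psi>"
    unfolding \<psi>_def by (intro test_function_affine t) simp
  have \<psi>_eq: "\<psi> y = \<phi> (x - y)" for y
    by (simp add: \<psi>_def)
  have deriv: "frechet_derivative \<psi> (at y) i = - (grad \<phi> (x - y) \<bullet> i)" for y i
  proof -
    have "((\<lambda>y. \<phi> (x - y)) has_derivative (\<lambda>h. grad \<phi> (x - y) \<bullet> (- h))) (at y)"
      by (rule has_derivative_compose[OF _ test_function_has_derivative[OF t], where f="\<lambda>y. x - y"])
        (auto intro!: derivative_eq_intros)
    then show ?thesis
      using frechet_derivative_at[of "\<lambda>y. \<phi> (x - y)"] by (simp add: \<psi>_eq[abs_def] fun_eq_iff)
  qed
  note [measurable] = test_function_measurable[OF t] test_function_grad_measurable[OF t] borel_measurable_integrable[OF v]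
  obtain B where "B > 0" and B: "\<And>x. norm (grad \<phi> x) \<le> B"
    using test_function_grad_bounded[OF t] by blast
  note int = integrable_moll[OF v test_function_grad_measurable[OF t] B, of x]
  have [measurable]: "V \<in> borel_measurable lebesgue" and g: "g \<in> borel_measurable lebesgue"
    using wg by (auto simp: weak_gradient_def)
  have gi: "integrable lebesgue (\<lambda>y. (g y \<bullet> i) * \<phi> (x - y))"
    and eq: "moll (grad \<phi>) v x \<bullet> i = (\<integral>y. (g y \<bullet> i) * \<phi> (x - y) \<partial>lebesgue)" if i: "i \<in> Basis" for i
  proof -
    have w: "integrable lebesgue (\<lambda>y. (g y \<bullet> i) * \<psi> y)"
      "(\<integral>y. V y * frechet_derivative \<psi> (at y) i \<partial>lebesgue) = - (\<integral>y. (g y \<bullet> i) * \<psi> y \<partial>lebesgue)"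
      using wg \<psi> i by (auto simp: weak_gradient_def)
    then show "integrable lebesgue (\<lambda>y. (g y \<bullet> i) * \<phi> (x - y))"
      by (simp add: \<psi>_eq)
    have m: "(\<lambda>y. grad \<phi> (x - y) \<bullet> i) \<in> borel_measurable lebesgue" "(\<lambda>y. v y * (grad \<phi> (x - y) \<bullet> i)) \<in> borel_measurable lebesgue"
      by (rule measurable_completion, measurable)+
    have "moll (grad \<phi>) v x \<bullet> i = (LBINT y. (v y *\<^sub>R grad \<phi> (x - y)) \<bullet> i)"
      unfolding moll_def by (rule integral_inner_left[OF int, symmetric])
    also have "\<dots> = (LBINT y. v y * (grad \<phi> (x - y) \<bullet> i))"
      by simp
    also have "\<dots> = (\<integral>y. v y * (grad \<phi> (x - y) \<bullet> i) \<partial>lebesgue)"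
      by (rule integral_completion[symmetric]) measurable
    also have "\<dots> = (\<integral>y. V y * (grad \<phi> (x - y) \<bullet> i) \<partial>lebesgue)"
    proof (rule integral_cong_AE)
      show "AE y in lebesgue. v y * (grad \<phi> (x - y) \<bullet> i) = V y * (grad \<phi> (x - y) \<bullet> i)"
        unfolding AE_completion_iff using V by eventually_elim simp
    qed (use m in measurable)
    also have "\<dots> = (\<integral>y. (g y \<bullet> i) * \<phi> (x - y) \<partial>lebesgue)"
      using w(2) by (simp add: deriv \<psi>_eq)
    finally show "moll (grad \<phi>) v x \<bullet> i = (\<integral>y. (g y \<bullet> i) * \<phi> (x - y) \<partial>lebesgue)" .
  qed
  define e where "e = moll (grad \<phi>) v x /\<^sub>R norm (moll (grad \<phi>) v x)"
  have e: "norm e = 1"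
    using False by (simp add: e_def)
  have ge: "(g y \<bullet> e) * \<phi> (x - y) = (\<Sum>i\<in>Basis. (e \<bullet> i) * ((g y \<bullet> i) * \<phi> (x - y)))" for y
    by (subst euclidean_inner) (simp add: sum_distrib_left mult_ac)
  have "norm (moll (grad \<phi>) v x) = moll (grad \<phi>) v x \<bullet> e"
    using False by (simp add: e_def dot_square_norm power2_eq_square)
  also have "\<dots> = (\<Sum>i\<in>Basis. (e \<bullet> i) * (\<integral>y. (g y \<bullet> i) * \<phi> (x - y) \<partial>lebesgue))"
    by (subst euclidean_inner) (simp add: eq mult.commute)
  also have "\<dots> = (\<integral>y. (g y \<bullet> e) * \<phi> (x - y) \<partial>lebesgue)"
    unfolding ge using gi by simp
  also have "\<dots> \<le> M"
  proof (rule integral_bounded_le_mollifier[OF \<phi> g M e])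
    show "integrable lebesgue (\<lambda>y. (g y \<bullet> e) * \<phi> (x - y))"
      unfolding ge using gi by (intro Bochner_Integration.integrable_sum integrable_mult_right) auto
  qed
  finally show ?thesis .
qed (use \<open>M \<ge> 0\<close> in simp)

text \<open>Moving a boundary point along \<open>e\<close> leaves \<open>g\<close> unchanged and
  raises the height, so it enters the open region above the graph at once. Hence a continuous
  function that is zero in the exterior is also zero on the boundary; at an interior slit this would
  fail.\<close>

lemma lipschitz_boundary_exterior:
  assumes "lipschitz_boundary \<Omega>" "open \<Omega>" "p \<notin> \<Omega>"
  shows "p \<in> closure (interior (- \<Omega>))"
proof (cases "p \<in> frontier \<Omega>")
  case True
  then obtain e U g L where e: "norm e = 1" and U: "open U" "p \<in> U" and g: "L-lipschitz_on UNIV g"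
    and inv: "\<And>y. g y = g (y - (y \<bullet> e) *\<^sub>R e)" and \<Omega>U: "\<Omega> \<inter> U = {y\<in>U. y \<bullet> e < g y}"
    using assms(1) unfolding lipschitz_boundary_def by blast
  have ee: "e \<bullet> e = 1"
    using e by (simp add: dot_square_norm)
  have cont: "continuous_on UNIV g"
    using g by (rule lipschitz_on_continuous_on)
  define E where "E = U \<inter> {y. g y < y \<bullet> e}"
  have "open E"
    unfolding E_def using U cont by (intro open_Int open_Collect_less continuous_intros) auto
  moreover have "E \<subseteq> - \<Omega>"
  proof
    fix y assume "y \<in> E"
    then have "y \<in> U" "\<not> y \<bullet> e < g y"
      by (auto simp: E_def)
    then have "y \<notin> \<Omega> \<inter> U"
      unfolding \<Omega>U by blast
    then show "y \<in> - \<Omega>"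
      using \<open>y \<in> U\<close> by blast
  qed
  ultimately have E: "E \<subseteq> interior (- \<Omega>)"
    by (rule interior_maximal[rotated])
  have gp: "g p \<le> p \<bullet> e"
    using \<Omega>U U assms(3) by force
  have shift: "g (p + t *\<^sub>R e) = g p" for t
    using inv[of "p + t *\<^sub>R e"] inv[of p] ee by (simp add: inner_add_left scaleR_add_left)
  have lim: "(\<lambda>n. p + (1 / real (Suc n)) *\<^sub>R e) \<longlonglongrightarrow> p"
  proof -
    have "(\<lambda>n. 1 / real (Suc n)) \<longlonglongrightarrow> 0"
      using LIMSEQ_inverse_real_of_nat by (simp add: inverse_eq_divide)
    then have "(\<lambda>n. p + (1 / real (Suc n)) *\<^sub>R e) \<longlonglongrightarrow> p + 0 *\<^sub>R e"
      by (intro tendsto_intros)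
    then show ?thesis
      by simp
  qed
  have "\<forall>\<^sub>F n in sequentially. p + (1 / real (Suc n)) *\<^sub>R e \<in> U"
    using lim U by (auto dest: topological_tendstoD)
  then have ev: "\<forall>\<^sub>F n in sequentially. p + (1 / real (Suc n)) *\<^sub>R e \<in> closure (interior (- \<Omega>))"
  proof eventually_elim
    case (elim n)
    then have "p + (1 / real (Suc n)) *\<^sub>R e \<in> E"
      using gp ee by (simp add: E_def shift inner_add_left) (simp add: order_le_less_trans[of "g p" "p \<bullet> e"])
    then show ?case
      using E closure_subset by blast
  qed
  show ?thesis
    by (rule Lim_in_closed_set[OF closed_closure ev _ lim]) simp
next
  case False
  then have "p \<notin> closure \<Omega>"
    using assms by (simp add: frontier_def interior_open)
  then have "p \<in> interior (- \<Omega>)"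
    by (simp add: interior_closure)
  then show ?thesis
    using closure_subset by blast
qed

text \<open>Everything reduces to bounding \<open>\<bar>V x\<bar>\<close> by the distance to the
  complement, because a segment that leaves \<open>\<Omega>\<close> passes through a zero of
  \<open>V\<close>.\<close>

lemma locally_unit_lipschitz_imp_lipschitz:
  fixes V :: "'a::euclidean_space \<Rightarrow> real"
  assumes V: "M-lipschitz_on UNIV V" and \<Omega>: "open \<Omega>" "\<Omega> \<noteq> UNIV" and V0: "\<And>x. x \<notin> \<Omega> \<Longrightarrow> V x = 0"
    and seg: "\<And>x y. closed_segment x y \<subseteq> \<Omega> \<Longrightarrow> \<bar>V x - V y\<bar> \<le> norm (x - y)"
  shows "\<bar>V x - V y\<bar> \<le> norm (x - y)"
proof -
  have M: "M \<ge> 0" "\<bar>V x - V y\<bar> \<le> M * norm (x - y)" for x y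
    using lipschitz_on_nonneg[OF V] lipschitz_onD[OF V, of x y] by (auto simp: dist_norm)
  have dist_bound: "\<bar>V x\<bar> \<le> norm (x - p)" if p: "p \<notin> \<Omega>" for x p
  proof (cases "x \<in> \<Omega>")
    case True
    define c where "c = closest_point (- \<Omega>) x"
    have "closed (- \<Omega>)" "- \<Omega> \<noteq> {}"
      using \<Omega> by auto
    then have c: "c \<notin> \<Omega>" "\<And>y. y \<notin> \<Omega> \<Longrightarrow> dist x c \<le> dist x y"
      using closest_point_in_set[of "- \<Omega>" x] closest_point_le[of "- \<Omega>" _ x] by (auto simp: c_def)
    define D where "D = norm (x - c)"
    have "D > 0"
      using c True by (auto simp: D_def)
    \<comment> \<open>Up to its endpoint \<open>c\<close> the segment to the nearest outside point
      stays in \<open>\<Omega>\<close>. It is stopped a fraction \<open>r\<close> short, and the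
      crude constant \<open>M\<close> pays for the rest.\<close>
    have "\<bar>V x\<bar> \<le> D + (M * D) * s" if "s > 0" for s
    proof -
      define r where "r = min s 1"
      have r: "0 < r" "r \<le> 1" "r \<le> s"
        using that by (auto simp: r_def)
      define p' where "p' = x + (1 - r) *\<^sub>R (c - x)"
      have p'x: "norm (x - p') = (1 - r) * D"
        using r by (simp add: p'_def D_def norm_minus_commute)
      have "p' - c = r *\<^sub>R (x - c)"
        by (simp add: p'_def algebra_simps)
      then have p'c: "norm (p' - c) = r * D"
        using r by (simp add: D_def)
      have "closed_segment x p' \<subseteq> \<Omega>"
      proof
        fix z assume "z \<in> closed_segment x p'"
        then have "norm (x - z) \<le> norm (x - p')"
          using segment_bound(1)[of z x p'] by (simp add: norm_minus_commute)
        then have "dist x z < dist x c"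
          using r \<open>D > 0\<close> p'x by (simp add: dist_norm D_def[symmetric] algebra_simps) (smt (verit) mult_pos_pos)
        then show "z \<in> \<Omega>"
          using c(2)[of z] by fastforce
      qed
      then have "\<bar>V x - V p'\<bar> \<le> (1 - r) * D"
        using seg p'x by metis
      moreover have "\<bar>V p'\<bar> \<le> M * (r * D)"
        using M(2)[of p' c] V0[OF c(1)] p'c by simp
      moreover have "(1 - r) * D \<le> D"
        using r \<open>D > 0\<close> by (simp add: mult_left_le_one_le)
      moreover have "M * (r * D) \<le> (M * D) * s"
        using r M(1) \<open>D > 0\<close> by (simp add: mult_ac mult_left_mono)
      ultimately show ?thesis
        by linarith
    qed
    then have "\<bar>V x\<bar> \<le> D"
      by (rule affine_bound_at_0)
    also have "D \<le> norm (x - p)"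
      using c(2)[OF p] by (simp add: D_def dist_norm)
    finally show ?thesis .
  qed (simp add: V0)
  show ?thesis
  proof (cases "closed_segment x y \<subseteq> \<Omega>")
    case False
    \<comment> \<open>Such a point splits the length of the segment exactly, and each part bounds
      the value at its own end.\<close>
    then obtain p where p: "p \<in> closed_segment x y" "p \<notin> \<Omega>"
      by blast
    then have "norm (x - y) = norm (x - p) + norm (p - y)"
      using between_mem_segment[of x y p] by (simp add: between dist_norm)
    then show ?thesis
      using dist_bound[OF p(2), of x] dist_bound[OF p(2), of y] by (simp add: norm_minus_commute)
  qed (rule seg)
qed

text \<open>The unit bound is assumed on \<open>\<Omega>\<close> only; globally there is just some
  essential bound \<open>M\<close>. That crude constant yields continuity and hence the boundary
  values, and the sharp one is recovered along segments inside \<open>\<Omega>\<close>.\<close>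

lemma W1inf0_unit_lipschitz_representative:
  fixes \<Omega> :: "'a::euclidean_space set"
  assumes \<Omega>: "open \<Omega>" "bounded \<Omega>" "lipschitz_boundary \<Omega>" and u: "L2 \<Omega> u" and W: "W1inf0_unit \<Omega> u"
  obtains V where "\<And>x y. \<bar>V x - V y\<bar> \<le> norm (x - y)" "\<And>x. x \<notin> \<Omega> \<Longrightarrow> V x = 0" "AE x in lborel. V x = zext \<Omega> u x"
proof -
  obtain R where R: "R > 0" "\<Omega> \<subseteq> ball 0 R"
    using bounded_subset_ballD[OF \<Omega>(2)] by blast
  obtain v where v: "integrable lborel v" "v \<in> borel_measurable borel" "AE x in lborel. v x = zext \<Omega> u x" "\<And>x. norm x > R \<Longrightarrow> v x = 0"
    using L2_borel_version[OF \<Omega>(1,2) R(2) u] by blast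
  obtain g M' where wg: "weak_gradient (zext \<Omega> u) g" and M': "AE x in lebesgue. norm (g x) \<le> M'"
    and g1: "AE x in lebesgue_on \<Omega>. norm (g x) \<le> 1"
    using W unfolding W1inf0_unit_def ess_bounded_def by blast
  define M where "M = max M' 0"
  have M: "M \<ge> 0" "AE x in lebesgue. norm (g x) \<le> M"
    using M' by (auto simp: M_def elim: eventually_mono)
  have "\<Omega> \<inter> space lebesgue \<in> sets lebesgue"
    using \<Omega> by auto
  then have g1': "AE x in lebesgue. x \<in> \<Omega> \<longrightarrow> norm (g x) \<le> 1"
    using g1 by (simp add: AE_restrict_space_iff)
  have gradM: "norm (moll (grad \<phi>) v x) \<le> M" if "mollifier \<epsilon> \<phi>" for \<epsilon> \<phi> x
  proof (rule norm_moll_grad_le_weak_gradient[OF that v(1,3) wg _ M(1)])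
    show "AE y in lebesgue. norm (y - x) < \<epsilon> \<longrightarrow> norm (g y) \<le> M"
      using M(2) by eventually_elim simp
  qed
  obtain V where V: "M-lipschitz_on UNIV V" "AE x in lborel. v x = V x"
  proof (rule lipschitz_representative[OF v(1) _ _ M(1)])
    show "v x = 0" if "norm x > R" for x
      using v(4) that .
    show "norm (moll (grad \<phi>) v x) \<le> M" if "mollifier \<epsilon> \<phi>" for \<epsilon> \<phi> x
      using gradM that .
  qed
  have Vcont: "continuous_on UNIV V"
    using V(1) by (rule lipschitz_on_continuous_on)
  have closed0: "closed {x. V x = 0}"
    using Vcont by (intro closed_Collect_eq) auto
  have "V x = 0" if "x \<in> interior (- \<Omega>)" for x
  proof -
    have "AE x in lborel. x \<in> interior (- \<Omega>) \<longrightarrow> x \<in> {x. V x = 0}"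
      using V(2) v(3)
    proof eventually_elim
      case (elim x)
      then show ?case
        using interior_subset[of "- \<Omega>"] by (auto simp: zext_def)
    qed
    then have "AE x \<in> interior (- \<Omega>) in lebesgue. x \<in> {x. V x = 0}"
      by (simp add: AE_completion_iff)
    then have "x \<in> {x. V x = 0}"
      using that by (intro mem_closed_if_AE_lebesgue_open[OF open_interior closed0])
    then show ?thesis
      by simp
  qed
  then have "closure (interior (- \<Omega>)) \<subseteq> {x. V x = 0}"
    by (intro closure_minimal closed0) auto
  then have V0: "V x = 0" if "x \<notin> \<Omega>" for x
    using lipschitz_boundary_exterior[OF \<Omega>(3,1) that] by blast
  have Vint: "integrable lborel V"
  proof (rule integrable_lborel_compact_support[OF Vcont])
    show "V x = 0" if "norm x > R" for x
      using R that by (intro V0) (auto dest: subsetD)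
  qed
  have seg: "\<bar>V x - V y\<bar> \<le> norm (x - y)" if xy: "closed_segment x y \<subseteq> \<Omega>" for x y
  proof -
    obtain d where d: "d > 0" "(\<Union>z\<in>closed_segment x y. ball z d) \<subseteq> \<Omega>"
      using compact_subset_open_imp_ball_epsilon_subset[OF compact_segment \<Omega>(1) xy] by blast
    have "\<bar>V x - V y\<bar> \<le> norm (x - y) + (2 * M) * t" if "t > 0" for t
    proof -
      \<comment> \<open>Width at most \<open>d\<close> keeps the averaging inside
        \<open>\<Omega>\<close>, where the unit bound holds; width at most \<open>t\<close> keeps
        the error at each end below \<open>M * t\<close>.\<close>
      define \<epsilon> where "\<epsilon> = min t d"
      have \<epsilon>: "\<epsilon> > 0" "\<epsilon> \<le> t" "\<epsilon> \<le> d"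
        using that d by (auto simp: \<epsilon>_def)
      obtain \<phi> :: "'a \<Rightarrow> real" where \<phi>: "mollifier \<epsilon> \<phi>"
        using ex_mollifier[OF \<epsilon>(1)] by blast
      note t' = mollifierD(1)[OF \<phi>]
      note [measurable] = test_function_measurable[OF t'] v(2) borel_measurable_integrable[OF Vint]
      obtain C where C: "c11 C \<phi> (grad \<phi>)"
        using test_function_c11[OF t'] by blast
      have moll_eq: "moll \<phi> v z = moll \<phi> V z" for z
        unfolding moll_def
      proof (rule integral_cong_AE)
        show "AE y in lborel. v y *\<^sub>R \<phi> (z - y) = V y *\<^sub>R \<phi> (z - y)"
          using V(2) by eventually_elim simp
      qed measurable
      have near: "\<bar>moll \<phi> v z - V z\<bar> \<le> M * t" for z
        unfolding moll_eq
      proof (rule moll_lipschitz_close[OF \<phi> Vint])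
        fix y assume "norm (y - z) < \<epsilon>"
        then have "M * norm (y - z) \<le> M * t"
          using \<epsilon> M(1) by (intro mult_left_mono) auto
        then show "\<bar>V y - V z\<bar> \<le> M * t"
          using lipschitz_onD[OF V(1), of y z] by (simp add: dist_norm)
      qed
      have "\<bar>moll \<phi> v x - moll \<phi> v y\<bar> \<le> 1 * norm (x - y)"
      proof (rule c11_bounded_gradient_lipschitz[OF moll_c11[OF v(1) t' C]])
        fix z assume z: "z \<in> closed_segment x y"
        show "norm (moll (grad \<phi>) v z) \<le> 1"
        proof (rule norm_moll_grad_le_weak_gradient[OF \<phi> v(1,3) wg])
          show "AE y in lebesgue. norm (y - z) < \<epsilon> \<longrightarrow> norm (g y) \<le> 1"
            using g1'
          proof eventually_elim
            case (elim y)
            have "y \<in> \<Omega>" if "norm (y - z) < \<epsilon>"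
              using that \<epsilon> d(2) z by (force simp: dist_norm norm_minus_commute)
            then show ?case
              using elim by blast
          qed
        qed simp
      qed
      then show ?thesis
        using near[of x] near[of y] by linarith
    qed
    then show ?thesis
      by (rule affine_bound_at_0)
  qed
  have "\<Omega> \<noteq> UNIV"
    using \<Omega>(2) not_bounded_UNIV by blast
  show thesis
  proof (rule that)
    show "\<bar>V x - V y\<bar> \<le> norm (x - y)" for x y
      by (rule locally_unit_lipschitz_imp_lipschitz[OF V(1) \<Omega>(1) \<open>\<Omega> \<noteq> UNIV\<close> V0 seg])
    show "V x = 0" if "x \<notin> \<Omega>" for x
      using V0[OF that] .
    show "AE x in lborel. V x = zext \<Omega> u x"
      using V(2) v(3) by eventually_elim simp
  qed
qed

text \<open>Thresholding precedes mollification to make room: the set where \<open>W\<close> is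
  nonzero keeps a positive distance \<open>d\<close> from the complement, so a kernel of width at
  most \<open>d\<close> creates no values off \<open>\<Omega>\<close>. Each of the two operations
  may cost half of \<open>\<eta>\<close>.\<close>

lemma c11_approximation:
  fixes V :: "'a::euclidean_space \<Rightarrow> real"
  assumes lip: "\<And>x y. \<bar>V x - V y\<bar> \<le> norm (x - y)" and V0: "\<And>x. x \<notin> \<Omega> \<Longrightarrow> V x = 0"
    and \<Omega>: "open \<Omega>" "bounded \<Omega>" and "\<eta> > 0"
  obtains w g C where "c11 C w g" "\<And>x. norm (g x) \<le> 1" "\<And>x. x \<notin> \<Omega> \<Longrightarrow> w x = 0" "\<And>x. \<bar>w x - V x\<bar> \<le> \<eta>"
proof -
  define h where "h = \<eta> / 2"
  have h: "h > 0"
    using \<open>\<eta> > 0\<close> by (simp add: h_def)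
  \<comment> \<open>Subtracting the clipped value shrinks \<open>V\<close> towards zero by at most
    \<open>h\<close>; this is a nonexpansive map of the values, so the Lipschitz constant stays
    one.\<close>
  define W where "W x = V x - max (- h) (min h (V x))" for x
  have W_lip: "\<bar>W x - W y\<bar> \<le> norm (x - y)" for x y
    using lip[of x y] by (auto simp: W_def max_def min_def)
  have W_close: "\<bar>W x - V x\<bar> \<le> h" for x
    using h by (auto simp: W_def max_def min_def)
  have W_supp: "\<bar>V x\<bar> \<ge> h" if "W x \<noteq> 0" for x
    using that by (auto simp: W_def max_def min_def split: if_splits)
  define K where "K = {x. h \<le> \<bar>V x\<bar>}"
  have "1-lipschitz_on UNIV V"
    using lip by (intro lipschitz_onI) (auto simp: dist_norm)
  then have Vcont: "continuous_on UNIV V"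
    by (rule lipschitz_on_continuous_on)
  have "1-lipschitz_on UNIV W"
    using W_lip by (intro lipschitz_onI) (auto simp: dist_norm)
  then have Wcont: "continuous_on UNIV W"
    by (rule lipschitz_on_continuous_on)
  have K\<Omega>: "K \<subseteq> \<Omega>"
  proof
    fix x assume "x \<in> K"
    then have "V x \<noteq> 0"
      using h by (auto simp: K_def)
    then show "x \<in> \<Omega>"
      using V0 by blast
  qed
  have "compact K"
    unfolding compact_eq_bounded_closed
  proof
    show "bounded K"
      using K\<Omega> \<Omega>(2) bounded_subset by blast
    show "closed K"
      unfolding K_def using Vcont by (intro closed_Collect_le continuous_intros) auto
  qed
  then obtain d where d: "d > 0" "(\<Union>z\<in>K. ball z d) \<subseteq> \<Omega>"
    using compact_subset_open_imp_ball_epsilon_subset[OF _ \<Omega>(1) K\<Omega>] by blast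
  obtain R where R: "\<Omega> \<subseteq> ball 0 R"
    using bounded_subset_ballD[OF \<Omega>(2)] by blast
  have W_int: "integrable lborel W"
  proof (rule integrable_lborel_compact_support[OF Wcont])
    fix x :: 'a assume "norm x > R"
    then have "x \<notin> K"
      using K\<Omega> R by (auto dest!: subsetD)
    then show "W x = 0"
      using W_supp[of x] by (auto simp: K_def)
  qed
  obtain \<phi> :: "'a \<Rightarrow> real" where \<phi>: "mollifier (min d h) \<phi>"
    using ex_mollifier[of "min d h"] d h by auto
  note t = mollifierD(1)[OF \<phi>]
  note [measurable] = test_function_measurable[OF t] borel_measurable_integrable[OF W_int]
  obtain C where C: "c11 C \<phi> (grad \<phi>)"
    using test_function_c11[OF t] by blast
  \<comment> \<open>With the translation placed on \<open>W\<close> the mollification is an average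
    of 1-Lipschitz functions; the gradient bound follows from this.\<close>
  have w_lip: "\<bar>moll \<phi> W x - moll \<phi> W y\<bar> \<le> 1 * norm (x - y)" for x y
  proof -
    obtain B where "B > 0" and B: "\<And>x. norm (\<phi> x) \<le> B"
      using test_function_bounded[OF t, folded real_norm_def] by blast
    have int: "integrable lborel (\<lambda>z. \<phi> z * W (x - z))" for x
    proof -
      have "integrable lborel (\<lambda>z. W z *\<^sub>R \<phi> (x - z))"
        by (rule integrable_moll[OF W_int test_function_measurable[OF t] B])
      then have "integrable lborel (\<lambda>z. W (x - z) *\<^sub>R \<phi> (x - (x - z)))"
        by (subst integrable_lborel_minus_iff) auto
      then show ?thesis
        by (simp add: mult.commute)
    qed
    have "moll \<phi> W x - moll \<phi> W y = (LBINT z. \<phi> z * W (x - z) - \<phi> z * W (y - z))"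
      using int by (simp add: moll_swap)
    then have "norm (moll \<phi> W x - moll \<phi> W y) \<le> (LBINT z. \<phi> z * norm (x - y))"
    proof (rule ssubst, intro Bochner_Integration.integral_norm_bound_integral)
      show "integrable lborel (\<lambda>z. \<phi> z * W (x - z) - \<phi> z * W (y - z))"
        using int by (intro Bochner_Integration.integrable_diff)
      show "integrable lborel (\<lambda>z. \<phi> z * norm (x - y))"
        using test_function_integrable[OF t] by simp
      show "norm (\<phi> z * W (x - z) - \<phi> z * W (y - z)) \<le> \<phi> z * norm (x - y)" for z
        using mult_left_mono[OF W_lip[of "x - z" "y - z"] mollifierD(2)[OF \<phi>, of z]] mollifierD(2)[OF \<phi>, of z]
        by (simp add: abs_mult flip: right_diff_distrib)
    qed
    then show ?thesis
      using mollifierD(4)[OF \<phi>] by simp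
  qed
  show thesis
  proof (rule that)
    show c: "c11 (C * (LBINT y. norm (W y))) (moll \<phi> W) (moll (grad \<phi>) W)"
      by (rule moll_c11[OF W_int t C])
    show "norm (moll (grad \<phi>) W x) \<le> 1" for x
      by (rule lipschitz_c11_gradient_le[OF c w_lip])
    show "moll \<phi> W x = 0" if "x \<notin> \<Omega>" for x
    proof (rule moll_support[OF \<phi>])
      fix y assume y: "norm (y - x) < min d h"
      have "y \<notin> K"
        using d(2) y that by (force simp: dist_norm)
      then show "W y = 0"
        using W_supp[of y] by (auto simp: K_def)
    qed
    show "\<bar>moll \<phi> W x - V x\<bar> \<le> \<eta>" for x
    proof -
      have "\<bar>moll \<phi> W x - W x\<bar> \<le> h"
      proof (rule moll_lipschitz_close[OF \<phi> W_int])
        show "\<bar>W y - W x\<bar> \<le> h" if "norm (y - x) < min d h" for y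
          using W_lip[of y x] that by simp
      qed
      moreover have "\<eta> = h + h"
        by (simp add: h_def)
      ultimately show ?thesis
        using W_close[of x] by linarith
    qed
  qed
qed

text \<open>The linear part of the increment has energy \<open>(norm (g x))\<^sup>2\<close>, without
  the factor n; only the remainder, already small, is charged with the full second moment.\<close>

lemma c11_nonlocal_energy_le:
  fixes w :: "'a::euclidean_space \<Rightarrow> real"
  assumes w: "c11 C w g" and g: "\<And>x. norm (g x) \<le> 1" and q: "normalized_kernel \<delta> q" and "\<delta> > 0"
  shows "(\<integral>\<^sup>+ z. ennreal ((w x - w (x - z))\<^sup>2 * q z) \<partial>lborel) \<le> ennreal (1 + \<delta> + C\<^sup>2 * DIM('a) * (\<delta>\<^sup>2 + \<delta>))"
proof -
  note [measurable] = normalized_kernelD(1)[OF q]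
  note q0 = normalized_kernelD(2)[OF q]
  have C0: "C \<ge> 0"
    using c11_nonneg[OF w] .
  have "(\<integral>\<^sup>+ z. ennreal ((w x - w (x - z))\<^sup>2 * q z) \<partial>lborel) \<le>
     (\<integral>\<^sup>+ z. ennreal (1 + \<delta>) * ennreal ((g x \<bullet> z)\<^sup>2 * q z) + ennreal (C\<^sup>2 * (\<delta>\<^sup>2 + \<delta>)) * ennreal ((norm z)\<^sup>2 * q z) \<partial>lborel)"
  proof (rule nn_integral_mono_AE)
    show "AE z in lborel. ennreal ((w x - w (x - z))\<^sup>2 * q z) \<le>
       ennreal (1 + \<delta>) * ennreal ((g x \<bullet> z)\<^sup>2 * q z) + ennreal (C\<^sup>2 * (\<delta>\<^sup>2 + \<delta>)) * ennreal ((norm z)\<^sup>2 * q z)"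
      using normalized_kernelD(3)[OF q]
    proof eventually_elim
      case (elim z)
      have "(w x - w (x - z))\<^sup>2 * q z \<le> (1 + \<delta>) * ((g x \<bullet> z)\<^sup>2 * q z) + (C\<^sup>2 * (\<delta>\<^sup>2 + \<delta>)) * ((norm z)\<^sup>2 * q z)"
      proof (cases "norm z \<ge> \<delta>")
        case False
        define a b where "a = g x \<bullet> z" and "b = w x - w (x - z) - g x \<bullet> z"
        have b: "\<bar>b\<bar> \<le> C * (norm z)\<^sup>2"
          using c11D[OF w, of x "- z"] by (simp add: b_def abs_minus_commute algebra_simps)
        have "C * (norm z)\<^sup>2 \<le> C * (\<delta> * norm z)"
          using False C0 by (intro mult_left_mono) (auto simp: power2_eq_square intro: mult_right_mono)
        then have "\<bar>b\<bar> \<le> C * \<delta> * norm z"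
          using b by simp
        then have "\<bar>b\<bar>\<^sup>2 \<le> (C * \<delta> * norm z)\<^sup>2"
          by (rule power_mono) simp
        then have b2: "b\<^sup>2 \<le> C\<^sup>2 * \<delta>\<^sup>2 * (norm z)\<^sup>2"
          by (simp add: power_mult_distrib)
        \<comment> \<open>Weight \<open>\<delta>\<close> on the linear part costs only 1 + \<delta>,
          and the remainder, divided by \<delta>, is still C^2 \<delta> |z|^2 since b is at most C
          \<delta> |z|.\<close>
        have "0 \<le> (\<delta> * a - b)\<^sup>2 / \<delta>"
          using \<open>\<delta> > 0\<close> by simp
        also have "\<dots> = \<delta> * a\<^sup>2 - 2 * a * b + b\<^sup>2 / \<delta>"
          using \<open>\<delta> > 0\<close> by (simp add: power2_eq_square field_simps)
        finally have "(a + b)\<^sup>2 \<le> (1 + \<delta>) * a\<^sup>2 + (1 + 1 / \<delta>) * b\<^sup>2"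
          by (simp add: power2_sum algebra_simps)
        also have "\<dots> \<le> (1 + \<delta>) * a\<^sup>2 + (1 + 1 / \<delta>) * (C\<^sup>2 * \<delta>\<^sup>2 * (norm z)\<^sup>2)"
          using b2 \<open>\<delta> > 0\<close> by (intro add_left_mono mult_left_mono) auto
        also have "(1 + 1 / \<delta>) * (C\<^sup>2 * \<delta>\<^sup>2 * (norm z)\<^sup>2) = C\<^sup>2 * (\<delta>\<^sup>2 + \<delta>) * (norm z)\<^sup>2"
          using \<open>\<delta> > 0\<close> by (simp add: field_simps power2_eq_square)
        finally have "(a + b)\<^sup>2 * q z \<le> ((1 + \<delta>) * a\<^sup>2 + C\<^sup>2 * (\<delta>\<^sup>2 + \<delta>) * (norm z)\<^sup>2) * q z"
          using q0 by (rule mult_right_mono)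
        then show ?thesis
          by (simp add: a_def b_def distrib_right mult.assoc)
      qed (use elim in simp)
      then have "ennreal ((w x - w (x - z))\<^sup>2 * q z) \<le> ennreal ((1 + \<delta>) * ((g x \<bullet> z)\<^sup>2 * q z) + (C\<^sup>2 * (\<delta>\<^sup>2 + \<delta>)) * ((norm z)\<^sup>2 * q z))"
        by (rule ennreal_leI)
      also have "\<dots> = ennreal ((1 + \<delta>) * ((g x \<bullet> z)\<^sup>2 * q z)) + ennreal ((C\<^sup>2 * (\<delta>\<^sup>2 + \<delta>)) * ((norm z)\<^sup>2 * q z))"
        using q0[of z] \<open>\<delta> > 0\<close> by (intro ennreal_plus) auto
      also have "ennreal ((1 + \<delta>) * ((g x \<bullet> z)\<^sup>2 * q z)) = ennreal (1 + \<delta>) * ennreal ((g x \<bullet> z)\<^sup>2 * q z)"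
        using q0[of z] \<open>\<delta> > 0\<close> by (intro ennreal_mult) auto
      also have "ennreal ((C\<^sup>2 * (\<delta>\<^sup>2 + \<delta>)) * ((norm z)\<^sup>2 * q z)) = ennreal (C\<^sup>2 * (\<delta>\<^sup>2 + \<delta>)) * ennreal ((norm z)\<^sup>2 * q z)"
        using q0[of z] \<open>\<delta> > 0\<close> by (intro ennreal_mult) auto
      finally show ?case .
    qed
  qed
  also have "\<dots> = ennreal (1 + \<delta>) * ennreal ((norm (g x))\<^sup>2) + ennreal (C\<^sup>2 * (\<delta>\<^sup>2 + \<delta>)) * ennreal (real DIM('a))"
    by (simp add: nn_integral_add nn_integral_cmult normalized_kernelD(6)[OF q] normalized_kernel_second_moment(3)[OF q] del: ennreal_of_nat_eq_real_of_nat)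
  also have "\<dots> \<le> ennreal (1 + \<delta>) * ennreal 1 + ennreal (C\<^sup>2 * (\<delta>\<^sup>2 + \<delta>)) * ennreal (real DIM('a))"
    using g[of x] by (intro add_right_mono mult_left_mono ennreal_leI) (auto simp: abs_square_le_1)
  also have "\<dots> = ennreal ((1 + \<delta>) * 1 + (C\<^sup>2 * (\<delta>\<^sup>2 + \<delta>)) * real DIM('a))"
    using \<open>\<delta> > 0\<close> by (simp only: ennreal_mult'[symmetric] ennreal_plus[symmetric]) (subst ennreal_plus; simp add: ennreal_mult)
  also have "(1 + \<delta>) * 1 + (C\<^sup>2 * (\<delta>\<^sup>2 + \<delta>)) * real DIM('a) = 1 + \<delta> + C\<^sup>2 * DIM('a) * (\<delta>\<^sup>2 + \<delta>)"
    by simp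
  finally show ?thesis .
qed

definition nonlocal_competitor :: "'a::euclidean_space set \<Rightarrow> ('a \<Rightarrow> real) \<Rightarrow> ('a \<Rightarrow> real) \<Rightarrow> bool" where
  "nonlocal_competitor \<Omega> q w \<longleftrightarrow> w \<in> borel_measurable borel \<and> nonlocal_unit q w \<and> (\<forall>x. x \<notin> \<Omega> \<longrightarrow> w x = 0)"

text \<open>The approximation \<open>w\<close> is fixed before \<open>k\<close>, and with it
  \<open>C\<close>, so the energy bound \<open>A (\<delta> k)\<close> tends to one. The energy is
  quadratic, hence the scaling by the inverse square root; as \<open>w\<close> is bounded, this
  moves it uniformly little.\<close>

lemma eventually_close_competitor:
  fixes V :: "'a::euclidean_space \<Rightarrow> real" and \<delta> :: "nat \<Rightarrow> real"
  assumes lip: "\<And>x y. \<bar>V x - V y\<bar> \<le> norm (x - y)" and V0: "\<And>x. x \<notin> \<Omega> \<Longrightarrow> V x = 0" and B: "\<And>x. \<bar>V x\<bar> \<le> B"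
    and \<Omega>: "open \<Omega>" "bounded \<Omega>" and \<delta>: "\<And>k. \<delta> k > 0" "\<delta> \<longlonglongrightarrow> 0"
    and q: "\<And>k. normalized_kernel (\<delta> k) (q k)" and "\<eta> > 0"
  shows "\<forall>\<^sub>F k in sequentially. \<exists>w. nonlocal_competitor \<Omega> (q k) w \<and> (\<forall>x. \<bar>w x - V x\<bar> \<le> \<eta>)"
proof -
  obtain w g C where w: "c11 C w g" and g: "\<And>x. norm (g x) \<le> 1" and w0: "\<And>x. x \<notin> \<Omega> \<Longrightarrow> w x = 0"
    and close: "\<And>x. \<bar>w x - V x\<bar> \<le> \<eta> / 2"
  proof (rule c11_approximation[OF _ _ \<Omega>, of V "\<eta> / 2"])
    show "\<bar>V x - V y\<bar> \<le> norm (x - y)" for x y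
      by (rule lip)
    show "V x = 0" if "x \<notin> \<Omega>" for x
      using V0 that .
    show "\<eta> / 2 > 0"
      using \<open>\<eta> > 0\<close> by simp
  qed blast
  have [measurable]: "w \<in> borel_measurable borel"
    using c11_continuous[OF w] by (rule borel_measurable_continuous_onI)
  define B' where "B' = B + \<eta>"
  have B': "\<bar>w x\<bar> \<le> B'" for x
    using close[of x] B[of x] \<open>\<eta> > 0\<close> unfolding B'_def by linarith
  define A where "A t = 1 + t + C\<^sup>2 * DIM('a) * (t\<^sup>2 + t)" for t
  define l where "l k = 1 / sqrt (A (\<delta> k))" for k
  have A: "A (\<delta> k) \<ge> 1" for k
    using \<delta>(1)[of k] by (simp add: A_def)
  have l: "l k > 0" "l k \<le> 1" "(l k)\<^sup>2 * A (\<delta> k) = 1" for k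
    using A[of k] by (auto simp: l_def power_divide)
  have "(\<lambda>k. A (\<delta> k)) \<longlonglongrightarrow> 1 + 0 + C\<^sup>2 * DIM('a) * (0\<^sup>2 + 0)"
    unfolding A_def by (intro tendsto_add tendsto_mult tendsto_power tendsto_const \<delta>(2))
  then have "(\<lambda>k. A (\<delta> k)) \<longlonglongrightarrow> 1"
    by simp
  then have "(\<lambda>k. (1 - l k) * B') \<longlonglongrightarrow> (1 - 1 / sqrt 1) * B'"
    unfolding l_def by (intro tendsto_mult tendsto_diff tendsto_divide tendsto_real_sqrt tendsto_const) simp_all
  then have "(\<lambda>k. (1 - l k) * B') \<longlonglongrightarrow> 0"
    by simp
  then have "\<forall>\<^sub>F k in sequentially. (1 - l k) * B' < \<eta> / 2"
    using \<open>\<eta> > 0\<close> by (intro order_tendstoD(2)) auto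
  then show ?thesis
  proof eventually_elim
    case (elim k)
    have "nonlocal_unit (q k) (\<lambda>x. l k * w x)"
      unfolding nonlocal_unit_def
    proof (rule AE_I2)
      fix x
      note [measurable] = normalized_kernelD(1)[OF q]
      have "(\<integral>\<^sup>+ z. ennreal ((l k * w x - l k * w (x - z))\<^sup>2 * q k z) \<partial>lborel) =
        (\<integral>\<^sup>+ z. ennreal ((l k)\<^sup>2) * ennreal ((w x - w (x - z))\<^sup>2 * q k z) \<partial>lborel)"
      proof (rule nn_integral_cong)
        fix z
        have "(l k * w x - l k * w (x - z))\<^sup>2 * q k z = (l k)\<^sup>2 * ((w x - w (x - z))\<^sup>2 * q k z)"
          by (simp add: power_mult_distrib flip: right_diff_distrib)
        then show "ennreal ((l k * w x - l k * w (x - z))\<^sup>2 * q k z) = ennreal ((l k)\<^sup>2) * ennreal ((w x - w (x - z))\<^sup>2 * q k z)"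
          by (simp only: ennreal_mult' zero_le_power2)
      qed
      also have "\<dots> = ennreal ((l k)\<^sup>2) * (\<integral>\<^sup>+ z. ennreal ((w x - w (x - z))\<^sup>2 * q k z) \<partial>lborel)"
        by (rule nn_integral_cmult) measurable
      also have "\<dots> \<le> ennreal ((l k)\<^sup>2) * ennreal (A (\<delta> k))"
        using c11_nonlocal_energy_le[OF w g q \<delta>(1)] by (intro mult_left_mono) (auto simp: A_def)
      also have "\<dots> = 1"
        using l(3)[of k] by (simp flip: ennreal_mult')
      finally show "(\<integral>\<^sup>+ z. ennreal ((l k * w x - l k * w (x - z))\<^sup>2 * q k z) \<partial>lborel) \<le> 1" .
    qed
    moreover have "\<bar>l k * w x - V x\<bar> \<le> \<eta>" for x
    proof -
      have "\<bar>l k * w x - w x\<bar> = (1 - l k) * \<bar>w x\<bar>"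
      proof -
        have "l k * w x - w x = - ((1 - l k) * w x)"
          by (simp add: algebra_simps)
        then show ?thesis
          using l(2)[of k] by (simp add: abs_mult)
      qed
      also have "\<dots> \<le> (1 - l k) * B'"
        using l(2)[of k] B' by (intro mult_left_mono) auto
      finally have "\<bar>l k * w x - w x\<bar> \<le> \<eta> / 2"
        using elim by linarith
      then show ?thesis
        using close[of x] by linarith
    qed
    ultimately show ?case
      using w0 by (intro exI[of _ "\<lambda>x. l k * w x"]) (auto simp: nonlocal_competitor_def)
  qed
qed

text \<open>In place of a diagonal sequence each \<open>k\<close> takes a competitor whose distance
  to \<open>V\<close> is within 1/(k+1) of the best possible; the preceding lemma sends the best
  distance to zero. The zero function guarantees that competitors exist for every
  \<open>k\<close>.\<close>

lemma close_competitor_sequence: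
  fixes V :: "'a::euclidean_space \<Rightarrow> real" and \<delta> :: "nat \<Rightarrow> real"
  assumes lip: "\<And>x y. \<bar>V x - V y\<bar> \<le> norm (x - y)" and V0: "\<And>x. x \<notin> \<Omega> \<Longrightarrow> V x = 0" and B: "\<And>x. \<bar>V x\<bar> \<le> B"
    and \<Omega>: "open \<Omega>" "bounded \<Omega>" and \<delta>: "\<And>k. \<delta> k > 0" "\<delta> \<longlonglongrightarrow> 0"
    and q: "\<And>k. normalized_kernel (\<delta> k) (q k)"
  obtains ws \<eta> where "\<And>k. nonlocal_competitor \<Omega> (q k) (ws k)" "\<And>k x. \<bar>ws k x - V x\<bar> \<le> \<eta> k" "\<eta> \<longlonglongrightarrow> 0"
proof -
  define S where "S k = {t. t \<ge> 0 \<and> (\<exists>w. nonlocal_competitor \<Omega> (q k) w \<and> (\<forall>x. \<bar>w x - V x\<bar> \<le> t))}" for k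
  have "nonlocal_competitor \<Omega> (q k) (\<lambda>x. 0)" for k
    by (simp add: nonlocal_competitor_def nonlocal_unit_def)
  then have "B \<in> S k" for k
    using B order_trans[OF abs_ge_zero B] by (auto simp: S_def intro!: exI[of _ "\<lambda>x. 0"])
  then have ne: "S k \<noteq> {}" for k
    by blast
  have bdd: "bdd_below (S k)" for k
    by (rule bdd_belowI[of _ 0]) (simp add: S_def)
  have "\<exists>t\<in>S k. t < Inf (S k) + 1 / real (Suc k)" for k
    using ne bdd by (subst cInf_less_iff[symmetric]) auto
  then obtain \<eta> where \<eta>: "\<And>k. \<eta> k \<in> S k" "\<And>k. \<eta> k < Inf (S k) + 1 / real (Suc k)"
    by metis
  have "\<eta> \<longlonglongrightarrow> 0"
  proof (rule LIMSEQ_I)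
    fix r :: real assume "r > 0"
    then have r2: "r / 2 > 0"
      by simp
    have "\<forall>\<^sub>F k in sequentially. \<exists>w. nonlocal_competitor \<Omega> (q k) w \<and> (\<forall>x. \<bar>w x - V x\<bar> \<le> r / 2)"
      by (rule eventually_close_competitor[OF lip V0 B \<Omega> \<delta> q r2])
    moreover have "(\<lambda>k. 1 / real (Suc k)) \<longlonglongrightarrow> 0"
      using LIMSEQ_inverse_real_of_nat by (simp add: inverse_eq_divide)
    then have "\<forall>\<^sub>F k in sequentially. 1 / real (Suc k) < r / 2"
      using r2 by (rule order_tendstoD(2))
    ultimately have "\<forall>\<^sub>F k in sequentially. norm (\<eta> k - 0) < r"
    proof eventually_elim
      case (elim k)
      then have "r / 2 \<in> S k"
        using r2 by (simp add: S_def)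
      then have "Inf (S k) \<le> r / 2"
        using bdd by (rule cInf_lower)
      then show ?case
        using \<eta>(2)[of k] \<eta>(1)[of k] elim by (simp add: S_def)
    qed
    then show "\<exists>no. \<forall>n\<ge>no. norm (\<eta> n - 0) < r"
      by (simp add: eventually_sequentially)
  qed
  moreover obtain ws where "\<And>k. nonlocal_competitor \<Omega> (q k) (ws k)" "\<And>k x. \<bar>ws k x - V x\<bar> \<le> \<eta> k"
  proof -
    have "\<exists>w. nonlocal_competitor \<Omega> (q k) w \<and> (\<forall>x. \<bar>w x - V x\<bar> \<le> \<eta> k)" for k
      using \<eta>(1)[of k] by (simp add: S_def)
    then show thesis
      using that by metis
  qed
  ultimately show thesis
    using that by blast
qed

section \<open>From uniform approximation to recovery in L2\<close>

lemma L2_bounded_borel: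
  fixes w :: "'a::euclidean_space \<Rightarrow> real"
  assumes "open \<Omega>" "bounded \<Omega>" and w: "w \<in> borel_measurable borel" and B: "\<And>x. \<bar>w x\<bar> \<le> B"
  shows "L2 \<Omega> w"
proof -
  interpret finite_measure "lebesgue_on \<Omega>"
    using assms by (intro finite_measure_lebesgue_on lmeasurable_open)
  have [measurable]: "w \<in> borel_measurable (lebesgue_on \<Omega>)"
    using w by (intro measurable_restrict_space1 measurable_completion) simp
  have "(w x)\<^sup>2 \<le> B\<^sup>2" for x
    using power_mono[OF B[of x] abs_ge_zero, of 2] by simp
  then have "integrable (lebesgue_on \<Omega>) (\<lambda>x. (w x)\<^sup>2)"
    by (intro integrable_const_bound[where B="B\<^sup>2"]) auto
  then show ?thesis
    by (simp add: L2_def)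
qed

lemma L2_conv_uniform:
  fixes \<Omega> :: "'a::euclidean_space set"
  assumes \<Omega>: "open \<Omega>" "bounded \<Omega>" and V: "AE x in lborel. V x = zext \<Omega> u x"
    and close: "\<And>k x. \<bar>ws k x - V x\<bar> \<le> \<eta> k" and \<eta>: "\<eta> \<longlonglongrightarrow> 0"
  shows "L2_conv \<Omega> ws u"
  unfolding L2_conv_def
proof (rule tendsto_sandwich[OF always_eventually always_eventually tendsto_const])
  have meas: "\<Omega> \<inter> space lebesgue \<in> sets lebesgue"
    using \<Omega> by auto
  interpret finite_measure "lebesgue_on \<Omega>"
    using \<Omega> by (intro finite_measure_lebesgue_on lmeasurable_open)
  define m where "m = measure (lebesgue_on \<Omega>) (space (lebesgue_on \<Omega>))"
  have ae: "AE x in lebesgue_on \<Omega>. V x = u x"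
    unfolding AE_restrict_space_iff[OF meas] AE_completion_iff
    using V by eventually_elim (simp add: zext_def)
  show "\<forall>k. (\<integral>\<^sup>+ x. ennreal ((ws k x - u x)\<^sup>2) \<partial>lebesgue_on \<Omega>) \<le> ennreal ((\<eta> k)\<^sup>2 * m)"
  proof
    fix k
    have "(\<integral>\<^sup>+ x. ennreal ((ws k x - u x)\<^sup>2) \<partial>lebesgue_on \<Omega>) \<le> (\<integral>\<^sup>+ x. ennreal ((\<eta> k)\<^sup>2) \<partial>lebesgue_on \<Omega>)"
    proof (rule nn_integral_mono_AE)
      show "AE x in lebesgue_on \<Omega>. ennreal ((ws k x - u x)\<^sup>2) \<le> ennreal ((\<eta> k)\<^sup>2)"
        using ae
      proof eventually_elim
        case (elim x)
        then show ?case
          using power_mono[OF close[of k x] abs_ge_zero, of 2] by (intro ennreal_leI) simp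
      qed
    qed
    also have "\<dots> = ennreal ((\<eta> k)\<^sup>2 * m)"
      unfolding m_def by (simp add: emeasure_eq_measure ennreal_mult')
    finally show "(\<integral>\<^sup>+ x. ennreal ((ws k x - u x)\<^sup>2) \<partial>lebesgue_on \<Omega>) \<le> ennreal ((\<eta> k)\<^sup>2 * m)" .
  qed
  have "(\<lambda>k. ennreal ((\<eta> k)\<^sup>2 * m)) \<longlonglongrightarrow> ennreal (0\<^sup>2 * m)"
    by (intro tendsto_ennrealI tendsto_intros \<eta>)
  then show "(\<lambda>k. ennreal ((\<eta> k)\<^sup>2 * m)) \<longlonglongrightarrow> 0"
    by simp
qed simp

lemma recovery_sequence:
  fixes \<Omega> :: "'a::euclidean_space set" and \<delta> :: "nat \<Rightarrow> real"
  assumes \<Omega>: "open \<Omega>" "bounded \<Omega>" "lipschitz_boundary \<Omega>" and u: "L2 \<Omega> u" and W: "W1inf0_unit \<Omega> u"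
    and \<delta>: "\<And>k. \<delta> k > 0" "\<delta> \<longlonglongrightarrow> 0" and w: "\<And>k. admissible_kernel (\<delta> k) (w k)"
  obtains us where "\<And>k. L2 \<Omega> (us k)" "L2_conv \<Omega> us u"
    "\<And>k. in_unit_ball_Linf2 (nbhd \<Omega> (\<delta> k)) (Gdelta \<Omega> (w k) (us k))"
proof -
  obtain V where lip: "\<And>x y. \<bar>V x - V y\<bar> \<le> norm (x - y)" and V0: "\<And>x. x \<notin> \<Omega> \<Longrightarrow> V x = 0"
    and Vu: "AE x in lborel. V x = zext \<Omega> u x"
    using W1inf0_unit_lipschitz_representative[OF \<Omega> u W] by blast
  have "\<Omega> \<noteq> UNIV"
    using \<Omega>(2) not_bounded_UNIV by blast
  \<comment> \<open>A zero of \<open>V\<close> off the bounded set: the unit Lipschitz bound then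
    limits \<open>V\<close> by the radius of a ball around \<open>p\<close>.\<close>
  then obtain p where p: "p \<notin> \<Omega>"
    by blast
  obtain R where R: "\<Omega> \<subseteq> ball p R"
    using bounded_subset_ballD[OF \<Omega>(2)] by blast
  have B: "\<bar>V x\<bar> \<le> \<bar>R\<bar>" for x
  proof (cases "x \<in> \<Omega>")
    case True
    then have "norm (x - p) < R"
      using R by (auto simp: dist_norm norm_minus_commute dest: subsetD)
    then show ?thesis
      using lip[of x p] V0[OF p] by simp
  qed (simp add: V0)
  have "\<exists>q. normalized_kernel (\<delta> k) q \<and> (AE z in lborel. (w k z)\<^sup>2 = q z)" for k
    using admissible_kernel_normalized[OF w] by blast
  then obtain q where q: "\<And>k. normalized_kernel (\<delta> k) (q k)" "\<And>k. AE z in lborel. (w k z)\<^sup>2 = q k z"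
    by metis
  obtain ws \<eta> where ws: "\<And>k. nonlocal_competitor \<Omega> (q k) (ws k)" and close: "\<And>k x. \<bar>ws k x - V x\<bar> \<le> \<eta> k" and \<eta>: "\<eta> \<longlonglongrightarrow> 0"
    using close_competitor_sequence[OF lip V0 B \<Omega>(1,2) \<delta> q(1)] by blast
  show thesis
  proof (rule that)
    fix k
    have "\<bar>ws k x\<bar> \<le> \<bar>R\<bar> + \<eta> k" for x
      using close[of k x] B[of x] by linarith
    then show "L2 \<Omega> (ws k)"
      using ws[of k] by (intro L2_bounded_borel \<Omega>(1,2)) (auto simp: nonlocal_competitor_def)
    have z: "zext \<Omega> (ws k) = ws k"
      using ws[of k] by (auto simp: nonlocal_competitor_def zext_def)
    show "in_unit_ball_Linf2 (nbhd \<Omega> (\<delta> k)) (Gdelta \<Omega> (w k) (ws k))"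
    proof (subst in_unit_ball_iff_nonlocal_unit)
      show "norm z < \<delta> k" if "w k z \<noteq> 0" for z
        using w[of k] that unfolding admissible_kernel_def by (metis mem_ball_0)
      show "AE y in lborel. ws k y = zext \<Omega> (ws k) y"
        by (simp add: z)
      show "nonlocal_unit (q k) (ws k)" "ws k \<in> borel_measurable borel"
        using ws[of k] by (auto simp: nonlocal_competitor_def)
    qed (use \<delta>(1) q(2) normalized_kernelD(1)[OF q(1)] in auto)
  next
    show "L2_conv \<Omega> ws u"
      by (rule L2_conv_uniform[OF \<Omega>(1,2) Vu close \<eta>])
  qed
qed

section \<open>Gamma-convergence\<close>

theorem theorem5p3:
  fixes \<Omega> :: "'a::euclidean_space set"
    and f :: "'a \<Rightarrow> real"
    and \<omega> :: "real \<Rightarrow> 'a \<Rightarrow> real"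
  assumes "DIM('a) \<ge> 2"
    and "open \<Omega>" and "bounded \<Omega>" and "connected \<Omega>"
    and "lipschitz_boundary \<Omega>"
    and "L2 \<Omega> f"
    and "\<And>\<delta>. \<delta> > 0 \<Longrightarrow> admissible_kernel \<delta> (\<omega> \<delta>)"
  shows "Gamma_conv_L2 \<Omega> (\<lambda>\<delta> u. Fdelta \<Omega> f \<delta> (\<omega> \<delta>) u) (F0 \<Omega> f)"
  unfolding Gamma_conv_L2_def
proof (intro allI impI)
  fix \<delta>s :: "nat \<Rightarrow> real" and u
  assume pos: "\<forall>k. 0 < \<delta>s k" and lim: "\<delta>s \<longlonglongrightarrow> 0" and u: "L2 \<Omega> u"
  let ?F = "\<lambda>us k. Fdelta \<Omega> f (\<delta>s k) (\<omega> (\<delta>s k)) (us k)"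
  let ?J = "\<lambda>u. \<integral>x. f x * u x \<partial>lebesgue_on \<Omega>"
  have w: "admissible_kernel (\<delta>s k) (\<omega> (\<delta>s k))" for k
    using assms(7) pos by blast
  have J_conv: "(\<lambda>k. ereal (- ?J (us k))) \<longlonglongrightarrow> ereal (- ?J u)"
    if "\<And>k. L2 \<Omega> (us k)" "L2_conv \<Omega> us u" for us
    using L2_conv_linear_functional[OF that(1) u that(2) assms(6)] by (intro tendsto_intros) auto
  show "(\<forall>us. (\<forall>k. L2 \<Omega> (us k)) \<longrightarrow> L2_conv \<Omega> us u \<longrightarrow> F0 \<Omega> f u \<le> liminf (?F us)) \<and>
    (\<exists>us. (\<forall>k. L2 \<Omega> (us k)) \<and> L2_conv \<Omega> us u \<and> limsup (?F us) \<le> F0 \<Omega> f u)"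
  proof (intro conjI allI impI)
    fix us assume us: "\<forall>k. L2 \<Omega> (us k)" and conv: "L2_conv \<Omega> us u"
    show "F0 \<Omega> f u \<le> liminf (?F us)"
    proof (cases "W1inf0_unit \<Omega> u")
      case True
      \<comment> \<open>For admissible \<open>u\<close> the lower bound is immediate: the indicator
        only adds to a continuous functional.\<close>
      have "F0 \<Omega> f u = liminf (\<lambda>k. ereal (- ?J (us k)))"
        using lim_imp_Liminf[OF _ J_conv[OF _ conv]] us True by (simp add: F0_def)
      also have "\<dots> \<le> liminf (?F us)"
        by (intro Liminf_mono always_eventually) (auto simp: Fdelta_def)
      finally show ?thesis .
    next
      case False
      \<comment> \<open>Here the lower limit has to be infinite. If the constraint held for
        infinitely many indices, the subsequence of these would put \<open>u\<close> into the limit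
        class.\<close>
      define S where "S = {k. in_unit_ball_Linf2 (nbhd \<Omega> (\<delta>s k)) (Gdelta \<Omega> (\<omega> (\<delta>s k)) (us k))}"
      have "finite S"
      proof (rule ccontr)
        assume "infinite S"
        then obtain r :: "nat \<Rightarrow> nat" where r: "strict_mono r" "\<And>n. r n \<in> S"
          using infinite_enumerate by blast
        have "W1inf0_unit \<Omega> u"
        proof (rule nonlocal_limit_W1inf0_unit[OF assms(2,3) _ u])
          show "L2 \<Omega> ((us \<circ> r) k)" for k
            using us by simp
          show "L2_conv \<Omega> (us \<circ> r) u"
            using LIMSEQ_subseq_LIMSEQ[OF _ r(1)] conv by (auto simp: L2_conv_def o_def)
          show "(\<delta>s \<circ> r) k > 0" for k
            using pos by simp
          show "(\<delta>s \<circ> r) \<longlonglongrightarrow> 0"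
            using lim r(1) by (rule LIMSEQ_subseq_LIMSEQ)
          show "admissible_kernel ((\<delta>s \<circ> r) k) (\<omega> ((\<delta>s \<circ> r) k))" for k
            using w by simp
          show "in_unit_ball_Linf2 (nbhd \<Omega> ((\<delta>s \<circ> r) k)) (Gdelta \<Omega> (\<omega> ((\<delta>s \<circ> r) k)) ((us \<circ> r) k))" for k
            using r(2)[of k] by (simp add: S_def)
        qed
        with False show False ..
      qed
      then have "\<forall>\<^sub>F k in sequentially. k \<notin> S"
        by (simp add: cofinite_eq_sequentially[symmetric] eventually_cofinite)
      then have "\<forall>\<^sub>F k in sequentially. ?F us k = \<infinity>"
        by eventually_elim (simp add: S_def Fdelta_def)
      then have "liminf (?F us) = \<infinity>"
        by (intro lim_imp_Liminf tendsto_eventually) auto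
      then show ?thesis
        by simp
    qed
  next
    show "\<exists>us. (\<forall>k. L2 \<Omega> (us k)) \<and> L2_conv \<Omega> us u \<and> limsup (?F us) \<le> F0 \<Omega> f u"
    proof (cases "W1inf0_unit \<Omega> u")
      case True
      obtain us where us: "\<And>k. L2 \<Omega> (us k)" "L2_conv \<Omega> us u"
        "\<And>k. in_unit_ball_Linf2 (nbhd \<Omega> (\<delta>s k)) (Gdelta \<Omega> (\<omega> (\<delta>s k)) (us k))"
        using recovery_sequence[OF assms(2,3,5) u True _ lim w] pos by blast
      then have "?F us = (\<lambda>k. ereal (- ?J (us k)))"
        by (simp add: Fdelta_def)
      then have "limsup (?F us) = F0 \<Omega> f u"
        using lim_imp_Limsup[OF _ J_conv[OF us(1,2)]] True by (simp add: F0_def)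
      then show ?thesis
        using us by (intro exI[of _ us]) auto
    next
      case False
      \<comment> \<open>With \<open>F0\<close> infinite any convergent sequence recovers it, for
        instance the constant one.\<close>
      then show ?thesis
        using u by (intro exI[of _ "\<lambda>_. u"]) (simp add: F0_def L2_conv_def)
    qed
  qed
qed

end
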